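(* Let $T>0$ and let $\mathbf Z:[-T,T]\to\mathbb R^{2N}$ be a solution of $\dot{\mathbf Z}\in\operatorname{co}F(\mathbf Z)$, $\mathbf Z(0)=\mathbf Z_0$, where $\mathbf Z_0\in\mathcal D(F)$. Assume that there exist $t_1\in(-T,T)$ and $\mathbf Z_1\in\mathcal I_\ell$, for some $\ell\in\{1,\dots,N\}$, such that $\mathbf Z(t_1)=\mathbf Z_1$ and $$\widehat{\mathbf f}^-(\mathbf Z_1)\cdot\mathbf n(\mathbf Z_1)>0\qquad\text{and}\qquad\widehat{\mathbf f}^+(\mathbf Z_1)\cdot\mathbf n(\mathbf Z_1)>0,$$ where $\widehat{\mathbf f}^\pm$, $\mathbf n$, $V^\pm$ are associated with the base point $\hat{\mathbf Z}=\mathbf Z_1$ (see context). Then uniqueness holds for $\dot{\mathbf Z}\in\operatorname{co}F(\mathbf Z)$ at the point $(t_1,\mathbf Z_1)$ and the solution passes from $V^-$ to $V^+$. Similarly, if $$\widehat{\mathbf f}^-(\mathbf Z_1)\cdot\mathbf n(\mathbf Z_1)<0\qquad\text{and}\qquad\widehat{\mathbf f}^+(\mathbf Z_1)\cdot\mathbf n(\mathbf Z_1)<0,$$ then uniqueness holds for $\dot{\mathbf Z}\in\operatorname{co}F(\mathbf Z)$ at the point $(t_1,\mathbf Z_1)$ and the solution passes from $V^+$ to $V^-$.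
   Context: Setting. $\Omega\subset\mathbb R^2$ is a bounded simply connected open set with $C^{2,\gamma}$ boundary for some $\gamma\in(0,1)$, with outer unit normal $\mathbf n_\Omega$; $N\ge1$ is an integer, and $b_1,\dots,b_N\in\mathbb R$ are the Burgers moduli. Let $\mu>0$, $\lambda\neq0$ and $$\mathbf L=\begin{pmatrix}\mu&0\\0&\mu\lambda^2\end{pmatrix},\quad \mathbf J=\begin{pmatrix}0&1\\-1&0\end{pmatrix},\quad \boldsymbol\Lambda=\begin{pmatrix}\lambda&0\\0&1\end{pmatrix},\quad \mathbf k_i(\mathbf x;\mathbf y)=\frac{b_i}{2\pi}\frac{\lambda\mathbf J^T(\mathbf x-\mathbf y)}{|\boldsymbol\Lambda(\mathbf x-\mathbf y)|^2}\ (\mathbf x\ne\mathbf y).$$ Set $\mathcal D(F)=\{\mathbf Z=(\mathbf z_1,\dots,\mathbf z_N)\in\Omega^N:\ \mathbf z_j\neq\mathbf z_k\text{ for all }j\ne k\}\subset\mathbb R^{2N}$. For $\mathbf Z\in\mathcal D(F)$ let $u_0(\cdot;\mathbf z_1,\dots,\mathbf z_N)$ be the solution (unique up to an additive constant) of the Neumann problem $\operatorname{div}(\mathbf L\nabla_{\mathbf x}u_0)=0$ in $\Omega$, $\mathbf L(\nabla_{\mathbf x}u_0+\sum_{i=1}^N\mathbf k_i(\mathbf x;\mathbf z_i))\cdot\mathbf n_\Omega(\mathbf x)=0$ on $\partial\Omega$. The Peach-Köhler force on the $\ell$-th dislocation is $$\mathbf j_\ell(\mathbf Z)=b_\ell\,\mathbf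 J\mathbf L\Big[\sum_{i\ne\ell}\mathbf k_i(\mathbf z_\ell;\mathbf z_i)+\nabla_{\mathbf x}u_0(\mathbf z_\ell;\mathbf z_1,\dots,\mathbf z_N)\Big].$$ The set of glide directions $\mathcal G\subset S^1$ is a finite set of unit vectors of $\mathbb R^2$ with $-\mathbf g\in\mathcal G$ whenever $\mathbf g\in\mathcal G$ and $\operatorname{span}\mathcal G=\mathbb R^2$. Set $\mathcal G_\ell(\mathbf Z)=\arg\max_{\mathbf g\in\mathcal G}\{\mathbf j_\ell(\mathbf Z)\cdot\mathbf g\}$, $F_\ell(\mathbf Z)=\{(\mathbf j_\ell(\mathbf Z)\cdot\mathbf g)\mathbf g:\mathbf g\in\mathcal G_\ell(\mathbf Z)\}$, $F(\mathbf Z)=F_1(\mathbf Z)\times\cdots\times F_N(\mathbf Z)\subset\mathbb R^{2N}$. $\operatorname{co}$ denotes the convex hull. A solution of $\dot{\mathbf Z}\in\operatorname{co}F(\mathbf Z)$ on an interval $I$ is an absolutely continuous function $\mathbf Z$ on $I$ with $\mathbf Z(t)\in\mathcal D(F)$ for $t\in I$ and $\dot{\mathbf Z}(t)\in\operatorname{co}F(\mathbf Z(t))$ for a.e. $t\in I$. Ambiguity sets. $\mathcal A_\ell=\{\mathbf Z\in\mathcal D(F):\operatorname{card}\mathcal G_\ell(\mathbf Z)=2\}$; for $\mathbf Z\in\mathcal A_\ell$ write $\mathcal G_\ell(\mathbf Z)=\{\mathbf g_\ell^+(\mathbf Z),\mathbf g_\ell^-(\mathbf Z)\}$. If $\mathcal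 G_k(\mathbf Z)$ is a singleton, its element is denoted $\mathbf g_k(\mathbf Z)$. The singular set $\mathcal S_\ell$ is the set of $\mathbf Z^*\in\mathcal A_\ell$ such that, with the constant vector $\mathbf g_0=\mathbf g_\ell^+(\mathbf Z^* )-\mathbf g_\ell^-(\mathbf Z^* )$, the function $\mathbf Z\mapsto\mathbf j_\ell(\mathbf Z)\cdot\mathbf g_0$ and its full gradient in $\mathbb R^{2N}$ both vanish at $\mathbf Z^*$. Further, $\mathcal E_{\rm int}=\{\mathbf Z:\mathbf Z\in\mathcal A_\ell\cap\mathcal A_j\text{ for some }\ell\ne j\}$, $\mathcal E_{\rm zero}=\{\mathbf Z\in\mathcal D(F):\mathbf j_k(\mathbf Z)=\mathbf 0\text{ for some }k\}$, and $\mathcal I_\ell=\mathcal A_\ell\setminus(\mathcal S_\ell\cup\mathcal E_{\rm int}\cup\mathcal E_{\rm zero})$. Local fields. Let $\hat{\mathbf Z}\in\mathcal I_\ell$. For $r>0$ small, $\mathcal A_\ell\cap B_r(\hat{\mathbf Z})$ is a smooth $(2N-1)$-dimensional manifold dividing $B_r(\hat{\mathbf Z})\subset\mathcal D(F)$ into two disjoint open sets $V^\pm$ such that $\mathcal G_\ell(\mathbf Z)=\{\mathbf g_\ell^\pm(\hat{\mathbf Z})\}$ for $\mathbf Z\in V^\pm$ (respectively), and $\mathcal G_k(\mathbf Z)=\{\mathbf g_k(\hat{\mathbf Z})\}$ on $B_r(\hat{\mathbf Z})$ for $k\neq\ell$. On $B_r(\hat{\mathbf Z})$ define $\widehat{\mathbf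 f}^\pm=(\widehat{\mathbf f}^\pm_1,\dots,\widehat{\mathbf f}^\pm_N)$ by $\widehat{\mathbf f}^\pm_k(\mathbf Z)=(\mathbf j_k(\mathbf Z)\cdot\mathbf g_k(\hat{\mathbf Z}))\mathbf g_k(\hat{\mathbf Z})$ for $k\ne\ell$ and $\widehat{\mathbf f}^\pm_\ell(\mathbf Z)=(\mathbf j_\ell(\mathbf Z)\cdot\mathbf g^\pm_\ell(\hat{\mathbf Z}))\mathbf g^\pm_\ell(\hat{\mathbf Z})$. $\mathbf n(\mathbf Z)$ is the unit normal to $\mathcal A_\ell$ at $\mathbf Z\in\mathcal A_\ell\cap B_r(\hat{\mathbf Z})$ directed from $V^-$ to $V^+$. Uniqueness at $(t_1,\mathbf Z_1)$ means both right and left uniqueness: there exist $s_1<t_1<s_2$ such that any two solutions of the inclusion taking the value $\mathbf Z_1$ at time $t_1$ coincide on the subset of $[s_1,s_2]$ on which they are both defined. "The solution passes from $V^-$ to $V^+$" means that there exist $s_1<t_1<s_2$ such that $\mathbf Z(t)\in V^-$ for $t\in[s_1,t_1)$ and $\mathbf Z(t)\in V^+$ for $t\in(t_1,s_2]$; analogously with the roles of $V^\pm$ exchanged. *)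

theory Defs
  imports "HOL-Analysis.Analysis"
begin

definition grad :: "('a::real_inner \<Rightarrow> real) \<Rightarrow> 'a \<Rightarrow> 'a" where
  "grad f x = (THE D. GDERIV f x :> D)"

definition divergence :: "(real^'m \<Rightarrow> real^'m) \<Rightarrow> real^'m \<Rightarrow> real" where
  "divergence V x = trace (jacobian V (at x))"

definition C2_on :: "('a::euclidean_space) set \<Rightarrow> ('a \<Rightarrow> real) \<Rightarrow> bool" where
  "C2_on \<Omega> u \<longleftrightarrow>
     (\<forall>x\<in>\<Omega>. u differentiable (at x)) \<and>
     (\<forall>x\<in>\<Omega>. grad u differentiable (at x)) \<and>
     (\<forall>v. continuous_on \<Omega> (\<lambda>x. frechet_derivative (grad u) (at x) v))"

definition C2_holder :: "real \<Rightarrow> (real \<Rightarrow> real) \<Rightarrow> bool" where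
  "C2_holder \<gamma> \<phi> \<longleftrightarrow>
     (\<forall>s. \<phi> differentiable (at s)) \<and>
     (\<forall>s. deriv \<phi> differentiable (at s)) \<and>
     (\<exists>C. \<forall>s t. \<bar>deriv (deriv \<phi>) s - deriv (deriv \<phi>) t\<bar> \<le> C * \<bar>s - t\<bar> powr \<gamma>)"

definition absolutely_continuous_on ::
    "real set \<Rightarrow> (real \<Rightarrow> 'a::real_normed_vector) \<Rightarrow> bool" where
  "absolutely_continuous_on I f \<longleftrightarrow>
     (\<forall>\<epsilon>>0. \<exists>\<delta>>0. \<forall>(m::nat) a b.
        (\<forall>i<m. a i \<le> b i \<and> {a i..b i} \<subseteq> I) \<and>
        (\<forall>i<m. \<forall>j<m. i \<noteq> j \<longrightarrow> {a i<..<b i} \<inter> {a j<..<b j} = {}) \<and>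
        (\<Sum>i<m. b i - a i) < \<delta>
        \<longrightarrow> (\<Sum>i<m. norm (f (b i) - f (a i))) < \<epsilon>)"

text \<open>
  Near \<^term>\<open>p\<close>, in the orthonormal frame \<^term>\<open>e1\<close>, \<^term>\<open>e2\<close> centred at \<^term>\<open>p\<close>, the set
  lies strictly below the graph of \<^term>\<open>\<phi>\<close>; so for \<^term>\<open>p\<close> in the frontier and continuous
  \<^term>\<open>\<phi>\<close> one has \<^prop>\<open>\<phi> 0 = 0\<close>.
\<close>

definition local_graph ::
    "(real^2) set \<Rightarrow> real^2 \<Rightarrow> real \<Rightarrow> real^2 \<Rightarrow> real^2 \<Rightarrow> (real \<Rightarrow> real) \<Rightarrow> bool" where
  "local_graph \<Omega> p r e1 e2 \<phi> \<longleftrightarrow>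
     r > 0 \<and> norm e1 = 1 \<and> norm e2 = 1 \<and> e1 \<bullet> e2 = 0 \<and>
     \<Omega> \<inter> ball p r = {x \<in> ball p r. (x - p) \<bullet> e2 < \<phi> ((x - p) \<bullet> e1)}"

definition C2_holder_boundary :: "real \<Rightarrow> (real^2) set \<Rightarrow> bool" where
  "C2_holder_boundary \<gamma> \<Omega> \<longleftrightarrow>
     (\<forall>p\<in>frontier \<Omega>. \<exists>r e1 e2 \<phi>. local_graph \<Omega> p r e1 e2 \<phi> \<and> C2_holder \<gamma> \<phi>)"

definition outer_unit_normal :: "(real^2) set \<Rightarrow> real^2 \<Rightarrow> real^2 \<Rightarrow> bool" where
  "outer_unit_normal \<Omega> p \<nu> \<longleftrightarrow>
     (\<exists>r e1 e2 \<phi>. local_graph \<Omega> p r e1 e2 \<phi> \<and> (\<forall>s. \<phi> differentiable (at s)) \<and>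
        \<nu> = (1 / sqrt (1 + (deriv \<phi> 0)\<^sup>2)) *\<^sub>R (e2 - deriv \<phi> 0 *\<^sub>R e1))"

definition L_mat :: "real \<Rightarrow> real \<Rightarrow> real^2^2" where
  "L_mat \<mu> lam = vector [vector [\<mu>, 0], vector [0, \<mu> * lam\<^sup>2]]"

definition J_mat :: "real^2^2" where
  "J_mat = vector [vector [0, 1], vector [- 1, 0]]"

definition Lambda_mat :: "real \<Rightarrow> real^2^2" where
  "Lambda_mat lam = vector [vector [lam, 0], vector [0, 1]]"

definition strain_kernel :: "real \<Rightarrow> real \<Rightarrow> real^2 \<Rightarrow> real^2 \<Rightarrow> real^2" where
  "strain_kernel lam \<beta> x y =
     (\<beta> / (2 * pi)) *\<^sub>R
       ((lam / (norm (Lambda_mat lam *v (x - y)))\<^sup>2) *\<^sub>R (transpose J_mat *v (x - y)))"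

text \<open>
  A configuration of the dislocations is a vector indexed by a finite type \<^typ>\<open>'n\<close>, which
  plays the role of \<open>{1..N}\<close>; the inner product of \<^typ>\<open>real^2^'n\<close> is the Euclidean one
  of dimension \<open>2 N\<close>.
\<close>

definition config_domain :: "(real^2) set \<Rightarrow> (real^2^'n) set" where
  "config_domain \<Omega> = {Z. (\<forall>i. Z $ i \<in> \<Omega>) \<and> (\<forall>j k. j \<noteq> k \<longrightarrow> Z $ j \<noteq> Z $ k)}"

text \<open>
  Classical solution of the Neumann problem, of class \<open>C\<^sup>2\<close> in the domain and
  \<open>C\<^sup>1\<close> up to the boundary: \<^term>\<open>w\<close> is the continuous extension of the gradient to the
  closure, and the boundary condition is imposed on \<^term>\<open>w\<close>.
\<close>

definition neumann_solution ::
    "(real^2) set \<Rightarrow> real \<Rightarrow> real \<Rightarrow> ('n \<Rightarrow> real) \<Rightarrow> real^2^'n::finite \<Rightarrow> (real^2 \<Rightarrow> real) \<Rightarrow> bool" where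
  "neumann_solution \<Omega> \<mu> lam b Z u \<longleftrightarrow>
     C2_on \<Omega> u \<and> continuous_on (closure \<Omega>) u \<and>
     (\<forall>x\<in>\<Omega>. divergence (\<lambda>y. L_mat \<mu> lam *v grad u y) x = 0) \<and>
     (\<exists>w. continuous_on (closure \<Omega>) w \<and> (\<forall>x\<in>\<Omega>. w x = grad u x) \<and>
        (\<forall>x\<in>frontier \<Omega>. \<forall>\<nu>. outer_unit_normal \<Omega> x \<nu> \<longrightarrow>
           (L_mat \<mu> lam *v (w x + (\<Sum>i\<in>UNIV. strain_kernel lam (b i) x (Z $ i)))) \<bullet> \<nu> = 0))"

text \<open>The force only involves the gradient of \<^term>\<open>u0 Z\<close>, so the free additive constant is
  irrelevant.\<close>

definition pk_force ::
    "real \<Rightarrow> real \<Rightarrow> ('n \<Rightarrow> real) \<Rightarrow> (real^2^'n::finite \<Rightarrow> real^2 \<Rightarrow> real) \<Rightarrow> 'n \<Rightarrow> real^2^'n \<Rightarrow> real^2" where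
  "pk_force \<mu> lam b u0 l Z =
     b l *\<^sub>R ((J_mat ** L_mat \<mu> lam) *v
       ((\<Sum>i\<in>UNIV - {l}. strain_kernel lam (b i) (Z $ l) (Z $ i)) + grad (u0 Z) (Z $ l)))"

definition glide_directions :: "(real^2) set \<Rightarrow> bool" where
  "glide_directions G \<longleftrightarrow>
     finite G \<and> (\<forall>g\<in>G. norm g = 1 \<and> - g \<in> G) \<and> span G = UNIV"

definition max_glide ::
    "(real^2) set \<Rightarrow> ('n \<Rightarrow> real^2^'n \<Rightarrow> real^2) \<Rightarrow> 'n \<Rightarrow> real^2^'n \<Rightarrow> (real^2) set" where
  "max_glide G j l Z = {g. is_arg_max (\<lambda>h. j l Z \<bullet> h) (\<lambda>h. h \<in> G) g}"

definition F_comp ::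
    "(real^2) set \<Rightarrow> ('n \<Rightarrow> real^2^'n \<Rightarrow> real^2) \<Rightarrow> 'n \<Rightarrow> real^2^'n \<Rightarrow> (real^2) set" where
  "F_comp G j l Z = (\<lambda>g. (j l Z \<bullet> g) *\<^sub>R g) ` max_glide G j l Z"

definition F_map ::
    "(real^2) set \<Rightarrow> ('n \<Rightarrow> real^2^'n \<Rightarrow> real^2) \<Rightarrow> real^2^'n \<Rightarrow> (real^2^'n) set" where
  "F_map G j Z = {V. \<forall>l. V $ l \<in> F_comp G j l Z}"

definition inclusion_solution ::
    "(real^2) set \<Rightarrow> (real^2) set \<Rightarrow> ('n::finite \<Rightarrow> real^2^'n \<Rightarrow> real^2) \<Rightarrow>
      real set \<Rightarrow> (real \<Rightarrow> real^2^'n) \<Rightarrow> bool" where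
  "inclusion_solution \<Omega> G j I Z \<longleftrightarrow>
     absolutely_continuous_on I Z \<and>
     (\<forall>t\<in>I. Z t \<in> config_domain \<Omega>) \<and>
     (AE t in lebesgue. t \<in> I \<longrightarrow>
        (\<exists>v \<in> convex hull (F_map G j (Z t)). (Z has_vector_derivative v) (at t within I)))"

text \<open>\<^term>\<open>s1\<close> and \<^term>\<open>s2\<close> do not depend on the two solutions, which live on arbitrary,
  possibly one-sided, intervals containing \<^term>\<open>t1\<close>.\<close>

definition uniqueness_at ::
    "(real^2) set \<Rightarrow> (real^2) set \<Rightarrow> ('n::finite \<Rightarrow> real^2^'n \<Rightarrow> real^2) \<Rightarrow>
      real \<Rightarrow> real^2^'n \<Rightarrow> bool" where
  "uniqueness_at \<Omega> G j t1 Z1 \<longleftrightarrow>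
     (\<exists>s1 s2. s1 < t1 \<and> t1 < s2 \<and>
        (\<forall>I X I' X'.
           is_interval I \<and> t1 \<in> I \<and> inclusion_solution \<Omega> G j I X \<and> X t1 = Z1 \<and>
           is_interval I' \<and> t1 \<in> I' \<and> inclusion_solution \<Omega> G j I' X' \<and> X' t1 = Z1
           \<longrightarrow> (\<forall>t \<in> {s1..s2} \<inter> I \<inter> I'. X t = X' t)))"

definition ambiguity_set ::
    "(real^2) set \<Rightarrow> (real^2) set \<Rightarrow> ('n \<Rightarrow> real^2^'n \<Rightarrow> real^2) \<Rightarrow> 'n \<Rightarrow> (real^2^'n) set" where
  "ambiguity_set \<Omega> G j l = {Z \<in> config_domain \<Omega>. card (max_glide G j l Z) = 2}"

definition singular_set ::
    "(real^2) set \<Rightarrow> (real^2) set \<Rightarrow> ('n::finite \<Rightarrow> real^2^'n \<Rightarrow> real^2) \<Rightarrow> 'n \<Rightarrow> (real^2^'n) set" where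
  "singular_set \<Omega> G j l =
     {Z \<in> ambiguity_set \<Omega> G j l.
        \<exists>gp gm. max_glide G j l Z = {gp, gm} \<and> gp \<noteq> gm \<and>
          j l Z \<bullet> (gp - gm) = 0 \<and> GDERIV (\<lambda>Y. j l Y \<bullet> (gp - gm)) Z :> 0}"

definition E_int ::
    "(real^2) set \<Rightarrow> (real^2) set \<Rightarrow> ('n \<Rightarrow> real^2^'n \<Rightarrow> real^2) \<Rightarrow> (real^2^'n) set" where
  "E_int \<Omega> G j = {Z. \<exists>l k. l \<noteq> k \<and> Z \<in> ambiguity_set \<Omega> G j l \<inter> ambiguity_set \<Omega> G j k}"

definition E_zero ::
    "(real^2) set \<Rightarrow> ('n \<Rightarrow> real^2^'n \<Rightarrow> real^2) \<Rightarrow> (real^2^'n) set" where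
  "E_zero \<Omega> j = {Z \<in> config_domain \<Omega>. \<exists>k. j k Z = 0}"

definition regular_ambiguity_set ::
    "(real^2) set \<Rightarrow> (real^2) set \<Rightarrow> ('n::finite \<Rightarrow> real^2^'n \<Rightarrow> real^2) \<Rightarrow> 'n \<Rightarrow> (real^2^'n) set" where
  "regular_ambiguity_set \<Omega> G j l =
     ambiguity_set \<Omega> G j l - (singular_set \<Omega> G j l \<union> E_int \<Omega> G j \<union> E_zero \<Omega> j)"

text \<open>
  For small \<^term>\<open>r\<close> the ball around a regular ambiguity point \<^term>\<open>Zh\<close>, minus the
  ambiguity set, splits into the two sides \<^term>\<open>side \<Omega> G j l Zh r gp\<close> and
  \<^term>\<open>side \<Omega> G j l Zh r gm\<close>, where \<^term>\<open>gp\<close> and \<^term>\<open>gm\<close> are the two maximizing glide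
  directions of dislocation \<^term>\<open>l\<close> at \<^term>\<open>Zh\<close>.
\<close>

definition side ::
    "(real^2) set \<Rightarrow> (real^2) set \<Rightarrow> ('n::finite \<Rightarrow> real^2^'n \<Rightarrow> real^2) \<Rightarrow> 'n \<Rightarrow>
      real^2^'n \<Rightarrow> real \<Rightarrow> real^2 \<Rightarrow> (real^2^'n) set" where
  "side \<Omega> G j l Zh r g = {Z \<in> ball Zh r \<inter> config_domain \<Omega>. max_glide G j l Z = {g}}"

text \<open>Away from component \<^term>\<open>l\<close> the maximizing direction at \<^term>\<open>Zh\<close> is unique when
  \<^term>\<open>Zh\<close> is a regular ambiguity point; it is frozen there, as is \<^term>\<open>g\<close>.\<close>

definition local_field ::
    "(real^2) set \<Rightarrow> ('n::finite \<Rightarrow> real^2^'n \<Rightarrow> real^2) \<Rightarrow> 'n \<Rightarrow> real^2^'n \<Rightarrow> real^2 \<Rightarrow>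
      real^2^'n \<Rightarrow> real^2^'n" where
  "local_field G j l Zh g Z =
     (\<chi> k. let h = (if k = l then g else the_elem (max_glide G j k Zh)) in (j k Z \<bullet> h) *\<^sub>R h)"

definition tangent_vector :: "('a::real_normed_vector) set \<Rightarrow> 'a \<Rightarrow> 'a \<Rightarrow> bool" where
  "tangent_vector M p v \<longleftrightarrow>
     (\<exists>c::real \<Rightarrow> 'a. c 0 = p \<and> (\<forall>\<^sub>F t in at 0. c t \<in> M) \<and> (c has_vector_derivative v) (at 0))"

definition unit_normal_from_to ::
    "('a::real_inner) set \<Rightarrow> 'a set \<Rightarrow> 'a set \<Rightarrow> 'a \<Rightarrow> 'a \<Rightarrow> bool" where
  "unit_normal_from_to M Vm Vp p \<nu> \<longleftrightarrow>
     norm \<nu> = 1 \<and> (\<forall>v. tangent_vector M p v \<longrightarrow> \<nu> \<bullet> v = 0) \<and>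
     (\<forall>\<^sub>F t in at_right 0. p + t *\<^sub>R \<nu> \<in> Vp \<and> p - t *\<^sub>R \<nu> \<in> Vm)"

definition passes_from_to :: "(real \<Rightarrow> 'a) \<Rightarrow> real \<Rightarrow> 'a set \<Rightarrow> 'a set \<Rightarrow> real set \<Rightarrow> bool" where
  "passes_from_to Z t1 V W I \<longleftrightarrow>
     (\<exists>s1 s2. s1 < t1 \<and> t1 < s2 \<and> {s1..s2} \<subseteq> I \<and>
        (\<forall>t\<in>{s1..<t1}. Z t \<in> V) \<and> (\<forall>t\<in>{t1<..s2}. Z t \<in> W))"

end

theory Submission
  imports Defs "HOL-Complex_Analysis.Complex_Analysis"
begin

text \<open>
  The proof has an analytic half and a dynamical half.

  The analytic half shows that every Peach-Koehler force is differentiable and locally Lipschitz in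
  the configuration, although the regular part of the strain is only given through a Neumann
  problem for each configuration separately. The stretching \<open>x \<mapsto> \<lambda> x\<^sub>1 + \<i> x\<^sub>2\<close> turns the
  equation into the Laplace equation in a bounded simply connected plane domain \<open>D\<close>, the gradient of a
  solution into a holomorphic function \<open>f\<close>, and the kernel of the \<open>i\<close>-th dislocation into
  \<open>b\<^sub>i / (2 \<pi> \<i> (z - a\<^sub>i))\<close>. If \<open>H' = f\<close>, the Neumann condition says that
  \<open>Im H - \<Sum>\<^sub>i b\<^sub>i / (2 \<pi>) ln |z - a\<^sub>i|\<close> is constant along the boundary, which is connected
  (\<open>stream_function_constant_on_frontier\<close>). So the Neumann problem has become a Dirichlet problem for
  the conjugate function, and its solution is explicit: with a Riemann map \<open>\<psi>\<close> of \<open>D\<close>, the functions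
  \<open>ln |(\<psi> - \<psi> a\<^sub>i) / (1 - cnj (\<psi> a\<^sub>i) \<psi>)|\<close> vanish on the boundary and have the required
  logarithmic poles. The maximum principle identifies \<open>f\<close> (\<open>field_eq_image_field\<close>), and evaluation at
  a dislocation gives a closed formula for the force (\<open>pk_force_eq_vortex_field\<close>) in which the
  configuration enters only through \<open>\<psi>\<close>, its derivatives and complex conjugation. This
  formula is what provides the regularity (\<open>pk_force_lipschitz_differentiable\<close>).

  In the dynamical half put \<open>\<phi> = j\<^sub>l \<bullet> (g\<^sup>+ - g\<^sup>-)\<close>. Near a regular ambiguity point \<open>Z\<^sub>1\<close> the sign
  of \<open>\<phi>\<close> decides which of \<open>g\<^sup>+\<close>, \<open>g\<^sup>-\<close> maximizes, all other dislocations have a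
  fixed glide direction, and the gradient of \<open>\<phi>\<close> at \<open>Z\<^sub>1\<close> is a positive multiple of the normal
  \<open>\<nu>\<close> (\<open>gradient_parallel_to_level_set_normal\<close>). The velocity of any solution is a convex
  combination of the two local fields, both of which have a positive normal component; hence
  \<open>\<phi>\<close> grows at least linearly along every solution through \<open>Z\<^sub>1\<close>, so that each of them is on the
  minus side before the crossing and on the plus side after it. On each side the inclusion is an ordinary
  differential equation with Lipschitz right-hand side, and this forces uniqueness
  (\<open>transversal_crossing\<close>). Only the derivative of \<open>\<phi>\<close> at the single point \<open>Z\<^sub>1\<close> and Lipschitz
  bounds for the forces are needed. The case of negative normal components is the same statement with
  \<open>g\<^sup>+\<close> and \<open>g\<^sup>-\<close> exchanged and the normal reversed.
\<close>

(* power series would otherwise compete with vectors for the infix dollar *)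
unbundle no Formal_Power_Series.fps_syntax

section \<open>Increments of absolutely continuous functions\<close>

definition interval_family :: "real set \<Rightarrow> nat \<Rightarrow> (nat \<Rightarrow> real) \<Rightarrow> (nat \<Rightarrow> real) \<Rightarrow> bool" where
  "interval_family I m u v \<longleftrightarrow> (\<forall>i<m. u i \<le> v i \<and> {u i..v i} \<subseteq> I) \<and>
     (\<forall>i<m. \<forall>j<m. i \<noteq> j \<longrightarrow> {u i<..<v i} \<inter> {u j<..<v j} = {})"

lemma absolutely_continuous_on_iff:
  "absolutely_continuous_on I f \<longleftrightarrow>
     (\<forall>e>0. \<exists>d>0. \<forall>m u v. interval_family I m u v \<longrightarrow> (\<Sum>i<m. v i - u i) < d \<longrightarrow>
        (\<Sum>i<m. norm (f (v i) - f (u i))) < e)"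
  by (simp only: absolutely_continuous_on_def interval_family_def imp_conjL)

lemma absolutely_continuous_onE:
  assumes "absolutely_continuous_on I f" "e > 0"
  obtains d where "d > 0" "\<And>m u v. \<lbrakk>interval_family I m u v; (\<Sum>i<m. v i - u i) < d\<rbrakk>
     \<Longrightarrow> (\<Sum>i<m. norm (f (v i) - f (u i))) < e"
  using assms(1)[unfolded absolutely_continuous_on_iff, rule_format, OF assms(2)] by blast

lemma absolutely_continuous_on_subset:
  assumes f: "absolutely_continuous_on I f" and J: "J \<subseteq> I"
  shows "absolutely_continuous_on J f"
  unfolding absolutely_continuous_on_iff
proof (intro allI impI)
  fix e :: real assume "e > 0"
  from absolutely_continuous_onE[OF f this]
  obtain d where "d > 0" "\<And>m u v. \<lbrakk>interval_family I m u v; (\<Sum>i<m. v i - u i) < d\<rbrakk>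
     \<Longrightarrow> (\<Sum>i<m. norm (f (v i) - f (u i))) < e" by blast
  moreover have "interval_family J m u v \<Longrightarrow> interval_family I m u v" for m u v
    using J unfolding interval_family_def by blast
  ultimately show "\<exists>d>0. \<forall>m u v. interval_family J m u v \<longrightarrow> (\<Sum>i<m. v i - u i) < d \<longrightarrow>
        (\<Sum>i<m. norm (f (v i) - f (u i))) < e" by blast
qed

text \<open>
  Absolute continuity restated for tagged partial divisions, the form in which it meets Cousin's lemma
  below.
\<close>

lemma absolutely_continuous_on_tagged_sum:
  fixes f :: "real \<Rightarrow> 'a::real_normed_vector"
  assumes ac: "absolutely_continuous_on {a..b} f" and e: "e > 0"
  obtains \<delta> where "\<delta> > 0"
    "\<And>p. \<lbrakk>p tagged_partial_division_of {a..b}; (\<Sum>(x,K)\<in>p. Sup K - Inf K) < \<delta>\<rbrakk>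
        \<Longrightarrow> (\<Sum>(x,K)\<in>p. norm (f (Sup K) - f (Inf K))) < e"
proof -
  obtain d where d: "d > 0" and D: "\<And>m u v. \<lbrakk>interval_family {a..b} m u v; (\<Sum>i<m. v i - u i) < d\<rbrakk>
     \<Longrightarrow> (\<Sum>i<m. norm (f (v i) - f (u i))) < e"
    using absolutely_continuous_onE[OF ac e] by blast
  show ?thesis
  proof (rule that[OF d])
    fix p assume p: "p tagged_partial_division_of {a..b}" and s: "(\<Sum>(x,K)\<in>p. Sup K - Inf K) < d"
    have fin: "finite p" by (rule tagged_partial_division_ofD(1)[OF p])
    obtain h where h: "bij_betw h {..<card p} p"
      using ex_bij_betw_nat_finite[OF fin] by (auto simp: atLeast0LessThan)
    define u where "u i = Inf (snd (h i))" for i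
    define v where "v i = Sup (snd (h i))" for i
    have K: "u i \<le> v i \<and> {u i..v i} \<subseteq> {a..b} \<and> snd (h i) = {u i..v i}" if "i < card p" for i
    proof -
      have "h i \<in> p" using h that by (auto simp: bij_betw_def)
      then have hp: "(fst (h i), snd (h i)) \<in> p" by simp
      then obtain c e where ce: "snd (h i) = cbox c e" 
        using tagged_partial_division_ofD(4)[OF p hp] by blast
      moreover have "fst (h i) \<in> snd (h i)" "snd (h i) \<subseteq> {a..b}"
        using tagged_partial_division_ofD(2,3)[OF p hp] by auto
      ultimately have "c \<le> e" by auto
      then show ?thesis using ce \<open>snd (h i) \<subseteq> {a..b}\<close> unfolding u_def v_def by auto
    qed
    have disj: "{u i<..<v i} \<inter> {u k<..<v k} = {}" if "i < card p" "k < card p" "i \<noteq> k" for i k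
    proof -
      have "h i \<in> p" "h k \<in> p" "h i \<noteq> h k"
        using h that by (auto simp: bij_betw_def inj_on_def)
      then have "interior (snd (h i)) \<inter> interior (snd (h k)) = {}"
        using tagged_partial_division_ofD(5)[OF p, of "fst (h i)" "snd (h i)" "fst (h k)" "snd (h k)"]
        by auto
      then show ?thesis using K[OF that(1)] K[OF that(2)] by auto
    qed
    have sm: "(\<Sum>i<card p. v i - u i) = (\<Sum>(x,K)\<in>p. Sup K - Inf K)"
      using sum.reindex_bij_betw[OF h, of "\<lambda>(x,K). Sup K - Inf K"]
      by (simp add: u_def v_def case_prod_beta)
    have sm2: "(\<Sum>i<card p. norm (f (v i) - f (u i))) = (\<Sum>(x,K)\<in>p. norm (f (Sup K) - f (Inf K)))"
      using sum.reindex_bij_betw[OF h, of "\<lambda>(x,K). norm (f (Sup K) - f (Inf K))"]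
      by (simp add: u_def v_def case_prod_beta)
    show "(\<Sum>(x,K)\<in>p. norm (f (Sup K) - f (Inf K))) < e"
      using D[of "card p" u v] K disj s sm sm2 unfolding interval_family_def by auto
  qed
qed

lemma negligible_open_cover_small:
  fixes N :: "'a::euclidean_space set"
  assumes "negligible N" "d > 0"
  obtains U where "open U" "N \<subseteq> U" "U \<in> lmeasurable" "measure lebesgue U < d"
proof -
  have N: "N \<in> null_sets lebesgue" using assms(1) negligible_iff_null_sets by blast
  obtain T where T: "open T" "N \<subseteq> T" "(T - N) \<in> lmeasurable" "emeasure lebesgue (T - N) < ennreal d"
    using sets_lebesgue_outer_open[of N d] N assms(2) by auto
  have TT: "T = (T - N) \<union> N" using T by auto
  have "T \<in> lmeasurable" using T(3) N TT by (metis fmeasurable.Un negligible_iff_null_sets negligible_imp_measurable)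
  moreover have "measure lebesgue T = measure lebesgue (T - N)"
    using N T by (metis measure_Diff_null_set fmeasurableD calculation)
  moreover have "measure lebesgue (T-N) < d"
    using T(3,4) by (simp add: emeasure_eq_measure2 ennreal_less_iff)
  ultimately show ?thesis using that T by auto
qed

text \<open>
  The mean value inequality for absolutely continuous functions, proved without Lebesgue's
  fundamental theorem. In a fine tagged division the intervals tagged outside \<^term>\<open>N\<close> obey the
  derivative bound up to an error proportional to their length, while those tagged in \<^term>\<open>N\<close> lie in
  an open set of small measure, so that absolute continuity makes their contribution small.
\<close>

lemma absolutely_continuous_increment_le:
  fixes g :: "real \<Rightarrow> real"
  assumes ac: "absolutely_continuous_on {a..b} g" and ab: "a \<le> b" and N: "negligible N"
    and der: "\<And>t. t \<in> {a..b} - N \<Longrightarrow> \<exists>v \<le> K. (g has_vector_derivative v) (at t within {a..b})"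
  shows "g b - g a \<le> K * (b - a)"
proof -
  have main: "g b - g a \<le> 2 * e + (K + e) * (b - a)" if e: "e > 0" for e
  proof -
    obtain \<delta> where \<delta>: "\<delta> > 0"
      "\<And>p. \<lbrakk>p tagged_partial_division_of {a..b}; (\<Sum>(x,K)\<in>p. Sup K - Inf K) < \<delta>\<rbrakk>
        \<Longrightarrow> (\<Sum>(x,K)\<in>p. norm (g (Sup K) - g (Inf K))) < e"
      using absolutely_continuous_on_tagged_sum[OF ac e] by blast
    \<comment> \<open>the second bound absorbs the slope \<^term>\<open>K\<close> over the intervals tagged in \<^term>\<open>N\<close>\<close>
    define \<delta>' where "\<delta>' = min \<delta> (e / (\<bar>K\<bar> + 1))"
    have \<delta>': "\<delta>' > 0" using \<delta> e by (auto simp: \<delta>'_def)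
    obtain U where U: "open U" "N \<subseteq> U" "U \<in> lmeasurable" "measure lebesgue U < \<delta>'"
      using negligible_open_cover_small[OF N \<delta>'] by blast
    have "\<exists>d>0. (t \<in> N \<longrightarrow> ball t d \<subseteq> U) \<and> (t \<in> {a..b} - N \<longrightarrow>
       (\<forall>u w. u \<in> {a..b} \<and> w \<in> {a..b} \<and> u \<le> t \<and> t \<le> w \<and> u \<in> ball t d \<and> w \<in> ball t d
         \<longrightarrow> g w - g u \<le> (K + e) * (w - u)))" for t
    proof (cases "t \<in> N \<or> t \<notin> {a..b}")
      case True
      then show ?thesis using U by (cases "t \<in> N") (meson DiffD2 openE subsetD, auto intro: exI[of _ 1])
    next
      case False
      then obtain v where v: "v \<le> K" "(g has_vector_derivative v) (at t within {a..b})"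
        using der by blast
      from v(2)[unfolded has_vector_derivative_def has_derivative_within_alt] e
      obtain d where d: "d > 0" "\<And>y. \<lbrakk>y \<in> {a..b}; norm (y - t) < d\<rbrakk>
         \<Longrightarrow> norm (g y - g t - (y-t) *\<^sub>R v) \<le> e * norm (y - t)"
        by blast
      have "g w - g u \<le> (K + e) * (w - u)"
        if "u \<in> {a..b}" "w \<in> {a..b}" "u \<le> t" "t \<le> w" "u \<in> ball t d" "w \<in> ball t d" for u w
      proof -
        have "norm (u - t) < d" "norm (w - t) < d" using that by (auto simp: dist_real_def)
        then have 1: "\<bar>g u - g t - (u-t) * v\<bar> \<le> e * (t - u)" "\<bar>g w - g t - (w-t) * v\<bar> \<le> e * (w - t)"
          using d(2)[of u] d(2)[of w] that by auto
        have "g w - g u \<le> (w - u) * v + e * (w - u)"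
          using 1 by (simp add: algebra_simps abs_le_iff)
        also have "\<dots> \<le> (K + e) * (w - u)" using mult_right_mono[OF v(1), of "w - u"] that 
          by (simp add: algebra_simps)
        finally show ?thesis .
      qed
      then show ?thesis using d(1) False by blast
    qed
    then obtain d where d: "\<And>t. d t > 0" "\<And>t. t \<in> N \<Longrightarrow> ball t (d t) \<subseteq> U"
       "\<And>t u w. \<lbrakk>t \<in> {a..b} - N; u \<in> {a..b}; w \<in> {a..b}; u \<le> t; t \<le> w; u \<in> ball t (d t); w \<in> ball t (d t)\<rbrakk>
         \<Longrightarrow> g w - g u \<le> (K + e) * (w - u)"
      by metis
    obtain p where p: "p tagged_division_of {a..b}" "(\<lambda>t. ball t (d t)) fine p"
      using fine_division_exists_real[of "\<lambda>t. ball t (d t)"] gauge_ball_dependent d(1) by blast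
    define p1 where "p1 = {z \<in> p. fst z \<in> N}"
    define p2 where "p2 = p - p1"
    have fin: "finite p" using p(1) by auto
    have K: "\<exists>u w. k = {u..w} \<and> u \<le> x \<and> x \<le> w \<and> u \<in> {a..b} \<and> w \<in> {a..b} \<and> u \<in> ball x (d x) \<and> w \<in> ball x (d x) \<and> k \<subseteq> ball x (d x)" if xk: "(x,k) \<in> p" for x k
    proof -
      obtain u w where k: "k = {u..w}" using tagged_division_ofD(4)[OF p(1) xk] by auto
      have "x \<in> k" "k \<subseteq> {a..b}" "k \<subseteq> ball x (d x)"
        using tagged_division_ofD(2,3)[OF p(1) xk] p(2) xk by (auto simp: fine_def)
      moreover from this k have "u \<in> k" "w \<in> k" by auto
      moreover from calculation have "u \<in> ball x (d x)" "w \<in> ball x (d x)" "u \<in> {a..b}" "w \<in> {a..b}" by blast+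
      ultimately have "u \<le> x" "x \<le> w" "u \<in> {a..b}" "w \<in> {a..b}" "u \<in> ball x (d x)" "w \<in> ball x (d x)" "k \<subseteq> ball x (d x)"
        unfolding k by (auto simp del: mem_ball dest: subsetD)
      with k show ?thesis by blast
    qed
    have p1: "p1 tagged_partial_division_of {a..b}"
      by (rule tagged_partial_division_subset[of p]) (use p(1) in \<open>auto simp: p1_def tagged_division_of_def\<close>)
    have "(\<Sum>(x,k)\<in>p1. Sup k - Inf k) = (\<Sum>(x,k)\<in>p1. measure lebesgue k)"
    proof (intro sum.cong refl, clarify)
      fix x k assume "(x,k) \<in> p1"
      then have "(x,k) \<in> p" by (auto simp: p1_def)
      from K[OF this] show "Sup k - Inf k = measure lebesgue k" by auto
    qed
    also have "\<dots> = (\<Sum>k\<in>snd ` p1. measure lebesgue k)"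
    proof -
      have div: "p1 tagged_division_of \<Union>(snd ` p1)" 
        by (rule tagged_partial_division_of_Union_self[OF p1])
      show ?thesis
        by (rule sum.over_tagged_division_lemma[OF div]) (simp add: measure_completion content_eq_0_interior)
    qed
    also have "\<dots> = measure lebesgue (\<Union>(snd ` p1))"
    proof -
      have "snd ` p1 division_of \<Union>(snd ` p1)"
        by (rule partial_division_of_tagged_division[OF p1])
      from content_division[OF this] show ?thesis .
    qed
    also have "\<dots> \<le> measure lebesgue U"
    proof (rule measure_mono_fmeasurable)
      show "\<Union>(snd ` p1) \<subseteq> U" using K d(2) unfolding p1_def by fastforce
      have "k \<in> lmeasurable" if kp: "k \<in> snd ` p1" for k
      proof -
        obtain z where "z \<in> p1" "snd z = k" using kp by blast
        then have "(fst z, k) \<in> p" by (auto simp: p1_def)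
        from K[OF this] show ?thesis by auto
      qed
      then show "\<Union>(snd ` p1) \<in> sets lebesgue"
        using fin by (intro sets.finite_Union) (auto simp: p1_def fmeasurableD)
    qed (use U in auto)
    finally have small: "(\<Sum>(x,k)\<in>p1. Sup k - Inf k) < \<delta>'" using U by linarith
    have nonneg: "0 \<le> (\<Sum>(x,k)\<in>p1. Sup k - Inf k)"
      by (rule sum_nonneg) (use K in \<open>fastforce simp: p1_def\<close>)
    have s1: "(\<Sum>(x,k)\<in>p1. g (Sup k) - g (Inf k)) \<le> e"
    proof -
      have "(\<Sum>(x,k)\<in>p1. g (Sup k) - g (Inf k)) \<le> (\<Sum>(x,k)\<in>p1. norm (g (Sup k) - g (Inf k)))"
        by (rule sum_mono) auto
      also have "\<dots> < e" using \<delta>(2)[OF p1] small by (auto simp: \<delta>'_def)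
      finally show ?thesis by simp
    qed
    have s2: "(\<Sum>(x,k)\<in>p2. g (Sup k) - g (Inf k)) \<le> (\<Sum>(x,k)\<in>p2. (K + e) * (Sup k - Inf k))"
    proof (rule sum_mono, clarify)
      fix x k assume xk: "(x,k) \<in> p2"
      then have xp: "(x,k) \<in> p" "x \<notin> N" by (auto simp: p1_def p2_def)
      then have "x \<in> {a..b} - N" using tagged_division_ofD(2,3)[OF p(1) xp(1)] by blast
      then show "g (Sup k) - g (Inf k) \<le> (K + e) * (Sup k - Inf k)"
        using K[OF xp(1)] d(3)[of x] by force
    qed
    have split: "(\<Sum>z\<in>p. F z) = (\<Sum>z\<in>p1. F z) + (\<Sum>z\<in>p2. F z)" for F :: "_ \<Rightarrow> real"
      unfolding p2_def using fin p1_def by (simp add: sum.subset_diff[of p1 p])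
    have len: "(\<Sum>(x,k)\<in>p1. Sup k - Inf k) + (\<Sum>(x,k)\<in>p2. Sup k - Inf k) = b - a"
      using additive_tagged_division_1[OF ab p(1), of "\<lambda>x. x"] split by simp
    have "g b - g a = (\<Sum>(x,k)\<in>p1. g (Sup k) - g (Inf k)) + (\<Sum>(x,k)\<in>p2. g (Sup k) - g (Inf k))"
      using additive_tagged_division_1[OF ab p(1), of g] split by simp
    also have "\<dots> \<le> e + (\<Sum>(x,k)\<in>p2. (K + e) * (Sup k - Inf k))" using s1 s2 by linarith
    also have "(\<Sum>(x,k)\<in>p2. (K + e) * (Sup k - Inf k)) = (K+e) * (\<Sum>(x,k)\<in>p2. Sup k - Inf k)"
      by (simp add: sum_distrib_left case_prod_beta)
    also have "\<dots> = (K + e) * (b - a) - (K + e) * (\<Sum>(x,k)\<in>p1. Sup k - Inf k)"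
      using len by (simp add: algebra_simps flip: len)
    finally have A: "g b - g a \<le> e + ((K + e) * (b - a) - (K + e) * (\<Sum>(x,k)\<in>p1. Sup k - Inf k))" .
    have "- (K + e) * (\<Sum>(x,k)\<in>p1. Sup k - Inf k) \<le> e"
    proof -
      let ?s = "(\<Sum>(x,k)\<in>p1. Sup k - Inf k)"
      have "- (K + e) * ?s \<le> \<bar>K\<bar> * ?s" using nonneg e by (intro mult_right_mono) auto
      also have "\<dots> \<le> \<bar>K\<bar> * (e / (\<bar>K\<bar> + 1))" using small by (intro mult_left_mono) (auto simp: \<delta>'_def)
      also have "\<dots> \<le> e" using e by (auto simp: field_simps)
      finally show ?thesis .
    qed
    with A show ?thesis by (simp only: mult_minus_left)
  qed
  show ?thesis
  proof (rule field_le_epsilon)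
    fix \<eta> :: real assume "\<eta> > 0"
    define e where "e = \<eta> / (2 + (b - a))"
    have e: "e > 0" using \<open>\<eta> > 0\<close> ab by (simp add: e_def)
    have "2 * e + e * (b - a) = \<eta>" 
    proof -
      have "2 * e + e * (b - a) = e * (2 + (b - a))" by (simp add: algebra_simps)
      then show ?thesis using ab unfolding e_def by simp
    qed
    then show "g b - g a \<le> K * (b - a) + \<eta>" using main[OF e] by (simp add: algebra_simps)
  qed
qed

lemma absolutely_continuous_on_imp_continuous_on:
  fixes f :: "real \<Rightarrow> 'a::real_normed_vector"
  assumes "absolutely_continuous_on {a..b} f"
  shows "continuous_on {a..b} f"
  unfolding continuous_on_iff
proof (intro ballI allI impI)
  fix x e :: real assume x: "x \<in> {a..b}" and e: "0 < e"
  obtain d where d: "d > 0" and D: "\<And>m u v. \<lbrakk>interval_family {a..b} m u v; (\<Sum>i<m. v i - u i) < d\<rbrakk>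
     \<Longrightarrow> (\<Sum>i<m. norm (f (v i) - f (u i))) < e"
    using absolutely_continuous_onE[OF assms e] by blast
  have "dist (f y) (f x) < e" if y: "y \<in> {a..b}" "dist y x < d" for y
    using D[of 1 "\<lambda>_. min x y" "\<lambda>_. max x y"] x y
    by (cases "x \<le> y") (auto simp: interval_family_def dist_norm min_def max_def norm_minus_commute)
  then show "\<exists>d>0. \<forall>x'\<in>{a..b}. dist x' x < d \<longrightarrow> dist (f x') (f x) < e"
    using d by blast
qed

text \<open>
  Covers at once differences of absolutely continuous functions and their inner products with a
  fixed vector.
\<close>

lemma absolutely_continuous_on_dominated:
  assumes ac: "absolutely_continuous_on I f" "absolutely_continuous_on I g"
    and K: "K > 0" and le: "\<And>u v. norm (h v - h u) \<le> K * (norm (f v - f u) + norm (g v - g u))"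
  shows "absolutely_continuous_on I h"
  unfolding absolutely_continuous_on_iff
proof (intro allI impI)
  fix e :: real assume "e > 0"
  then have e: "e / (2 * K) > 0" using K by simp
  obtain d1 where d1: "d1 > 0" "\<And>m u v. \<lbrakk>interval_family I m u v; (\<Sum>i<m. v i - u i) < d1\<rbrakk>
     \<Longrightarrow> (\<Sum>i<m. norm (f (v i) - f (u i))) < e / (2 * K)"
    using absolutely_continuous_onE[OF ac(1) e] by blast
  obtain d2 where d2: "d2 > 0" "\<And>m u v. \<lbrakk>interval_family I m u v; (\<Sum>i<m. v i - u i) < d2\<rbrakk>
     \<Longrightarrow> (\<Sum>i<m. norm (g (v i) - g (u i))) < e / (2 * K)"
    using absolutely_continuous_onE[OF ac(2) e] by blast
  show "\<exists>d>0. \<forall>m u v. interval_family I m u v \<longrightarrow> (\<Sum>i<m. v i - u i) < d \<longrightarrow>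
      (\<Sum>i<m. norm (h (v i) - h (u i))) < e"
  proof (intro exI[of _ "min d1 d2"] conjI allI impI)
    fix m u v
    assume H: "interval_family I m u v" "(\<Sum>i<m. v i - u i) < min d1 d2"
    have "(\<Sum>i<m. norm (h (v i) - h (u i)))
       \<le> (\<Sum>i<m. K * (norm (f (v i) - f (u i)) + norm (g (v i) - g (u i))))"
      by (rule sum_mono) (rule le)
    also have "\<dots> = K * ((\<Sum>i<m. norm (f (v i) - f (u i))) + (\<Sum>i<m. norm (g (v i) - g (u i))))"
      by (simp add: sum.distrib sum_distrib_left distrib_left)
    also have "\<dots> < K * (e / (2 * K) + e / (2 * K))"
      using d1(2)[OF H(1)] d2(2)[OF H(1)] H(2) K by (intro mult_strict_left_mono add_strict_mono) auto
    also have "\<dots> = e" using K by simp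
    finally show "(\<Sum>i<m. norm (h (v i) - h (u i))) < e" .
  qed (use d1 d2 in auto)
qed

lemma absolutely_continuous_inner_increment_le:
  fixes f :: "real \<Rightarrow> 'a::real_inner"
  assumes ac: "absolutely_continuous_on {a..b} f" and ab: "a \<le> b" and N: "negligible N"
    and der: "\<And>t. t \<in> {a..b} - N \<Longrightarrow> \<exists>v. v \<bullet> e \<le> K \<and> (f has_vector_derivative v) (at t within {a..b})"
  shows "(f b - f a) \<bullet> e \<le> K * (b - a)"
proof -
  have "absolutely_continuous_on {a..b} (\<lambda>t. f t \<bullet> e)"
  proof (rule absolutely_continuous_on_dominated[OF ac ac])
    show "norm e + 1 > 0" by (simp add: add_nonneg_pos)
    fix u v
    have "norm (f v \<bullet> e - f u \<bullet> e) \<le> norm (f v - f u) * norm e"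
      by (metis inner_diff_left Cauchy_Schwarz_ineq2 real_norm_def)
    also have "\<dots> \<le> (norm (f v - f u) + norm (f v - f u)) * (norm e + 1)"
      by (intro mult_mono) auto
    finally show "norm (f v \<bullet> e - f u \<bullet> e) \<le> (norm e + 1) * (norm (f v - f u) + norm (f v - f u))"
      by (simp only: mult.commute)
  qed
  then have "f b \<bullet> e - f a \<bullet> e \<le> K * (b - a)"
  proof (rule absolutely_continuous_increment_le[OF _ ab N])
    fix t assume "t \<in> {a..b} - N"
    then obtain v where "v \<bullet> e \<le> K" "(f has_vector_derivative v) (at t within {a..b})"
      using der by blast
    then show "\<exists>v\<le>K. ((\<lambda>t. f t \<bullet> e) has_vector_derivative v) (at t within {a..b})"
      using bounded_linear.has_vector_derivative[OF bounded_linear_inner_left] by blast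
  qed
  then show ?thesis by (simp add: inner_diff_left)
qed

lemma absolutely_continuous_norm_increment_le:
  fixes f :: "real \<Rightarrow> 'a::real_inner"
  assumes ac: "absolutely_continuous_on {a..b} f" and ab: "a \<le> b" and N: "negligible N"
    and der: "\<And>t. t \<in> {a..b} - N \<Longrightarrow> \<exists>v. norm v \<le> K \<and> (f has_vector_derivative v) (at t within {a..b})"
  shows "norm (f b - f a) \<le> K * (b - a)"
proof -
  define e where "e = sgn (f b - f a)"
  have e: "norm e \<le> 1" by (simp add: e_def norm_sgn)
  have "(f b - f a) \<bullet> e \<le> K * (b - a)"
  proof (rule absolutely_continuous_inner_increment_le[OF ac ab N])
    fix t assume "t \<in> {a..b} - N"
    then obtain v where v: "norm v \<le> K" "(f has_vector_derivative v) (at t within {a..b})"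
      using der by blast
    have "v \<bullet> e \<le> norm v * norm e" by (rule norm_cauchy_schwarz)
    also have "\<dots> \<le> K" using v(1) e by (smt (verit) mult_left_le norm_ge_zero)
    finally show "\<exists>v. v \<bullet> e \<le> K \<and> (f has_vector_derivative v) (at t within {a..b})" using v by blast
  qed
  moreover have "(f b - f a) \<bullet> e = norm (f b - f a)"
    by (cases "f b = f a") (simp_all add: e_def sgn_div_norm dot_square_norm power2_eq_square)
  ultimately show ?thesis by simp
qed

section \<open>Differential inclusions that cross a discontinuity surface\<close>

definition solves_inclusion :: "('a::euclidean_space \<Rightarrow> 'a set) \<Rightarrow> real set \<Rightarrow> (real \<Rightarrow> 'a) \<Rightarrow> bool" where
  "solves_inclusion \<Phi> I X \<longleftrightarrow> absolutely_continuous_on I X \<and>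
     (\<exists>N. negligible N \<and> (\<forall>t\<in>I - N. \<exists>v\<in>\<Phi> (X t). (X has_vector_derivative v) (at t within I)))"

lemma solves_inclusion_subset:
  assumes "solves_inclusion \<Phi> I X" "J \<subseteq> I"
  shows "solves_inclusion \<Phi> J X"
proof -
  obtain N where N: "negligible N" "\<And>t. t \<in> I - N \<Longrightarrow> \<exists>v\<in>\<Phi> (X t). (X has_vector_derivative v) (at t within I)"
    and ac: "absolutely_continuous_on I X"
    using assms unfolding solves_inclusion_def by blast
  have "\<exists>v\<in>\<Phi> (X t). (X has_vector_derivative v) (at t within J)" if t: "t \<in> J - N" for t
  proof -
    obtain v where "v \<in> \<Phi> (X t)" "(X has_vector_derivative v) (at t within I)" using N(2) t assms(2) by blast
    then show ?thesis using has_vector_derivative_within_subset[OF _ assms(2)] by blast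
  qed
  then show ?thesis unfolding solves_inclusion_def 
    using N(1) absolutely_continuous_on_subset[OF ac assms(2)] by blast
qed

text \<open>
  Time reversal; it reduces the behaviour before the crossing time to that after it.
\<close>

lemma solves_inclusion_uminus:
  assumes "solves_inclusion \<Phi> I X"
  shows "solves_inclusion (\<lambda>y. uminus ` \<Phi> y) (uminus ` I) (\<lambda>t. X (- t))"
proof -
  obtain N where N: "negligible N" "\<And>t. t \<in> I - N \<Longrightarrow> \<exists>v\<in>\<Phi> (X t). (X has_vector_derivative v) (at t within I)"
    and ac: "absolutely_continuous_on I X"
    using assms unfolding solves_inclusion_def by blast
  have "absolutely_continuous_on (uminus ` I) (\<lambda>t. X (- t))"
    unfolding absolutely_continuous_on_iff
  proof (intro allI impI)
    fix e :: real assume e: "e > 0"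
    obtain d where d: "d > 0" "\<And>m u v. \<lbrakk>interval_family I m u v; (\<Sum>i<m. v i - u i) < d\<rbrakk>
       \<Longrightarrow> (\<Sum>i<m. norm (X (v i) - X (u i))) < e"
      using absolutely_continuous_onE[OF ac e] by blast
    have "(\<Sum>i<m. norm (X (- v i) - X (- u i))) < e"
      if F: "interval_family (uminus ` I) m u v" and small: "(\<Sum>i<m. v i - u i) < d" for m u v
    proof -
      have "{- v i..- u i} \<subseteq> I" if "i < m" for i
      proof -
        have "uminus ` {u i..v i} \<subseteq> uminus ` uminus ` I" using F that unfolding interval_family_def by blast
        then show ?thesis by (simp add: image_image)
      qed
      moreover have "{- v i<..<- u i} \<inter> {- v j<..<- u j} = {}" if "i < m" "j < m" "i \<noteq> j" for i j
      proof -
        have "{u i<..<v i} \<inter> {u j<..<v j} = {}" using F that unfolding interval_family_def by blast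
        moreover have "- y \<in> {u i<..<v i} \<inter> {u j<..<v j}" if "y \<in> {- v i<..<- u i} \<inter> {- v j<..<- u j}" for y
          using that by auto
        ultimately show ?thesis by blast
      qed
      ultimately have "interval_family I m (\<lambda>i. - v i) (\<lambda>i. - u i)"
        using F unfolding interval_family_def by simp
      from d(2)[OF this] show ?thesis using small by (simp add: norm_minus_commute)
    qed
    then show "\<exists>d>0. \<forall>m u v. interval_family (uminus ` I) m u v \<longrightarrow> (\<Sum>i<m. v i - u i) < d \<longrightarrow>
        (\<Sum>i<m. norm (X (- v i) - X (- u i))) < e" using d(1) by blast
  qed
  moreover have "negligible (uminus ` N)"
    by (rule negligible_differentiable_image_negligible[OF order_refl N(1)])
       (auto intro!: derivative_intros simp: differentiable_on_def)
  moreover have "\<exists>v\<in>uminus ` \<Phi> (X (- t)). ((\<lambda>t. X (- t)) has_vector_derivative v) (at t within uminus ` I)"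
    if "t \<in> uminus ` I - uminus ` N" for t
  proof -
    have "- t \<in> I - N" using that by force
    then obtain v where v: "v \<in> \<Phi> (X (- t))" "(X has_vector_derivative v) (at (- t) within I)"
      using N(2) by blast
    have "(X \<circ> uminus has_vector_derivative (- 1) *\<^sub>R v) (at t within uminus ` I)"
      by (rule vector_diff_chain_within) (use v(2) in \<open>auto simp: image_image intro!: derivative_eq_intros\<close>)
    then show ?thesis using v(1) by (auto simp: o_def)
  qed
  ultimately show ?thesis unfolding solves_inclusion_def by blast
qed


text \<open>
  The speed bound is only known inside the ball, so the argument looks at the first exit time: up to
  then the bound holds, and the distance covered is too small for an exit.
\<close>

lemma absolutely_continuous_stays_in_ball:
  fixes X :: "real \<Rightarrow> 'a::real_inner"
  assumes ac: "absolutely_continuous_on {t1..t} X" and tt: "t1 \<le> t" and N: "negligible N"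
    and der: "\<And>s. \<lbrakk>s \<in> {t1..t} - N; X s \<in> ball (X t1) \<rho>\<rbrakk>
        \<Longrightarrow> \<exists>v. norm v \<le> C \<and> (X has_vector_derivative v) (at s within {t1..t})"
    and C: "C * (t - t1) < \<rho>" "C \<ge> 0" and s: "s \<in> {t1..t}"
  shows "X s \<in> ball (X t1) \<rho>"
proof (rule ccontr)
  assume out: "X s \<notin> ball (X t1) \<rho>"
  define S where "S = {s \<in> {t1..t}. \<rho> \<le> dist (X t1) (X s)}"
  have cont: "continuous_on {t1..t} X" by (rule absolutely_continuous_on_imp_continuous_on[OF ac])
  have "closed S" unfolding S_def
    by (intro continuous_closed_preimage_constant continuous_on_closed_Collect_le continuous_intros cont)
  moreover have "bounded S" unfolding S_def by (rule bounded_subset[of "{t1..t}"]) auto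
  moreover have ne: "S \<noteq> {}" using s out by (auto simp: S_def)
  ultimately have inf: "Inf S \<in> S" by (intro closed_contains_Inf bounded_imp_bdd_below)
  define s0 where "s0 = Inf S"
  have s0: "s0 \<in> {t1..t}" "\<rho> \<le> dist (X t1) (X s0)" using inf by (auto simp: S_def s0_def)
  have before: "X u \<in> ball (X t1) \<rho>" if "u \<in> {t1..<s0}" for u
  proof (rule ccontr)
    assume "X u \<notin> ball (X t1) \<rho>"
    then have "u \<in> S" using that s0 by (auto simp: S_def)
    then have "s0 \<le> u" unfolding s0_def using \<open>bounded S\<close> by (intro cInf_lower bounded_imp_bdd_below)
    then show False using that by simp
  qed
  have "norm (X s0 - X t1) \<le> C * (s0 - t1)"
  proof (rule absolutely_continuous_norm_increment_le)
    show "absolutely_continuous_on {t1..s0} X"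
      by (rule absolutely_continuous_on_subset[OF ac]) (use s0 in auto)
    show "negligible (N \<union> {s0})" using N by auto
    fix u assume u: "u \<in> {t1..s0} - (N \<union> {s0})"
    then have "u \<in> {t1..t} - N" "u \<in> {t1..<s0}" using s0 by auto
    then obtain v where "norm v \<le> C" "(X has_vector_derivative v) (at u within {t1..t})"
      using der before by blast
    then show "\<exists>v. norm v \<le> C \<and> (X has_vector_derivative v) (at u within {t1..s0})"
      using s0 has_vector_derivative_within_subset[of X _ u "{t1..t}" "{t1..s0}"] by auto
  qed (use s0 in auto)
  also have "\<dots> \<le> C * (t - t1)" using s0 C(2) by (intro mult_left_mono) auto
  finally show False using s0(2) C(1) by (simp add: dist_norm norm_minus_commute)
qed

definition solves_through :: "('a::euclidean_space \<Rightarrow> 'a set) \<Rightarrow> 'a \<Rightarrow> real \<Rightarrow> real set \<Rightarrow> (real \<Rightarrow> 'a) \<Rightarrow> bool" where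
  "solves_through \<Phi> p t1 I X \<longleftrightarrow> is_interval I \<and> t1 \<in> I \<and> solves_inclusion \<Phi> I X \<and> X t1 = p"

lemma solves_through_uminus:
  assumes "solves_through \<Phi> p t1 I X"
  shows "solves_through (\<lambda>y. uminus ` \<Phi> y) p (- t1) (uminus ` I) (\<lambda>t. X (- t))"
  using assms solves_inclusion_uminus[of \<Phi> I X] unfolding solves_through_def
  by (simp add: is_interval_minus_translation is_interval_uminus)

lemma is_interval_subset_Icc:
  fixes I :: "real set"
  assumes "is_interval I" "a \<in> I" "b \<in> I"
  shows "{a..b} \<subseteq> I"
  using assms mem_is_interval_1_I[of I a b] by (meson atLeastAtMost_iff subsetI)

text \<open>
  What happens after the crossing time. In a small ball every admissible velocity \<open>v\<close> has
  \<open>v \<bullet> n \<ge> c > 0\<close> and \<open>norm v \<le> C\<close>, so a solution \<open>X\<close> starting at \<^term>\<open>p\<close> at time \<open>t1\<close>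
  satisfies \<open>(X t - p) \<bullet> n \<ge> c (t - t1)\<close> and \<open>norm (X t - p) \<le> C (t - t1)\<close>. Differentiability of
  \<^term>\<open>\<phi>\<close> at \<^term>\<open>p\<close> with an error below \<open>c / (2 C) norm (y - p)\<close> then gives \<open>\<phi> (X t) > 0\<close>.
  From there on the solution follows the single Lipschitz field \<^term>\<open>fp\<close>, and two solutions agree
  on an interval so short that \<open>L h \<le> 1 / 2\<close>, where the supremum of their distance is at most half of
  itself. The length \<^term>\<open>h\<close> is the same for all solutions, as uniqueness requires.
\<close>

lemma transversal_crossing_forward:
  fixes \<Phi> :: "'a::euclidean_space \<Rightarrow> 'a set" and \<phi> :: "'a \<Rightarrow> real"
  assumes \<rho>: "\<rho> > 0"
    and hull: "\<And>y. y \<in> ball p \<rho> \<Longrightarrow> \<Phi> y \<subseteq> closed_segment (fm y) (fp y)"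
    and pos: "\<And>y. \<lbrakk>y \<in> ball p \<rho>; \<phi> y > 0\<rbrakk> \<Longrightarrow> \<Phi> y \<subseteq> {fp y}"
    and Lp: "L-lipschitz_on (ball p \<rho>) fp" and Lm: "continuous_on (ball p \<rho>) fm"
    and \<phi>p: "\<phi> p = 0" and der: "GDERIV \<phi> p :> n"
    and fp: "fp p \<bullet> n > 0" and fm: "fm p \<bullet> n > 0"
  obtains h where "h > 0"
    "\<And>I X t1 t. \<lbrakk>solves_through \<Phi> p t1 I X; t \<in> I; t1 < t; t \<le> t1 + h\<rbrakk>
       \<Longrightarrow> X t \<in> ball p \<rho> \<and> \<phi> (X t) > 0"
    "\<And>I X I' X' t1 t. \<lbrakk>solves_through \<Phi> p t1 I X; solves_through \<Phi> p t1 I' X'; t \<in> I; t \<in> I'; t1 \<le> t; t \<le> t1 + h\<rbrakk> \<Longrightarrow> X t = X' t"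
proof -
  have cp: "isCont fp p" and cm: "isCont fm p"
    using lipschitz_on_continuous_on[OF Lp] Lm \<rho>
    by (auto simp: continuous_on_eq_continuous_at)
  define c where "c = min (fp p \<bullet> n) (fm p \<bullet> n) / 2"
  define C where "C = max (norm (fp p)) (norm (fm p)) + 1"
  have c: "c > 0" "c < fp p \<bullet> n" "c < fm p \<bullet> n" using fp fm by (auto simp: c_def min_def)
  have C: "C > 0" "norm (fp p) < C" "norm (fm p) < C" 
    using norm_ge_zero[of "fp p"] unfolding C_def by linarith+
  have ev: "\<forall>\<^sub>F y in nhds p. norm (fp y) < C \<and> norm (fm y) < C \<and> c < fp y \<bullet> n \<and> c < fm y \<bullet> n"
  proof -
    have "((\<lambda>y. norm (fp y)) \<longlongrightarrow> norm (fp p)) (nhds p)" "((\<lambda>y. norm (fm y)) \<longlongrightarrow> norm (fm p)) (nhds p)"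
      "((\<lambda>y. fp y \<bullet> n) \<longlongrightarrow> fp p \<bullet> n) (nhds p)" "((\<lambda>y. fm y \<bullet> n) \<longlongrightarrow> fm p \<bullet> n) (nhds p)"
      using cp cm by (auto intro!: tendsto_intros simp: continuous_at tendsto_at_iff_tendsto_nhds)
    then show ?thesis using c C
      by (intro eventually_conj) (auto intro: order_tendstoD)
  qed
  have ev2: "\<forall>\<^sub>F y in nhds p. norm (\<phi> y - (y - p) \<bullet> n) \<le> c / (2 * C) * norm (y - p)"
  proof -
    have "(\<phi> has_derivative (\<lambda>h. h \<bullet> n)) (at p)" using der by (simp add: gderiv_def)
    then have "\<exists>d>0. \<forall>y. norm (y - p) < d \<longrightarrow> norm (\<phi> y - \<phi> p - (y - p) \<bullet> n) \<le> c / (2 * C) * norm (y - p)"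
      using c C unfolding has_derivative_at_alt by (metis divide_pos_pos mult_pos_pos zero_less_numeral)
    then show ?thesis using \<phi>p by (auto simp: eventually_nhds_metric dist_norm)
  qed
  obtain r where r: "r > 0" "\<And>y. dist y p < r \<Longrightarrow> norm (fp y) < C \<and> norm (fm y) < C \<and> c < fp y \<bullet> n \<and> c < fm y \<bullet> n"
     "\<And>y. dist y p < r \<Longrightarrow> norm (\<phi> y - (y - p) \<bullet> n) \<le> c / (2 * C) * norm (y - p)"
     using eventually_conj[OF ev ev2] unfolding eventually_nhds_metric by blast
  define r2 where "r2 = min r \<rho>"
  have r2: "r2 > 0" "r2 \<le> \<rho>" "r2 \<le> r" using r \<rho> by (auto simp: r2_def)
  have L: "L \<ge> 0" using Lp lipschitz_on_nonneg by blast
  \<comment> \<open>the first bound keeps solutions in the ball, the second makes the uniqueness estimate contract\<close>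
  define h where "h = min (r2 / (2 * C)) (1 / (2 * (L + 1)))"
  have h: "h > 0" "C * h \<le> r2 / 2" "L * h \<le> 1 / 2"
  proof -
    show "h > 0" using r2 C L by (simp add: h_def)
    have "C * h \<le> C * (r2 / (2 * C))" using C by (intro mult_left_mono) (auto simp: h_def)
    then show "C * h \<le> r2 / 2" using C by simp
    have "L * h \<le> L * (1 / (2 * (L + 1)))" using L by (intro mult_left_mono) (auto simp: h_def)
    also have "\<dots> \<le> 1 / 2" using L by (simp add: field_simps)
    finally show "L * h \<le> 1 / 2" .
  qed
  have seg: "norm v \<le> C \<and> c \<le> v \<bullet> n" if y: "y \<in> ball p r2" and v: "v \<in> \<Phi> y" for y v
  proof -
    have yr: "dist y p < r" "y \<in> ball p \<rho>" using y r2 by (auto simp: dist_commute)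
    have "v \<in> closed_segment (fm y) (fp y)" using hull[OF yr(2)] v by blast
    moreover have "closed_segment (fm y) (fp y) \<subseteq> cball 0 C \<inter> {v. c \<le> v \<bullet> n}"
    proof (rule closed_segment_subset)
      have "convex {v. c \<le> n \<bullet> v}" using convex_halfspace_ge[of c n] by simp
      then have "convex {v. c \<le> v \<bullet> n}" by (simp only: inner_commute)
      then show "convex (cball 0 C \<inter> {v. c \<le> v \<bullet> n})" by (intro convex_Int convex_cball)
    qed (use r(2)[OF yr(1)] in simp_all)
    ultimately show ?thesis by auto
  qed
  have basic: "X s \<in> ball p r2 \<and> (s > t1 \<longrightarrow> \<phi> (X s) > 0)"
    if sol: "solves_inclusion \<Phi> {t1..t} X" and X1: "X t1 = p" and t: "t1 \<le> t" "t \<le> t1 + h" 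
      and s: "s \<in> {t1..t}" for X t1 t s
  proof -
    obtain N where ac: "absolutely_continuous_on {t1..t} X" and N: "negligible N"
      "\<And>u. u \<in> {t1..t} - N \<Longrightarrow> \<exists>v\<in>\<Phi> (X u). (X has_vector_derivative v) (at u within {t1..t})"
      using sol unfolding solves_inclusion_def by blast
    have Ct: "C * (t - t1) < r2"
    proof -
      have "C * (t - t1) \<le> C * h" using C t by (intro mult_left_mono) auto
      then show ?thesis using h r2 by linarith
    qed
    have inball: "X u \<in> ball p r2" if "u \<in> {t1..t}" for u
    proof -
      have "X u \<in> ball (X t1) r2"
      proof (rule absolutely_continuous_stays_in_ball[OF ac t(1) N(1) _ Ct _ that])
        show "\<exists>v. norm v \<le> C \<and> (X has_vector_derivative v) (at s within {t1..t})"
          if "s \<in> {t1..t} - N" "X s \<in> ball (X t1) r2" for s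
          using N(2)[OF that(1)] seg[of "X s"] that(2) unfolding X1 by blast
      qed (use C in simp)
      then show ?thesis using X1 by simp
    qed
    have acs: "absolutely_continuous_on {t1..s} X"
      by (rule absolutely_continuous_on_subset[OF ac]) (use s in auto)
    have ders: "\<exists>v\<in>\<Phi> (X u). (X has_vector_derivative v) (at u within {t1..s})" "u \<in> {t1..t}"
      if uN: "u \<in> {t1..s} - N" for u
    proof -
      show u: "u \<in> {t1..t}" using uN s by auto
      then obtain v where "v\<in>\<Phi> (X u)" "(X has_vector_derivative v) (at u within {t1..t})"
        using N(2)[of u] uN by auto
      moreover have "{t1..s} \<subseteq> {t1..t}" using s by auto
      ultimately show "\<exists>v\<in>\<Phi> (X u). (X has_vector_derivative v) (at u within {t1..s})"
        using has_vector_derivative_within_subset by blast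
    qed
    have "norm (X s - X t1) \<le> C * (s - t1)"
    proof (rule absolutely_continuous_norm_increment_le[OF acs _ N(1)])
      show "\<exists>v. norm v \<le> C \<and> (X has_vector_derivative v) (at u within {t1..s})"
        if "u \<in> {t1..s} - N" for u
        using ders(1)[OF that] seg[OF inball[OF ders(2)[OF that]]] by blast
    qed (use s in simp)
    then have up: "norm (X s - p) \<le> C * (s - t1)" using X1 by simp
    have "(X s - X t1) \<bullet> (- n) \<le> - c * (s - t1)"
    proof (rule absolutely_continuous_inner_increment_le[OF acs _ N(1)])
      fix u assume u: "u \<in> {t1..s} - N"
      then obtain v where "v\<in>\<Phi> (X u)" "(X has_vector_derivative v) (at u within {t1..s})"
        using ders by blast
      then show "\<exists>v. v \<bullet> - n \<le> - c \<and> (X has_vector_derivative v) (at u within {t1..s})"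
        using seg[OF inball[OF ders(2)[OF u]], of v] by (intro exI[of _ v]) simp
    qed (use s in auto)
    then have low: "c * (s - t1) \<le> (X s - p) \<bullet> n" using X1 by simp
    have "\<phi> (X s) > 0" if "s > t1"
    proof -
      have "norm (\<phi> (X s) - (X s - p) \<bullet> n) \<le> c / (2 * C) * norm (X s - p)"
        using r(3)[of "X s"] inball[OF s] r2 by (auto simp: dist_commute)
      also have "\<dots> \<le> c / (2 * C) * (C * (s - t1))"
        using up c C by (intro mult_left_mono) auto
      also have "\<dots> = c * (s - t1) / 2" using C by simp
      finally have "\<phi> (X s) \<ge> c * (s - t1) / 2" using low unfolding real_norm_def by linarith
      moreover have "c * (s - t1) > 0" using c that by simp
      ultimately show ?thesis by linarith
    qed
    then show ?thesis using inball[OF s] by blast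
  qed
  show thesis
  proof (rule that[OF h(1)])
    fix I X and t1 t :: real
    assume "solves_through \<Phi> p t1 I X" and "t \<in> I" "t1 < t" "t \<le> t1 + h"
    then have "is_interval I" "t1 \<in> I" and sol: "solves_inclusion \<Phi> I X" and "X t1 = p" "t \<in> I" "t1 < t" "t \<le> t1 + h"
      by (auto simp: solves_through_def)
    then have "{t1..t} \<subseteq> I" by (intro is_interval_subset_Icc)
    then have "X t \<in> ball p r2 \<and> (t > t1 \<longrightarrow> \<phi> (X t) > 0)" 
      by (rule basic[OF solves_inclusion_subset[OF sol] \<open>X t1 = p\<close>])
        (use \<open>t1 < t\<close> \<open>t \<le> t1 + h\<close> in simp_all)
    then show "X t \<in> ball p \<rho> \<and> \<phi> (X t) > 0" using \<open>t1 < t\<close> r2 by auto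
  next
    fix I I' X X' and t1 t :: real
    assume thr: "solves_through \<Phi> p t1 I X" "solves_through \<Phi> p t1 I' X'"
      and tI: "t \<in> I" "t \<in> I'" and t: "t1 \<le> t" "t \<le> t1 + h"
    from thr have int: "is_interval I" "is_interval I'" "t1 \<in> I" "t1 \<in> I'"
      and sols: "solves_inclusion \<Phi> I X" "solves_inclusion \<Phi> I' X'"
      and X1: "X t1 = p" "X' t1 = p" by (auto simp: solves_through_def)
    have sub: "{t1..t} \<subseteq> I" "{t1..t} \<subseteq> I'" using int tI by (simp_all add: is_interval_subset_Icc)
    have sol: "solves_inclusion \<Phi> {t1..t} X" and sol': "solves_inclusion \<Phi> {t1..t} X'"
      using sols sub solves_inclusion_subset by blast+
    obtain N where ac: "absolutely_continuous_on {t1..t} X" and N: "negligible N"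
      "\<And>u. u \<in> {t1..t} - N \<Longrightarrow> \<exists>v\<in>\<Phi> (X u). (X has_vector_derivative v) (at u within {t1..t})"
      using sol unfolding solves_inclusion_def by blast
    obtain N' where ac': "absolutely_continuous_on {t1..t} X'" and N': "negligible N'"
      "\<And>u. u \<in> {t1..t} - N' \<Longrightarrow> \<exists>v\<in>\<Phi> (X' u). (X' has_vector_derivative v) (at u within {t1..t})"
      using sol' unfolding solves_inclusion_def by blast
    define D where "D u = X u - X' u" for u
    have X_diff: "D v - D u = (X v - X u) - (X' v - X' u)" for u v by (simp add: D_def)
    have acD: "absolutely_continuous_on {t1..t} D"
      by (rule absolutely_continuous_on_dominated[OF ac ac' zero_less_one])
         (unfold X_diff mult_1, rule norm_triangle_ineq4)
    have contD: "continuous_on {t1..t} (\<lambda>u. norm (D u))"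
      by (intro continuous_intros absolutely_continuous_on_imp_continuous_on[OF acD])
    obtain s where s: "s \<in> {t1..t}" "\<And>u. u \<in> {t1..t} \<Longrightarrow> norm (D u) \<le> norm (D s)"
      using continuous_attains_sup[OF _ _ contD] t by auto
    define M where "M = norm (D s)"
    have "norm (D s - D t1) \<le> (L * M) * (s - t1)"
    proof (rule absolutely_continuous_norm_increment_le)
      show "absolutely_continuous_on {t1..s} D" by (rule absolutely_continuous_on_subset[OF acD]) (use s in auto)
      show "negligible (N \<union> N' \<union> {t1})" using N N' by auto
      show "t1 \<le> s" using s by auto
      fix u assume u: "u \<in> {t1..s} - (N \<union> N' \<union> {t1})"
      then have ut: "u \<in> {t1..t}" "u > t1" using s by auto
      obtain v where v: "v\<in>\<Phi> (X u)" "(X has_vector_derivative v) (at u within {t1..t})"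
        using N(2)[of u] ut u by auto
      obtain v' where v': "v'\<in>\<Phi> (X' u)" "(X' has_vector_derivative v') (at u within {t1..t})"
        using N'(2)[of u] ut u by auto
      have XX: "X u \<in> ball p \<rho> \<and> \<phi> (X u) > 0" "X' u \<in> ball p \<rho> \<and> \<phi> (X' u) > 0"
        using basic[OF sol X1(1) t ut(1)] basic[OF sol' X1(2) t ut(1)] ut(2) r2 by auto
      have vv: "v = fp (X u)" "v' = fp (X' u)" using v v' XX pos by blast+
      have "norm (v - v') \<le> L * norm (X u - X' u)"
        using lipschitz_onD[OF Lp, of "X u" "X' u"] XX vv by (simp add: dist_norm)
      also have "\<dots> \<le> L * M" using L s(2)[OF ut(1)] by (intro mult_left_mono) (auto simp: D_def M_def)
      finally have "norm (v - v') \<le> L * M" .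
      moreover have "(D has_vector_derivative (v - v')) (at u within {t1..t})"
        unfolding D_def[abs_def] by (intro derivative_intros v v')
      ultimately show "\<exists>v. norm v \<le> L * M \<and> (D has_vector_derivative v) (at u within {t1..s})"
        using s has_vector_derivative_within_subset[of D _ u "{t1..t}" "{t1..s}"] by auto
    qed
    also have "D t1 = 0" using X1 by (simp add: D_def)
    also have "(L * M) * (s - t1) \<le> (L * M) * h" 
      using s t L by (intro mult_left_mono) (auto simp: M_def)
    also have "\<dots> = (L * h) * M" by simp
    also have "\<dots> \<le> 1 / 2 * M" using h by (intro mult_right_mono) (auto simp: M_def)
    finally have "M = 0" by (simp add: M_def)
    then have "norm (D t) \<le> 0" using s(2)[of t] t by (simp add: M_def)
    then show "X t = X' t" by (simp add: D_def)
  qed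
qed

text \<open>
  Time reversal replaces \<^term>\<open>\<Phi>\<close> by its negative, under which \<open>- fm\<close> becomes the field on the side
  that is entered and \<open>- \<phi>\<close> the crossing function; the positivity of both normal components is
  preserved. So the forward lemma also describes the time before the crossing.
\<close>

lemma transversal_crossing:
  fixes \<Phi> :: "'a::euclidean_space \<Rightarrow> 'a set" and \<phi> :: "'a \<Rightarrow> real"
  assumes \<rho>: "\<rho> > 0"
    and hull: "\<And>y. y \<in> ball p \<rho> \<Longrightarrow> \<Phi> y \<subseteq> closed_segment (fm y) (fp y)"
    and pos: "\<And>y. \<lbrakk>y \<in> ball p \<rho>; \<phi> y > 0\<rbrakk> \<Longrightarrow> \<Phi> y \<subseteq> {fp y}"
    and neg: "\<And>y. \<lbrakk>y \<in> ball p \<rho>; \<phi> y < 0\<rbrakk> \<Longrightarrow> \<Phi> y \<subseteq> {fm y}"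
    and Lp: "L-lipschitz_on (ball p \<rho>) fp" and Lm: "L-lipschitz_on (ball p \<rho>) fm"
    and \<phi>p: "\<phi> p = 0" and der: "GDERIV \<phi> p :> n"
    and fp: "fp p \<bullet> n > 0" and fm: "fm p \<bullet> n > 0"
  obtains h where "h > 0"
    "\<And>I X t1 t. \<lbrakk>solves_through \<Phi> p t1 I X; t \<in> I; t1 < t; t \<le> t1 + h\<rbrakk>
       \<Longrightarrow> X t \<in> ball p \<rho> \<and> \<phi> (X t) > 0"
    "\<And>I X t1 t. \<lbrakk>solves_through \<Phi> p t1 I X; t \<in> I; t < t1; t1 - h \<le> t\<rbrakk>
       \<Longrightarrow> X t \<in> ball p \<rho> \<and> \<phi> (X t) < 0"
    "\<And>I X I' X' t1 t. \<lbrakk>solves_through \<Phi> p t1 I X; solves_through \<Phi> p t1 I' X'; t \<in> I; t \<in> I'; t1 - h \<le> t; t \<le> t1 + h\<rbrakk> \<Longrightarrow> X t = X' t"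
proof -
  obtain h1 where h1: "h1 > 0"
    and fwd: "\<And>I X t1 t. \<lbrakk>solves_through \<Phi> p t1 I X; t \<in> I; t1 < t; t \<le> t1 + h1\<rbrakk>
       \<Longrightarrow> X t \<in> ball p \<rho> \<and> \<phi> (X t) > 0"
    and fuq: "\<And>I X I' X' t1 t. \<lbrakk>solves_through \<Phi> p t1 I X; solves_through \<Phi> p t1 I' X'; t \<in> I; t \<in> I'; t1 \<le> t; t \<le> t1 + h1\<rbrakk> \<Longrightarrow> X t = X' t"
    by (rule transversal_crossing_forward[OF \<rho> hull pos Lp lipschitz_on_continuous_on[OF Lm] \<phi>p der fp fm]) blast+
  \<comment> \<open>Reversing time turns the inclusion into the one for \<^term>\<open>\<lambda>y. uminus ` \<Phi> y\<close>; there the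
    roles of the two fields are exchanged and the crossing function changes sign.\<close>
  let ?\<Psi> = "\<lambda>y. uminus ` \<Phi> y"
  have hull': "?\<Psi> y \<subseteq> closed_segment (- fp y) (- fm y)" if "y \<in> ball p \<rho>" for y
  proof -
    have "?\<Psi> y \<subseteq> uminus ` closed_segment (fm y) (fp y)" using hull[OF that] by blast
    also have "\<dots> = closed_segment (- fm y) (- fp y)"
      by (rule closed_segment_linear_image[symmetric]) (rule module_hom_uminus)
    also have "\<dots> = closed_segment (- fp y) (- fm y)" by (rule closed_segment_commute)
    finally show ?thesis .
  qed
  have pos': "?\<Psi> y \<subseteq> {- fm y}" if "y \<in> ball p \<rho>" "- \<phi> y > 0" for y
  proof -
    have "\<Phi> y \<subseteq> {fm y}" using that by (intro neg) simp_all
    then show ?thesis by blast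
  qed
  have der': "GDERIV (\<lambda>y. - \<phi> y) p :> - n" by (rule GDERIV_minus[OF der])
  have Lm': "L-lipschitz_on (ball p \<rho>) (\<lambda>y. - fm y)" "L-lipschitz_on (ball p \<rho>) (\<lambda>y. - fp y)"
    by (rule lipschitz_on_minus[OF Lm] lipschitz_on_minus[OF Lp])+
  obtain h2 where h2: "h2 > 0"
    and bwd: "\<And>I X t1 t. \<lbrakk>solves_through ?\<Psi> p t1 I X; t \<in> I; t1 < t; t \<le> t1 + h2\<rbrakk>
       \<Longrightarrow> X t \<in> ball p \<rho> \<and> - \<phi> (X t) > 0"
    and buq: "\<And>I X I' X' t1 t. \<lbrakk>solves_through ?\<Psi> p t1 I X; solves_through ?\<Psi> p t1 I' X'; t \<in> I; t \<in> I'; t1 \<le> t; t \<le> t1 + h2\<rbrakk> \<Longrightarrow> X t = X' t"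
    by (rule transversal_crossing_forward[OF \<rho> hull' pos' Lm'(1) lipschitz_on_continuous_on[OF Lm'(2)] _ der'])
      (use \<phi>p fp fm in auto)
  show thesis
  proof (rule that[of "min h1 h2"])
    fix I X and t1 t :: real
    assume A: "solves_through \<Phi> p t1 I X" "t \<in> I" "t < t1" "t1 - min h1 h2 \<le> t"
    have "X (- (- t)) \<in> ball p \<rho> \<and> - \<phi> (X (- (- t))) > 0"
      by (rule bwd[OF solves_through_uminus[OF A(1)], of "- t"]) (use A in auto)
    then show "X t \<in> ball p \<rho> \<and> \<phi> (X t) < 0" by simp
  next
    fix I I' X X' and t1 t :: real
    assume A: "solves_through \<Phi> p t1 I X" "solves_through \<Phi> p t1 I' X'"
        "t \<in> I" "t \<in> I'" "t1 - min h1 h2 \<le> t" "t \<le> t1 + min h1 h2"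
    show "X t = X' t"
    proof (cases "t1 \<le> t")
      case True
      then show ?thesis using fuq[OF A(1-4)] A by auto
    next
      case False
      have "X (- (- t)) = X' (- (- t))"
        by (rule buq[OF solves_through_uminus[OF A(1)] solves_through_uminus[OF A(2)], of "- t"])
          (use A False in auto)
      then show ?thesis by simp
    qed
  qed (use h1 h2 fwd in auto)
qed

section \<open>Gradients and normals of level sets\<close>



text \<open>
  A substitute for the implicit function theorem for functions that are continuous near \<^term>\<open>p\<close> and
  differentiable at \<^term>\<open>p\<close>. For small \<open>t\<close> the intermediate value theorem gives zeros of \<^term>\<open>\<phi>\<close> on the segment
  through \<open>p + t v\<close> in direction \<^term>\<open>n\<close>, at distance \<open>o(t)\<close> from its centre; choosing a zero of least
  distance yields a curve with velocity \<^term>\<open>v\<close> at \<open>0\<close>. The curve may be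
  discontinuous elsewhere, which the notion of tangent vector permits.
\<close>

lemma tangent_vector_level_set:
  fixes \<phi> :: "'a::real_inner \<Rightarrow> real"
  assumes \<rho>: "\<rho> > 0" and cont: "continuous_on (ball p \<rho>) \<phi>"
    and \<phi>p: "\<phi> p = 0" and der: "GDERIV \<phi> p :> n" and n: "n \<noteq> 0"
    and M: "\<And>y. y \<in> ball p \<rho> \<Longrightarrow> \<phi> y = 0 \<Longrightarrow> y \<in> M"
    and v: "v \<bullet> n = 0"
  shows "tangent_vector M p v"
proof -
  define R where "R t = {s \<in> {-\<bar>t\<bar>..\<bar>t\<bar>}. \<phi> (p + t *\<^sub>R v + s *\<^sub>R n) = 0}" for t
  define K where "K = norm v + norm n"
  have K: "K > 0" using n by (simp add: K_def add_nonneg_pos)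
  have inb: "p + t *\<^sub>R v + s *\<^sub>R n \<in> ball p \<rho>" "norm (t *\<^sub>R v + s *\<^sub>R n) \<le> \<bar>t\<bar> * K"
    if "\<bar>t\<bar> * K < \<rho>" "s \<in> {-\<bar>t\<bar>..\<bar>t\<bar>}" for t s
  proof -
    have "norm (t *\<^sub>R v + s *\<^sub>R n) \<le> \<bar>t\<bar> * norm v + \<bar>s\<bar> * norm n"
      by (metis norm_scaleR norm_triangle_ineq)
    also have "\<dots> \<le> \<bar>t\<bar> * norm v + \<bar>t\<bar> * norm n"
      using that by (intro add_left_mono mult_right_mono) auto
    finally show *: "norm (t *\<^sub>R v + s *\<^sub>R n) \<le> \<bar>t\<bar> * K" by (simp add: K_def algebra_simps)
    then have "norm (t *\<^sub>R v + s *\<^sub>R n) < \<rho>" using that(1) by linarith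
    then have "dist (p + (t *\<^sub>R v + s *\<^sub>R n)) p < \<rho>" by (simp only: dist_norm add_diff_cancel_left')
    then show "p + t *\<^sub>R v + s *\<^sub>R n \<in> ball p \<rho>"
      by (simp only: mem_ball dist_commute[of p] add.assoc)
  qed
  have contR: "continuous_on {-\<bar>t\<bar>..\<bar>t\<bar>} (\<lambda>s. \<phi> (p + t *\<^sub>R v + s *\<^sub>R n))" if "\<bar>t\<bar> * K < \<rho>" for t
    by (rule continuous_on_compose2[OF cont]) (use inb[OF that] in \<open>auto intro!: continuous_intros simp del: mem_ball\<close>)
  have R_min: "\<exists>s\<in>R t. \<forall>s'\<in>R t. \<bar>s\<bar> \<le> \<bar>s'\<bar>" if "\<bar>t\<bar> * K < \<rho>" "R t \<noteq> {}" for t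
  proof -
    have "closed (R t)" unfolding R_def
      using continuous_closed_preimage_constant[OF contR[OF that(1)], of 0] by simp
    moreover have "bounded (R t)" unfolding R_def by (rule bounded_subset[of "{-\<bar>t\<bar>..\<bar>t\<bar>}"]) auto
    ultimately have "compact (R t)" by (simp add: compact_eq_bounded_closed)
    moreover have "continuous_on (R t) (\<lambda>s. \<bar>s\<bar>)" by (intro continuous_intros)
    ultimately show ?thesis using continuous_attains_inf[OF _ that(2)] by blast
  qed
  \<comment> \<open>the zero of least modulus, so that any zero of size \<open>\<epsilon> \<bar>t\<bar>\<close> bounds it\<close>
  define \<sigma> where "\<sigma> t = (SOME s. s \<in> R t \<and> (\<forall>s'\<in>R t. \<bar>s\<bar> \<le> \<bar>s'\<bar>))" for t
  have \<sigma>: "\<sigma> t \<in> R t" "\<And>s'. s' \<in> R t \<Longrightarrow> \<bar>\<sigma> t\<bar> \<le> \<bar>s'\<bar>" if "\<bar>t\<bar> * K < \<rho>" "R t \<noteq> {}" for t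
  proof -
    have "\<exists>s. s \<in> R t \<and> (\<forall>s'\<in>R t. \<bar>s\<bar> \<le> \<bar>s'\<bar>)" using R_min[OF that] by blast
    from someI_ex[OF this] show "\<sigma> t \<in> R t" "\<And>s'. s' \<in> R t \<Longrightarrow> \<bar>\<sigma> t\<bar> \<le> \<bar>s'\<bar>"
      unfolding \<sigma>_def by blast+
  qed
  have R0: "R 0 = {0}" using \<phi>p by (auto simp: R_def)
  have \<sigma>0: "\<sigma> 0 = 0" using \<sigma>(1)[of 0] \<rho> R0 by simp
  have root: "\<exists>d>0. \<forall>t. \<bar>t\<bar> < d \<longrightarrow> \<bar>t\<bar> * K < \<rho> \<and> (\<exists>s\<in>R t. \<bar>s\<bar> \<le> \<epsilon> * \<bar>t\<bar>)" if \<epsilon>: "0 < \<epsilon>" "\<epsilon> \<le> 1" for \<epsilon>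
  proof -
    define \<eta> where "\<eta> = \<epsilon> * (n \<bullet> n) / (2 * K)"
    have \<eta>: "\<eta> > 0" using \<epsilon> n K by (simp add: \<eta>_def)
    have "(\<phi> has_derivative (\<lambda>h. h \<bullet> n)) (at p)" using der by (simp add: gderiv_def)
    then obtain d1 where d1: "d1 > 0" "\<And>y. norm (y - p) < d1 \<Longrightarrow> norm (\<phi> y - \<phi> p - (y - p) \<bullet> n) \<le> \<eta> * norm (y - p)"
      using \<eta> unfolding has_derivative_at_alt by blast
    define d where "d = min d1 \<rho> / K"
    have d: "d > 0" using d1 \<rho> K by (simp add: d_def)
    have "\<bar>t\<bar> * K < \<rho> \<and> (\<exists>s\<in>R t. \<bar>s\<bar> \<le> \<epsilon> * \<bar>t\<bar>)" if t: "\<bar>t\<bar> < d" for t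
    proof (cases "t = 0")
      case True
      then show ?thesis using R0 \<rho> by simp
    next
      case False
      have tK: "\<bar>t\<bar> * K < \<rho>" "\<bar>t\<bar> * K < d1" using t K by (auto simp: d_def field_simps)
      define f where "f s = \<phi> (p + t *\<^sub>R v + s *\<^sub>R n)" for s
      have est: "\<bar>f s - s * (n \<bullet> n)\<bar> < \<epsilon> * \<bar>t\<bar> * (n \<bullet> n)" if s: "s \<in> {-\<bar>t\<bar>..\<bar>t\<bar>}" for s
      proof -
        let ?y = "p + t *\<^sub>R v + s *\<^sub>R n"
        have ny: "norm (?y - p) \<le> \<bar>t\<bar> * K" using inb(2)[OF tK(1) s] by (simp add: add.assoc)
        have "norm (\<phi> ?y - \<phi> p - (?y - p) \<bullet> n) \<le> \<eta> * norm (?y - p)"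
          using d1(2)[of ?y] ny tK by linarith
        also have "\<dots> \<le> \<eta> * (\<bar>t\<bar> * K)" using ny \<eta> by (intro mult_left_mono) auto
        also have "\<dots> = \<epsilon> * \<bar>t\<bar> * (n \<bullet> n) / 2" using K by (simp add: \<eta>_def)
        also have "\<dots> < \<epsilon> * \<bar>t\<bar> * (n \<bullet> n)" using False \<epsilon> n by simp
        finally show ?thesis using \<phi>p v by (simp add: f_def inner_add_left inner_diff_left)
      qed
      have et: "\<epsilon> * \<bar>t\<bar> \<in> {-\<bar>t\<bar>..\<bar>t\<bar>}" "- (\<epsilon> * \<bar>t\<bar>) \<in> {-\<bar>t\<bar>..\<bar>t\<bar>}" 
      proof -
        have "0 \<le> \<epsilon> * \<bar>t\<bar>" "\<epsilon> * \<bar>t\<bar> \<le> \<bar>t\<bar>" using \<epsilon> by (simp_all add: mult_left_le_one_le)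
        then show "\<epsilon> * \<bar>t\<bar> \<in> {-\<bar>t\<bar>..\<bar>t\<bar>}" "- (\<epsilon> * \<bar>t\<bar>) \<in> {-\<bar>t\<bar>..\<bar>t\<bar>}"
          unfolding atLeastAtMost_iff by linarith+
      qed
      have "f (- (\<epsilon> * \<bar>t\<bar>)) \<le> 0" "0 \<le> f (\<epsilon> * \<bar>t\<bar>)" using est[OF et(1)] est[OF et(2)] by (auto simp: abs_less_iff)
      moreover have "continuous_on {- (\<epsilon> * \<bar>t\<bar>)..\<epsilon> * \<bar>t\<bar>} f"
        unfolding f_def by (rule continuous_on_subset[OF contR[OF tK(1)]]) (use et in auto)
      moreover have "- (\<epsilon> * \<bar>t\<bar>) \<le> \<epsilon> * \<bar>t\<bar>" using \<epsilon> by simp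
      ultimately obtain s where "- (\<epsilon> * \<bar>t\<bar>) \<le> s" "s \<le> \<epsilon> * \<bar>t\<bar>" "f s = 0"
        using IVT'[of f "- (\<epsilon> * \<bar>t\<bar>)" 0 "\<epsilon> * \<bar>t\<bar>"] by blast
      moreover from this et have "s \<in> R t" by (auto simp: R_def f_def)
      ultimately show ?thesis using tK by (auto intro!: bexI[of _ s])
    qed
    then show ?thesis using d by blast
  qed
  define c where "c t = p + t *\<^sub>R v + \<sigma> t *\<^sub>R n" for t
  have "c 0 = p" by (simp add: c_def \<sigma>0)
  moreover have "\<forall>\<^sub>F t in at 0. c t \<in> M"
  proof -
    obtain d where d: "d > 0" "\<And>t. \<bar>t\<bar> < d \<Longrightarrow> \<bar>t\<bar> * K < \<rho> \<and> (\<exists>s\<in>R t. \<bar>s\<bar> \<le> 1 * \<bar>t\<bar>)"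
      using root[of 1] by auto
    have "c t \<in> M" if "\<bar>t\<bar> < d" for t
    proof -
      have t: "\<bar>t\<bar> * K < \<rho>" "R t \<noteq> {}" using d(2)[OF that] by auto
      then have "\<sigma> t \<in> R t" using \<sigma> by blast
      then show ?thesis using inb(1)[OF t(1), of "\<sigma> t"] M[of "c t"] by (auto simp: R_def c_def)
    qed
    then show ?thesis using d(1) by (auto simp: eventually_at dist_norm)
  qed
  moreover have "(c has_vector_derivative v) (at 0)"
    unfolding has_vector_derivative_def has_derivative_at_alt
  proof (intro conjI allI impI)
    show "bounded_linear (\<lambda>x. x *\<^sub>R v)" by (rule bounded_linear_scaleR_left)
    fix e :: real assume e: "e > 0"
    define \<epsilon> where "\<epsilon> = min 1 (e / norm n)"
    have \<epsilon>: "0 < \<epsilon>" "\<epsilon> \<le> 1" using e n by (auto simp: \<epsilon>_def)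
    obtain d where d: "d > 0" "\<And>t. \<bar>t\<bar> < d \<Longrightarrow> \<bar>t\<bar> * K < \<rho> \<and> (\<exists>s\<in>R t. \<bar>s\<bar> \<le> \<epsilon> * \<bar>t\<bar>)"
      using root[OF \<epsilon>] by blast
    have "norm (c t - c 0 - (t - 0) *\<^sub>R v) \<le> e * norm (t - 0)" if td: "\<bar>t\<bar> < d" for t
    proof -
      obtain s where t: "\<bar>t\<bar> * K < \<rho>" and s: "s \<in> R t" "\<bar>s\<bar> \<le> \<epsilon> * \<bar>t\<bar>" using d(2)[OF td] by blast
      have "\<bar>\<sigma> t\<bar> \<le> \<epsilon> * \<bar>t\<bar>" using \<sigma>(2)[of t s] t s by force
      then have "\<bar>\<sigma> t\<bar> * norm n \<le> (\<epsilon> * \<bar>t\<bar>) * norm n" by (rule mult_right_mono) simp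
      also have "\<dots> = (\<epsilon> * norm n) * \<bar>t\<bar>" by simp
      also have "\<dots> \<le> e * \<bar>t\<bar>" using n by (intro mult_right_mono) (auto simp: \<epsilon>_def min_def field_simps)
      finally show ?thesis by (simp add: c_def \<sigma>0)
    qed
    then show "\<exists>d>0. \<forall>y. norm (y - 0) < d \<longrightarrow> norm (c y - c 0 - (y - 0) *\<^sub>R v) \<le> e * norm (y - 0)"
      using d(1) by (metis diff_zero real_norm_def)
  qed
  ultimately show ?thesis unfolding tangent_vector_def by blast
qed

text \<open>
  The component of \<^term>\<open>\<nu>\<close> orthogonal to \<^term>\<open>n\<close> is tangent to the level set by the
  previous lemma, hence orthogonal to \<^term>\<open>\<nu>\<close>, hence zero. The sign comes from the side to which
  \<^term>\<open>\<nu>\<close> points.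
\<close>

lemma gradient_parallel_to_level_set_normal:
  fixes \<phi> :: "'a::real_inner \<Rightarrow> real"
  assumes \<rho>: "\<rho> > 0" and cont: "continuous_on (ball p \<rho>) \<phi>"
    and \<phi>p: "\<phi> p = 0" and der: "GDERIV \<phi> p :> n" and n: "n \<noteq> 0"
    and M: "\<And>y. y \<in> ball p \<rho> \<Longrightarrow> \<phi> y = 0 \<Longrightarrow> y \<in> M"
    and tan: "\<And>v. tangent_vector M p v \<Longrightarrow> \<nu> \<bullet> v = 0"
    and \<nu>: "norm \<nu> = 1" and pos: "\<forall>\<^sub>F t in at_right 0. \<phi> (p + t *\<^sub>R \<nu>) > 0"
  obtains \<alpha> where "\<alpha> > 0" "n = \<alpha> *\<^sub>R \<nu>"
proof -
  define v where "v = \<nu> - ((\<nu> \<bullet> n) / (n \<bullet> n)) *\<^sub>R n"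
  have vn: "v \<bullet> n = 0" using n by (simp add: v_def inner_diff_left)
  then have "\<nu> \<bullet> v = 0" using tan tangent_vector_level_set[OF \<rho> cont \<phi>p der n M] by blast
  then have "v \<bullet> v = 0" using vn by (simp add: v_def inner_diff_left inner_commute inner_diff_right)
  then have \<nu>n: "\<nu> = ((\<nu> \<bullet> n) / (n \<bullet> n)) *\<^sub>R n" by (simp add: v_def)
  then have ne: "\<nu> \<bullet> n \<noteq> 0" using \<nu> by (metis divide_eq_0_iff norm_zero scale_zero_left zero_neq_one)
  have "((\<lambda>t. \<phi> (p + t *\<^sub>R \<nu>)) has_real_derivative \<nu> \<bullet> n) (at 0)"
  proof -
    have 1: "((\<lambda>t. p + t *\<^sub>R \<nu>) has_derivative (\<lambda>t. t *\<^sub>R \<nu>)) (at 0)"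
      by (auto intro!: derivative_eq_intros)
    have "((\<lambda>t. \<phi> (p + t *\<^sub>R \<nu>)) has_derivative (\<lambda>t. (t *\<^sub>R \<nu>) \<bullet> n)) (at 0)"
      using has_derivative_compose[OF 1, of \<phi> "\<lambda>h. h \<bullet> n"] der by (simp add: gderiv_def)
    then show ?thesis by (simp add: has_field_derivative_def mult_commute_abs)
  qed
  then have "((\<lambda>t. (\<phi> (p + t *\<^sub>R \<nu>) - \<phi> p) / t) \<longlongrightarrow> \<nu> \<bullet> n) (at_right 0)"
    unfolding has_field_derivative_iff by (simp add: filterlim_at_split)
  moreover have "\<forall>\<^sub>F t in at_right 0. 0 \<le> (\<phi> (p + t *\<^sub>R \<nu>) - \<phi> p) / t"
    using pos eventually_at_right_less[of 0] by eventually_elim (simp add: \<phi>p)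
  ultimately have "\<nu> \<bullet> n \<ge> 0"
    by (rule tendsto_lowerbound) simp
  then have "\<nu> \<bullet> n > 0" using ne by simp
  show thesis
  proof (rule that[of "(n \<bullet> n) / (\<nu> \<bullet> n)"])
    show "0 < n \<bullet> n / (\<nu> \<bullet> n)" using \<open>\<nu> \<bullet> n > 0\<close> n by simp
    have "(n \<bullet> n / (\<nu> \<bullet> n)) *\<^sub>R \<nu> = (n \<bullet> n / (\<nu> \<bullet> n)) *\<^sub>R (((\<nu> \<bullet> n) / (n \<bullet> n)) *\<^sub>R n)"
      using \<nu>n by metis
    then show "n = (n \<bullet> n / (\<nu> \<bullet> n)) *\<^sub>R \<nu>" using ne n by simp
  qed
qed

section \<open>Maximizing glide directions\<close>

text \<open>
  A line meets the unit circle in at most two points.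
\<close>

lemma unit_vectors_same_inner_card_le_2:
  fixes a :: "real^2"
  assumes a: "a \<noteq> 0" and fin: "finite S" and S: "\<And>g. g \<in> S \<Longrightarrow> norm g = 1 \<and> a \<bullet> g = m"
  shows "card S \<le> 2"
proof (rule ccontr)
  assume "\<not> card S \<le> 2"
  then have "card S \<ge> 3" by simp
  then obtain T where "T \<subseteq> S" "card T = 3" using obtain_subset_with_card_n by metis
  then obtain g h k where ghk: "T = {g,h,k}" "g \<noteq> h" "g \<noteq> k" "h \<noteq> k" by (auto simp: card_3_iff)
  define p where "p = (vector [- a$2, a$1] :: real^2)"
  have on_line: "\<exists>s. x = g + s *\<^sub>R p" if "x \<in> S" for x
  proof -
    have "a \<bullet> (x - g) = 0" using S that ghk \<open>T \<subseteq> S\<close> by (simp add: inner_diff_right)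
    then have 1: "a$1 * (x$1 - g$1) + a$2 * (x$2 - g$2) = 0" by (simp add: inner_vec_def sum_2)
    have a0: "a$1 * a$1 + a$2 * a$2 > 0" using a by (simp add: vec_eq_iff forall_2 sum_squares_gt_zero_iff)
    define s where "s = (a$1 * (x$2 - g$2) - a$2 * (x$1 - g$1)) / (a$1 * a$1 + a$2 * a$2)"
    have "s * (a$1 * a$1 + a$2 * a$2) = a$1 * (x$2 - g$2) - a$2 * (x$1 - g$1)" using a0 by (simp add: s_def)
    then have "(x$1 - g$1 + s * a$2) * (a$1 * a$1 + a$2 * a$2) = 0" "(x$2 - g$2 - s * a$1) * (a$1 * a$1 + a$2 * a$2) = 0"
      using 1 by algebra+
    then have "x$1 = g$1 - s * a$2" "x$2 = g$2 + s * a$1" using a0 by auto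
    then show ?thesis by (intro exI[of _ s]) (simp add: vec_eq_iff forall_2 p_def)
  qed
  obtain s where s: "h = g + s *\<^sub>R p" using on_line[of h] ghk \<open>T \<subseteq> S\<close> by auto
  obtain t where t: "k = g + t *\<^sub>R p" using on_line[of k] ghk \<open>T \<subseteq> S\<close> by auto
  have "norm g = 1" "norm h = 1" "norm k = 1" using S ghk \<open>T \<subseteq> S\<close> by auto
  then have "g \<bullet> g = 1" "h \<bullet> h = 1" "k \<bullet> k = 1" by (simp_all add: norm_eq_1)
  then have "s * (2 * (g \<bullet> p) + s * (p \<bullet> p)) = 0" "t * (2 * (g \<bullet> p) + t * (p \<bullet> p)) = 0"
    by (auto simp: s t inner_add_left inner_add_right algebra_simps inner_commute)
  moreover have "s \<noteq> 0" "t \<noteq> 0" using s t ghk by auto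
  ultimately have "2 * (g \<bullet> p) + s * (p \<bullet> p) = 0" "2 * (g \<bullet> p) + t * (p \<bullet> p) = 0" by simp_all
  then have "(s - t) * (p \<bullet> p) = 0" by (simp only: left_diff_distrib)
  moreover have "p \<noteq> 0" using a by (auto simp: p_def vec_eq_iff forall_2)
  ultimately have "s = t" by simp
  then show False using s t ghk by simp
qed

lemma mem_max_glide: "g \<in> max_glide G j l Z \<longleftrightarrow> g \<in> G \<and> (\<forall>h\<in>G. j l Z \<bullet> h \<le> j l Z \<bullet> g)"
  by (auto simp: max_glide_def is_arg_max_def not_less)

lemma max_glide_nonempty:
  assumes "finite G" "G \<noteq> {}"
  shows "max_glide G j l Z \<noteq> {}"
proof -
  have "Max ((\<lambda>h. j l Z \<bullet> h) ` G) \<in> (\<lambda>h. j l Z \<bullet> h) ` G" using assms by (intro Max_in) auto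
  then obtain g where g: "g \<in> G" "Max ((\<lambda>h. j l Z \<bullet> h) ` G) = j l Z \<bullet> g" by blast
  have "\<forall>h\<in>G. j l Z \<bullet> h \<le> j l Z \<bullet> g"
    unfolding g(2)[symmetric] using assms(1) by (intro ballI Max_ge) auto
  with g(1) have "g \<in> max_glide G j l Z" by (simp add: mem_max_glide)
  then show ?thesis by blast
qed

text \<open>
  A direction that is strictly beaten at \<^term>\<open>Z1\<close> is still beaten nearby, and there are
  only finitely many directions.
\<close>

lemma max_glide_upper_semicontinuous:
  assumes "finite G" and cont: "isCont (j l) Z1"
  shows "\<forall>\<^sub>F Z in nhds Z1. max_glide G j l Z \<subseteq> max_glide G j l Z1"
proof -
  have "\<forall>\<^sub>F Z in nhds Z1. g \<in> max_glide G j l Z \<longrightarrow> g \<in> max_glide G j l Z1" if g: "g \<in> G" for g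
  proof (cases "g \<in> max_glide G j l Z1")
    case False
    then obtain h where h: "h \<in> G" "j l Z1 \<bullet> g < j l Z1 \<bullet> h" using g by (auto simp: mem_max_glide not_le)
    have "((\<lambda>Z. j l Z \<bullet> h - j l Z \<bullet> g) \<longlongrightarrow> j l Z1 \<bullet> h - j l Z1 \<bullet> g) (nhds Z1)"
      using cont by (intro tendsto_intros) (auto simp: continuous_at tendsto_at_iff_tendsto_nhds)
    then have "\<forall>\<^sub>F Z in nhds Z1. 0 < j l Z \<bullet> h - j l Z \<bullet> g" using h by (intro order_tendstoD) auto
    then show ?thesis by eventually_elim (use h in \<open>force simp: mem_max_glide\<close>)
  qed simp
  then have "\<forall>\<^sub>F Z in nhds Z1. \<forall>g\<in>G. g \<in> max_glide G j l Z \<longrightarrow> g \<in> max_glide G j l Z1"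
    by (intro eventually_ball_finite assms(1) ballI)
  then show ?thesis by eventually_elim (auto simp: mem_max_glide)
qed

lemma glide_directions_nonempty: "glide_directions G \<Longrightarrow> G \<noteq> {}"
  unfolding glide_directions_def
  by (metis UNIV_I singletonD span_empty vec_eq_iff vec_component one_neq_zero)

text \<open>
  A nonvanishing force has at most two maximizing directions, and exactly two are excluded since no
  two dislocations are ambiguous at once.
\<close>

lemma max_glide_singleton_off_index:
  fixes j :: "'n::finite \<Rightarrow> real^2^'n \<Rightarrow> real^2"
  assumes G: "glide_directions G" and Z: "Z \<in> regular_ambiguity_set \<Omega> G j l" and k: "k \<noteq> l"
  shows "max_glide G j k Z = {the_elem (max_glide G j k Z)}"
proof -
  let ?S = "max_glide G j k Z"
  have fin: "finite ?S" using G by (auto simp: glide_directions_def mem_max_glide intro: finite_subset[of _ G])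
  have Zd: "Z \<in> config_domain \<Omega>" "Z \<in> ambiguity_set \<Omega> G j l" using Z by (auto simp: regular_ambiguity_set_def ambiguity_set_def)
  have "j k Z \<noteq> 0" using Z Zd by (auto simp: regular_ambiguity_set_def E_zero_def)
  obtain g where g: "g \<in> ?S" using max_glide_nonempty[of G j k Z] glide_directions_nonempty[OF G] G
    by (auto simp: glide_directions_def)
  have "card ?S \<le> 2"
  proof (rule unit_vectors_same_inner_card_le_2[OF \<open>j k Z \<noteq> 0\<close> fin, of "j k Z \<bullet> g"])
    fix h assume "h \<in> ?S"
    then show "norm h = 1 \<and> j k Z \<bullet> h = j k Z \<bullet> g"
      using g G by (auto simp: glide_directions_def mem_max_glide intro: antisym)
  qed
  moreover have "card ?S \<noteq> 2" using Z Zd k by (auto simp: regular_ambiguity_set_def E_int_def ambiguity_set_def)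
  moreover have "card ?S \<noteq> 0" using fin g by auto
  ultimately have "card ?S = 1" by linarith
  then show ?thesis by (metis card_1_singletonE the_elem_eq)
qed

section \<open>Crossing a regular ambiguity point\<close>

lemma inclusion_solution_imp_solves_inclusion:
  assumes "inclusion_solution \<Omega> G j I X"
  shows "solves_inclusion (\<lambda>y. convex hull (F_map G j y)) I X"
proof -
  have ac: "absolutely_continuous_on I X" and
    ae: "AE t in lebesgue. t \<in> I \<longrightarrow>
        (\<exists>v \<in> convex hull (F_map G j (X t)). (X has_vector_derivative v) (at t within I))"
    using assms by (auto simp: inclusion_solution_def)
  obtain N where N: "{t \<in> space lebesgue. \<not> (t \<in> I \<longrightarrow>
      (\<exists>v \<in> convex hull (F_map G j (X t)). (X has_vector_derivative v) (at t within I)))} \<subseteq> N"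
    "emeasure lebesgue N = 0" "N \<in> sets lebesgue"
    using ae by (rule AE_E)
  have "negligible N" using null_setsI[OF N(2,3)] negligible_iff_null_sets by blast
  moreover have "\<forall>t\<in>I - N. \<exists>v \<in> convex hull (F_map G j (X t)). (X has_vector_derivative v) (at t within I)"
    using N(1) by auto
  ultimately show ?thesis unfolding solves_inclusion_def using ac by blast
qed

lemma differentiable_imp_GDERIV:
  fixes f :: "'a::euclidean_space \<Rightarrow> real"
  assumes "f differentiable (at x)"
  obtains n where "GDERIV f x :> n"
proof -
  obtain f' where f': "(f has_derivative f') (at x)" using assms by (auto simp: differentiable_def)
  have "f' = (\<lambda>h. h \<bullet> adjoint f' 1)"
    using adjoint_works[OF has_derivative_linear[OF f'], of _ 1] by auto
  then have "GDERIV f x :> adjoint f' 1" using f' unfolding gderiv_def by simp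
  then show ?thesis by (rule that)
qed

lemma norm_vec_le_sum_norm: "norm (x :: 'a::real_normed_vector ^ 'n) \<le> (\<Sum>i\<in>UNIV. norm (x $ i))"
  unfolding norm_vec_def by (rule L2_set_le_sum) simp

lemma lipschitz_on_local_field:
  fixes j :: "'n::finite \<Rightarrow> real^2^'n \<Rightarrow> real^2"
  assumes L: "\<And>k. L-lipschitz_on S (j k)"
    and unit: "\<And>k. k \<noteq> l \<Longrightarrow> norm (the_elem (max_glide G j k Zh)) = 1" "norm g = 1"
  shows "(real CARD('n) * L)-lipschitz_on S (local_field G j l Zh g)"
proof (rule lipschitz_onI)
  define h where "h k = (if k = l then g else the_elem (max_glide G j k Zh))" for k
  have h: "norm (h k) = 1" for k using unit by (simp add: h_def)
  fix x y assume xy: "x \<in> S" "y \<in> S"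
  have comp: "norm ((local_field G j l Zh g x - local_field G j l Zh g y) $ k) \<le> L * dist x y" for k
  proof -
    have "(local_field G j l Zh g x - local_field G j l Zh g y) $ k = ((j k x - j k y) \<bullet> h k) *\<^sub>R h k"
      by (simp add: local_field_def Let_def h_def inner_diff_left scaleR_diff_left)
    also have "norm \<dots> = \<bar>(j k x - j k y) \<bullet> h k\<bar>" using h by simp
    also have "\<dots> \<le> norm (j k x - j k y) * norm (h k)" by (rule Cauchy_Schwarz_ineq2)
    also have "\<dots> \<le> L * dist x y" using lipschitz_onD[OF L xy, of k] h by (simp add: dist_norm)
    finally show ?thesis .
  qed
  have "dist (local_field G j l Zh g x) (local_field G j l Zh g y) 
     \<le> (\<Sum>k\<in>UNIV. norm ((local_field G j l Zh g x - local_field G j l Zh g y) $ k))"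
    unfolding dist_norm by (rule norm_vec_le_sum_norm)
  also have "\<dots> \<le> (\<Sum>k\<in>(UNIV::'n set). L * dist x y)" by (rule sum_mono) (rule comp)
  finally show "dist (local_field G j l Zh g x) (local_field G j l Zh g y) \<le> real CARD('n) * L * dist x y"
    by simp
qed (use lipschitz_on_nonneg[OF L] in simp)

text \<open>
  The dynamical half of the theorem for arbitrary forces of the required regularity: on a small ball the
  sign of \<open>j l y \<bullet> (gp - gm)\<close> decides between the two local fields, which are the data of
  \<open>transversal_crossing\<close>.
\<close>

lemma crossing_of_regular_ambiguity_set:
  fixes j :: "'n::finite \<Rightarrow> real^2^'n \<Rightarrow> real^2" and Z1 :: "real^2^'n"
  assumes G: "glide_directions G"
    and Z1: "Z1 \<in> regular_ambiguity_set \<Omega> G j l" and glide: "max_glide G j l Z1 = {gp, gm}"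
    and r: "r > 0"
    and \<nu>: "unit_normal_from_to (ambiguity_set \<Omega> G j l) (side \<Omega> G j l Z1 r gm) (side \<Omega> G j l Z1 r gp) Z1 \<nu>"
    and \<rho>0: "\<rho>0 > 0" "ball Z1 \<rho>0 \<subseteq> config_domain \<Omega>"
    and Lip: "\<And>k. L-lipschitz_on (ball Z1 \<rho>0) (j k)"
    and diff: "j l differentiable (at Z1)"
    and pos: "local_field G j l Z1 gm Z1 \<bullet> \<nu> > 0" "local_field G j l Z1 gp Z1 \<bullet> \<nu> > 0"
    and Z: "inclusion_solution \<Omega> G j {-T..T} Z" "t1 \<in> {-T<..<T}" "Z t1 = Z1"
  shows "uniqueness_at \<Omega> G j t1 Z1 \<and>
    passes_from_to Z t1 (side \<Omega> G j l Z1 r gm) (side \<Omega> G j l Z1 r gp) {-T..T}"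
proof -
  define \<phi> where "\<phi> y = j l y \<bullet> (gp - gm)" for y
  define fp where "fp = local_field G j l Z1 gp"
  define fm where "fm = local_field G j l Z1 gm"
  have Gfin: "finite G" "G \<noteq> {}" and Gunit: "\<And>g. g \<in> G \<Longrightarrow> norm g = 1"
    using G glide_directions_nonempty[OF G] by (auto simp: glide_directions_def)
  have amb: "Z1 \<in> ambiguity_set \<Omega> G j l" and nsing: "Z1 \<notin> singular_set \<Omega> G j l"
    using Z1 by (auto simp: regular_ambiguity_set_def)
  have ne: "gp \<noteq> gm" using amb glide by (auto simp: ambiguity_set_def)
  have gG: "gp \<in> max_glide G j l Z1" "gm \<in> max_glide G j l Z1" using glide by auto
  then have gG': "gp \<in> G" "gm \<in> G" by (auto simp: mem_max_glide)
  have \<phi>0: "\<phi> Z1 = 0" using gG gG' by (auto simp: mem_max_glide \<phi>_def inner_diff_right intro: antisym)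
  have single: "max_glide G j k Z1 = {the_elem (max_glide G j k Z1)}" if "k \<noteq> l" for k
    by (rule max_glide_singleton_off_index[OF G Z1 that])
  have unit: "norm (the_elem (max_glide G j k Z1)) = 1" if "k \<noteq> l" for k
    using single[OF that] Gunit mem_max_glide by blast
  have cont: "isCont (j k) Z1" for k
    using lipschitz_on_continuous_on[OF Lip[of k]] \<rho>0 by (auto simp: continuous_on_eq_continuous_at)
  have "\<forall>\<^sub>F y in nhds Z1. \<forall>k\<in>UNIV. max_glide G j k y \<subseteq> max_glide G j k Z1"
    by (rule eventually_ball_finite) (auto intro: max_glide_upper_semicontinuous Gfin cont)
  then obtain \<rho>1 where \<rho>1: "\<rho>1 > 0" "\<And>y k. dist y Z1 < \<rho>1 \<Longrightarrow> max_glide G j k y \<subseteq> max_glide G j k Z1"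
    unfolding eventually_nhds_metric by blast
  define \<rho> where "\<rho> = min (min \<rho>0 \<rho>1) r"
  have \<rho>: "\<rho> > 0" "\<rho> \<le> \<rho>0" "\<rho> \<le> \<rho>1" "\<rho> \<le> r" using \<rho>0 \<rho>1 r by (auto simp: \<rho>_def)
  have sub: "ball Z1 \<rho> \<subseteq> ball Z1 \<rho>0" using \<rho> by auto
  have off: "max_glide G j k y = {the_elem (max_glide G j k Z1)}" if "y \<in> ball Z1 \<rho>" "k \<noteq> l" for y k
  proof -
    have "max_glide G j k y \<subseteq> {the_elem (max_glide G j k Z1)}"
      using \<rho>1(2)[of y k] single[OF that(2)] that(1) \<rho> by (simp add: dist_commute)
    then show ?thesis using max_glide_nonempty[OF Gfin, of j k y] by blast
  qed
  have on: "max_glide G j l y = (if \<phi> y > 0 then {gp} else if \<phi> y < 0 then {gm} else {gp, gm})"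
    if "y \<in> ball Z1 \<rho>" for y
  proof -
    have sb: "max_glide G j l y \<subseteq> {gp, gm}"
      using \<rho>1(2)[of y l] glide that(1) \<rho> by (simp add: dist_commute)
    obtain g0 where g0: "g0 \<in> max_glide G j l y" using max_glide_nonempty[OF Gfin] by blast
    have "gp \<in> max_glide G j l y \<longleftrightarrow> \<phi> y \<ge> 0" "gm \<in> max_glide G j l y \<longleftrightarrow> \<phi> y \<le> 0"
    proof -
      have "g0 = gp \<or> g0 = gm" using g0 sb by blast
      then have "\<forall>h\<in>G. j l y \<bullet> h \<le> max (j l y \<bullet> gp) (j l y \<bullet> gm)"
        using g0 unfolding mem_max_glide by fastforce
      then show "gp \<in> max_glide G j l y \<longleftrightarrow> \<phi> y \<ge> 0" "gm \<in> max_glide G j l y \<longleftrightarrow> \<phi> y \<le> 0"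
        using gG' by (auto simp: mem_max_glide \<phi>_def inner_diff_right max_def split: if_splits)
    qed
    then show ?thesis using sb by auto
  qed
  have M: "y \<in> ambiguity_set \<Omega> G j l" if "y \<in> ball Z1 \<rho>" "\<phi> y = 0" for y
    using on[OF that(1)] that ne sub \<rho>0 by (auto simp: ambiguity_set_def)
  have side_p: "y \<in> side \<Omega> G j l Z1 r gp" if "y \<in> ball Z1 \<rho>" "\<phi> y > 0" for y
    using on[OF that(1)] that sub \<rho>0 \<rho> by (auto simp: side_def)
  have side_m: "y \<in> side \<Omega> G j l Z1 r gm" if "y \<in> ball Z1 \<rho>" "\<phi> y < 0" for y
    using on[OF that(1)] that sub \<rho>0 \<rho> by (auto simp: side_def)
  have side_p_pos: "\<phi> y > 0" if "y \<in> side \<Omega> G j l Z1 r gp" for y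
  proof -
    have "max_glide G j l y = {gp}" using that by (simp add: side_def)
    then have "gm \<notin> max_glide G j l y" "gp \<in> max_glide G j l y" using ne by auto
    then have "j l y \<bullet> gm < j l y \<bullet> gp" using gG' unfolding mem_max_glide by force
    then show ?thesis by (simp add: \<phi>_def inner_diff_right)
  qed
  have "\<phi> differentiable (at Z1)" 
    unfolding \<phi>_def[abs_def] by (rule differentiable_inner[OF diff differentiable_const])
  then obtain n where n: "GDERIV \<phi> Z1 :> n" by (rule differentiable_imp_GDERIV)
  have "n \<noteq> 0"
  proof
    assume "n = 0"
    then have "GDERIV (\<lambda>Y. j l Y \<bullet> (gp - gm)) Z1 :> 0" using n by (simp add: \<phi>_def[abs_def])
    moreover have "j l Z1 \<bullet> (gp - gm) = 0" using \<phi>0 by (simp add: \<phi>_def)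
    ultimately have "Z1 \<in> singular_set \<Omega> G j l" unfolding singular_set_def using amb glide ne by blast
    then show False using nsing by simp
  qed
  have cont\<phi>: "continuous_on (ball Z1 \<rho>) \<phi>" unfolding \<phi>_def[abs_def]
    by (intro continuous_intros continuous_on_subset[OF lipschitz_on_continuous_on[OF Lip] sub])
  have \<nu>': "norm \<nu> = 1" "\<And>v. tangent_vector (ambiguity_set \<Omega> G j l) Z1 v \<Longrightarrow> \<nu> \<bullet> v = 0"
    "\<forall>\<^sub>F t in at_right 0. \<phi> (Z1 + t *\<^sub>R \<nu>) > 0"
    using \<nu> side_p_pos unfolding unit_normal_from_to_def by (auto elim: eventually_mono)
  obtain \<alpha> where \<alpha>: "\<alpha> > 0" "n = \<alpha> *\<^sub>R \<nu>"
    using gradient_parallel_to_level_set_normal[OF \<rho>(1) cont\<phi> \<phi>0 n \<open>n \<noteq> 0\<close> M \<nu>'(2) \<nu>'(1,3)] by blast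
  have posn: "fp Z1 \<bullet> n > 0" "fm Z1 \<bullet> n > 0" using pos \<alpha> by (simp_all add: fp_def fm_def)
  have Lf: "(real CARD('n) * L)-lipschitz_on (ball Z1 \<rho>) fp" "(real CARD('n) * L)-lipschitz_on (ball Z1 \<rho>) fm"
    unfolding fp_def fm_def using Gunit gG' unit
    by (auto intro!: lipschitz_on_local_field lipschitz_on_subset[OF Lip sub])
  have F: "V \<in> {fm y, fp y} \<and> (\<phi> y > 0 \<longrightarrow> V = fp y) \<and> (\<phi> y < 0 \<longrightarrow> V = fm y)"
    if y: "y \<in> ball Z1 \<rho>" and V: "V \<in> F_map G j y" for y V
  proof -
    obtain g where g: "g \<in> max_glide G j l y" "V $ l = (j l y \<bullet> g) *\<^sub>R g"
      using V unfolding F_map_def F_comp_def by blast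
    have "V $ k = local_field G j l Z1 g y $ k" for k
    proof (cases "k = l")
      case True
      then show ?thesis using g by (simp add: local_field_def Let_def)
    next
      case False
      have "V $ k \<in> F_comp G j k y" using V by (simp add: F_map_def)
      then show ?thesis using False by (simp add: F_comp_def off[OF y False] local_field_def Let_def)
    qed
    then have "V = local_field G j l Z1 g y" by (simp add: vec_eq_iff)
    then show ?thesis using on[OF y] g(1) by (auto simp: fp_def fm_def split: if_splits)
  qed
  let ?\<Phi> = "\<lambda>y. convex hull (F_map G j y)"
  have hull: "?\<Phi> y \<subseteq> closed_segment (fm y) (fp y)" if "y \<in> ball Z1 \<rho>" for y
    unfolding segment_convex_hull by (rule hull_mono) (use F[OF that] in blast)
  have hull_p: "?\<Phi> y \<subseteq> {fp y}" if "y \<in> ball Z1 \<rho>" "\<phi> y > 0" for y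
    by (rule hull_minimal) (use F[OF that(1)] that(2) in auto)
  have hull_m: "?\<Phi> y \<subseteq> {fm y}" if "y \<in> ball Z1 \<rho>" "\<phi> y < 0" for y
    by (rule hull_minimal) (use F[OF that(1)] that(2) in auto)
  obtain h where h: "h > 0" and
    fwd: "\<And>I X t1 t. \<lbrakk>solves_through ?\<Phi> Z1 t1 I X; t \<in> I; t1 < t; t \<le> t1 + h\<rbrakk>
       \<Longrightarrow> X t \<in> ball Z1 \<rho> \<and> \<phi> (X t) > 0" and
    bwd: "\<And>I X t1 t. \<lbrakk>solves_through ?\<Phi> Z1 t1 I X; t \<in> I; t < t1; t1 - h \<le> t\<rbrakk>
       \<Longrightarrow> X t \<in> ball Z1 \<rho> \<and> \<phi> (X t) < 0" and
    unq: "\<And>I X I' X' t1 t. \<lbrakk>solves_through ?\<Phi> Z1 t1 I X; solves_through ?\<Phi> Z1 t1 I' X';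
        t \<in> I; t \<in> I'; t1 - h \<le> t; t \<le> t1 + h\<rbrakk> \<Longrightarrow> X t = X' t"
    by (rule transversal_crossing[OF \<rho>(1) hull hull_p hull_m Lf \<phi>0 n posn]) blast+
  have "uniqueness_at \<Omega> G j t1 Z1"
    unfolding uniqueness_at_def
  proof (rule exI[of _ "t1 - h"], rule exI[of _ "t1 + h"], intro conjI allI impI ballI)
    fix I X I' X' t
    assume A: "is_interval I \<and> t1 \<in> I \<and> inclusion_solution \<Omega> G j I X \<and> X t1 = Z1 \<and>
           is_interval I' \<and> t1 \<in> I' \<and> inclusion_solution \<Omega> G j I' X' \<and> X' t1 = Z1"
      and t: "t \<in> {t1 - h..t1 + h} \<inter> I \<inter> I'"
    show "X t = X' t"
      by (rule unq[of t1 I X I' X'])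
        (use A t in \<open>auto simp: solves_through_def intro: inclusion_solution_imp_solves_inclusion\<close>)
  qed (use h in auto)
  moreover have "passes_from_to Z t1 (side \<Omega> G j l Z1 r gm) (side \<Omega> G j l Z1 r gp) {-T..T}"
    unfolding passes_from_to_def
  proof (rule exI[of _ "max (t1 - h) (-T)"], rule exI[of _ "min (t1 + h) T"], intro conjI ballI)
    have sol: "solves_through ?\<Phi> Z1 t1 {-T..T} Z"
      using inclusion_solution_imp_solves_inclusion[OF Z(1)] Z is_interval_cc[of "-T" T]
      by (simp add: solves_through_def)
    show "Z t \<in> side \<Omega> G j l Z1 r gm" if t: "t \<in> {max (t1 - h) (- T)..<t1}" for t
      using bwd[OF sol, of t] t Z(2) by (intro side_m) auto
    show "Z t \<in> side \<Omega> G j l Z1 r gp" if t: "t \<in> {t1<..min (t1 + h) T}" for t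
      using fwd[OF sol, of t] t Z(2) by (intro side_p) auto
  qed (use h Z in auto)
  ultimately show ?thesis by blast
qed

lemma unit_normal_from_to_uminus:
  assumes "unit_normal_from_to M Vm Vp p \<nu>"
  shows "unit_normal_from_to M Vp Vm p (- \<nu>)"
  using assms unfolding unit_normal_from_to_def by (auto elim: eventually_mono)

section \<open>Potentials with logarithmic poles in simply connected domains\<close>

lemma exp_constant_imp_deriv_0:
  assumes D: "open D" and W: "W holomorphic_on D" and k: "k \<noteq> 0"
    and const: "(\<lambda>z. exp (k * W z)) constant_on D" and z: "z \<in> D"
  shows "deriv W z = 0"
proof -
  obtain c where c: "\<And>w. w \<in> D \<Longrightarrow> exp (k * W w) = c" using const by (auto simp: constant_on_def)
  have W': "(W has_field_derivative deriv W z) (at z)" using holomorphic_derivI[OF W D z] .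
  have "((\<lambda>w. exp (k * W w)) has_field_derivative exp (k * W z) * (k * deriv W z)) (at z)"
    by (auto intro!: derivative_eq_intros W')
  moreover have "((\<lambda>w. exp (k * W w)) has_field_derivative 0) (at z)"
    by (rule has_field_derivative_transform_within_open[OF _ D z, of "\<lambda>_. c"]) (auto simp: c)
  ultimately have "exp (k * W z) * (k * deriv W z) = 0" by (rule DERIV_unique)
  then show ?thesis using k by simp
qed

text \<open>
  Uniqueness for the Dirichlet problem. The extension of \<open>Im W\<close> by \<^term>\<open>c\<close> attains its extrema
  on the compact closure; unless it is constant, one of them is attained in \<^term>\<open>D\<close>. Since
  \<open>|exp (- \<i> W)| = exp (Im W)\<close>, the maximum modulus principle makes \<open>exp (\<plusminus> \<i> W)\<close> constant.
\<close>

lemma constant_boundary_Im_imp_deriv_0: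
  assumes D: "open D" "connected D" "bounded D" and W: "W holomorphic_on D"
    and lim: "\<And>q. q \<in> frontier D \<Longrightarrow> ((\<lambda>z. Im (W z)) \<longlongrightarrow> c) (at q within D)"
    and z: "z \<in> D"
  shows "deriv W z = 0"
proof -
  define g where "g w = (if w \<in> D then Im (W w) else c)" for w
  have cont: "continuous_on (closure D) g"
    unfolding continuous_on_def
  proof
    fix x assume x: "x \<in> closure D"
    have cl: "closure D = D \<union> frontier D" by (simp add: closure_Un_frontier)
    show "(g \<longlongrightarrow> g x) (at x within closure D)"
    proof (cases "x \<in> D")
      case True
      have "isCont (\<lambda>w. Im (W w)) x"
        using holomorphic_on_imp_continuous_on[OF W] True D(1)
        by (auto simp: continuous_on_eq_continuous_at intro!: continuous_intros)
      then have "((\<lambda>w. Im (W w)) \<longlongrightarrow> g x) (at x)" using True by (simp add: g_def continuous_at)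
      then have "(g \<longlongrightarrow> g x) (at x)"
        by (rule Lim_transform_within_open[OF _ D(1) True]) (simp add: g_def)
      then show ?thesis by (rule tendsto_within_subset) simp
    next
      case False
      then have xf: "x \<in> frontier D" using x cl by blast
      have "(g \<longlongrightarrow> c) (at x within D)"
        by (rule Lim_transform_eventually[OF lim[OF xf]]) (simp add: g_def eventually_at_filter)
      moreover have "(g \<longlongrightarrow> c) (at x within frontier D)"
        by (rule tendsto_eventually) (use D(1) frontier_disjoint_eq[of D] in \<open>auto simp: g_def eventually_at_filter intro!: always_eventually\<close>)
      ultimately show ?thesis using False unfolding cl by (simp add: g_def Lim_within_Un)
    qed
  qed
  have cpt: "compact (closure D)" "closure D \<noteq> {}" using D z closure_subset by auto
  obtain x where x: "x \<in> closure D" "\<And>w. w \<in> closure D \<Longrightarrow> g w \<le> g x"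
    using continuous_attains_sup[OF cpt cont] by blast
  obtain y where y: "y \<in> closure D" "\<And>w. w \<in> closure D \<Longrightarrow> g y \<le> g w"
    using continuous_attains_inf[OF cpt cont] by blast
  have gD: "g w = Im (W w)" "w \<in> closure D" if "w \<in> D" for w using that closure_subset by (auto simp: g_def)
  have "\<exists>x\<in>D. (\<forall>w\<in>D. Im (W w) \<le> Im (W x)) \<or> (\<forall>w\<in>D. Im (W x) \<le> Im (W w))"
  proof (cases "x \<in> D \<or> y \<in> D")
    case True
    then show ?thesis using x y gD by metis
  next
    case False
    then have "g x = c" "g y = c" by (auto simp: g_def)
    then have "Im (W w) = c" if "w \<in> D" for w using x(2) y(2) gD[OF that] by (metis antisym)
    then show ?thesis using z by auto
  qed
  then obtain \<xi> where \<xi>: "\<xi> \<in> D" "(\<forall>w\<in>D. Im (W w) \<le> Im (W \<xi>)) \<or> (\<forall>w\<in>D. Im (W \<xi>) \<le> Im (W w))"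
    by blast
  have "\<exists>k. k \<noteq> 0 \<and> (\<lambda>z. exp (k * W z)) constant_on D"
  proof -
    have hol: "(\<lambda>z. exp (k * W z)) holomorphic_on D" for k by (intro holomorphic_intros W)
    consider "\<forall>w\<in>D. Im (W w) \<le> Im (W \<xi>)" | "\<forall>w\<in>D. Im (W \<xi>) \<le> Im (W w)" using \<xi>(2) by blast
    then show ?thesis
    proof cases
      case 1
      then have "(\<lambda>z. exp (- \<i> * W z)) constant_on D"
        by (intro maximum_modulus_principle[OF hol D(1,2,1) order_refl \<xi>(1)]) (simp add: norm_exp_eq_Re)
      then show ?thesis by (intro exI[of _ "- \<i>"]) simp
    next
      case 2
      then have "(\<lambda>z. exp (\<i> * W z)) constant_on D"
        by (intro maximum_modulus_principle[OF hol D(1,2,1) order_refl \<xi>(1)]) (simp add: norm_exp_eq_Re)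
      then show ?thesis by (intro exI[of _ "\<i>"]) simp
    qed
  qed
  then show ?thesis using exp_constant_imp_deriv_0[OF D(1) W _ _ z] by blast
qed

lemma blaschke_identity:
  "(cmod (1 - cnj \<alpha> * w))\<^sup>2 - (cmod (w - \<alpha>))\<^sup>2 = (1 - (cmod \<alpha>)\<^sup>2) * (1 - (cmod w)\<^sup>2)"
  unfolding cmod_power2 by (simp add: algebra_simps power2_eq_square)

lemma blaschke_denominator_nonzero:
  assumes "cmod \<alpha> < 1" "cmod w < 1"
  shows "1 - cnj \<alpha> * w \<noteq> 0"
proof -
  have "cmod (cnj \<alpha> * w) \<le> cmod \<alpha>" using assms by (simp add: norm_mult mult_left_le)
  then have "cmod (cnj \<alpha> * w) < 1" using assms by linarith
  then show ?thesis by auto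
qed

abbreviation log_potential :: "('n::finite \<Rightarrow> real) \<Rightarrow> ('n \<Rightarrow> complex) \<Rightarrow> complex \<Rightarrow> real" where
  "log_potential b a z \<equiv> \<Sum>i\<in>UNIV. b i / (2 * pi) * ln (cmod (z - a i))"

locale riemann_map =
  fixes D :: "complex set" and \<psi> \<psi>inv :: "complex \<Rightarrow> complex"
  assumes openD: "open D" and boundedD: "bounded D" and scD: "simply_connected D"
    and hol: "\<psi> holomorphic_on D" and hol_inv: "\<psi>inv holomorphic_on ball 0 1"
    and to_disc: "\<And>z. z \<in> D \<Longrightarrow> cmod (\<psi> z) < 1" and left_inv: "\<And>z. z \<in> D \<Longrightarrow> \<psi>inv (\<psi> z) = z"
    and inv_in: "\<And>w. cmod w < 1 \<Longrightarrow> \<psi>inv w \<in> D"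
begin

lemma connectedD: "connected D" using scD simply_connected_imp_connected by blast

lemma inj: "inj_on \<psi> D" using left_inv by (rule inj_on_inverseI)

lemma deriv_nonzero: "z \<in> D \<Longrightarrow> deriv \<psi> z \<noteq> 0"
  by (rule holomorphic_injective_imp_regular[OF hol openD inj])

text \<open>
  Riemann maps are proper: the preimage of a closed disc of radius less than \<open>1\<close> is
  compact in \<^term>\<open>D\<close> and therefore stays away from the frontier.
\<close>

lemma norm_tendsto_1:
  assumes q: "q \<in> frontier D"
  shows "((\<lambda>z. cmod (\<psi> z)) \<longlongrightarrow> 1) (at q within D)"
proof (rule tendstoI)
  fix e :: real assume e: "e > 0"
  define K where "K = \<psi>inv ` cball 0 (1 - e)"
  have "compact K" unfolding K_def
    by (rule compact_continuous_image[OF continuous_on_subset[OF holomorphic_on_imp_continuous_on[OF hol_inv]]]) (use e in auto)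
  moreover have "K \<subseteq> D" unfolding K_def using inv_in e by auto
  moreover have "q \<notin> D" using q openD frontier_disjoint_eq by blast
  ultimately have "open (- K)" "q \<in> - K" by (auto intro: compact_imp_closed)
  then have "\<forall>\<^sub>F z in at q within D. z \<in> - K"
    using eventually_at_topological by blast
  moreover have "\<forall>\<^sub>F z in at q within D. z \<in> D" by (simp add: eventually_at_filter)
  ultimately show "\<forall>\<^sub>F z in at q within D. dist (cmod (\<psi> z)) 1 < e"
  proof eventually_elim
    case (elim z)
    have "\<not> cmod (\<psi> z) \<le> 1 - e"
    proof
      assume "cmod (\<psi> z) \<le> 1 - e"
      then have "\<psi>inv (\<psi> z) \<in> K" by (auto simp: K_def)
      then show False using elim left_inv by simp
    qed
    then show ?case using to_disc[OF elim(2)] e by (simp add: dist_real_def)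
  qed
qed

text \<open>
  The difference quotient of \<^term>\<open>\<psi>\<close> with its removable singularity filled in, so that
  \<open>\<psi> - \<psi> a\<close> is \<open>z - a\<close> times a zero-free holomorphic function.
\<close>

definition dquot :: "complex \<Rightarrow> complex \<Rightarrow> complex" where
  "dquot a z = (if z = a then deriv \<psi> a else (\<psi> z - \<psi> a) / (z - a))"

text \<open>
  \<open>ln |image_factor a|\<close> is the regular part of the Green function of \<^term>\<open>D\<close> with pole \<open>a\<close>: adding
  \<open>ln |z - a|\<close> gives \<open>ln |(\<psi> - \<psi> a) / (1 - cnj (\<psi> a) \<psi>)|\<close>, which vanishes on the
  frontier.
\<close>

definition image_factor :: "complex \<Rightarrow> complex \<Rightarrow> complex" where
  "image_factor a z = dquot a z / (1 - cnj (\<psi> a) * \<psi> z)"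

lemma dquot_holomorphic: "dquot a holomorphic_on D"
  unfolding dquot_def[abs_def]
  by (rule pole_lemma_open[OF hol openD])

lemma dquot_nonzero:
  assumes "a \<in> D" "z \<in> D"
  shows "dquot a z \<noteq> 0"
  using assms deriv_nonzero inj by (auto simp: dquot_def inj_on_def)

lemma dquot_mult: "(z - a) * dquot a z = \<psi> z - \<psi> a"
  by (simp add: dquot_def)

lemma denom_nonzero: "a \<in> D \<Longrightarrow> z \<in> D \<Longrightarrow> 1 - cnj (\<psi> a) * \<psi> z \<noteq> 0"
  by (rule blaschke_denominator_nonzero) (auto intro: to_disc)

lemma image_factor_holomorphic: "a \<in> D \<Longrightarrow> image_factor a holomorphic_on D"
  unfolding image_factor_def[abs_def]
  by (intro holomorphic_intros dquot_holomorphic hol denom_nonzero)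

lemma image_factor_nonzero: "a \<in> D \<Longrightarrow> z \<in> D \<Longrightarrow> image_factor a z \<noteq> 0"
  unfolding image_factor_def using denom_nonzero dquot_nonzero by (simp only: divide_eq_0_iff) blast

text \<open>
  With \<open>\<alpha> = \<psi> a\<close> and \<open>w = \<psi> z\<close>, the squared modulus \<open>B\<close> of the Blaschke factor satisfies
  \<open>1 - B = (1 - |\<alpha>|\<^sup>2) (1 - |w|\<^sup>2) / |1 - cnj \<alpha> w|\<^sup>2\<close>, and \<open>|w|\<close> tends to \<open>1\<close> at the frontier.
\<close>

lemma ln_image_factor_tendsto:
  assumes a: "a \<in> D" and q: "q \<in> frontier D"
  shows "((\<lambda>z. ln (cmod (image_factor a z)) + ln (cmod (z - a))) \<longlongrightarrow> 0) (at q within D)"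
proof -
  let ?\<alpha> = "\<psi> a"
  define B where "B z = (cmod (\<psi> z - ?\<alpha>))\<^sup>2 / (cmod (1 - cnj ?\<alpha> * \<psi> z))\<^sup>2" for z
  have \<alpha>: "cmod ?\<alpha> < 1" using to_disc a by blast
  have evD: "\<forall>\<^sub>F z in at q within D. z \<in> D" by (simp add: eventually_at_filter)
  have qD: "q \<notin> D" using q openD frontier_disjoint_eq by blast
  have "q \<noteq> a" using qD a by blast
  have eq: "1 - B z = (1 - (cmod ?\<alpha>)\<^sup>2) * (1 - (cmod (\<psi> z))\<^sup>2) / (cmod (1 - cnj ?\<alpha> * \<psi> z))\<^sup>2" if "z \<in> D" for z
  proof -
    have "(cmod (1 - cnj ?\<alpha> * \<psi> z))\<^sup>2 \<noteq> 0" using denom_nonzero[OF a that] by simp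
    then show ?thesis unfolding B_def blaschke_identity[symmetric] by (simp add: diff_divide_distrib)
  qed
  have bound: "norm (1 - B z) \<le> (1 - (cmod (\<psi> z))\<^sup>2) / (1 - cmod ?\<alpha>)\<^sup>2" if "z \<in> D" for z
  proof -
    have w: "cmod (\<psi> z) < 1" using to_disc that .
    have "1 - cmod ?\<alpha> \<le> 1 - cmod (cnj ?\<alpha> * \<psi> z)" using w \<alpha> by (simp add: norm_mult mult_left_le)
    also have "\<dots> \<le> cmod (1 - cnj ?\<alpha> * \<psi> z)" by (metis norm_one norm_triangle_ineq2)
    finally have d: "(1 - cmod ?\<alpha>)\<^sup>2 \<le> (cmod (1 - cnj ?\<alpha> * \<psi> z))\<^sup>2" using \<alpha> by (intro power_mono) auto
    have p: "0 \<le> 1 - (cmod (\<psi> z))\<^sup>2" "0 \<le> 1 - (cmod ?\<alpha>)\<^sup>2" "1 - (cmod ?\<alpha>)\<^sup>2 \<le> 1"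
      using w \<alpha> by (simp_all add: power_le_one)
    have "norm (1 - B z) = (1 - (cmod ?\<alpha>)\<^sup>2) * (1 - (cmod (\<psi> z))\<^sup>2) / (cmod (1 - cnj ?\<alpha> * \<psi> z))\<^sup>2"
      unfolding eq[OF that] using p by simp
    also have "\<dots> \<le> 1 * (1 - (cmod (\<psi> z))\<^sup>2) / (1 - cmod ?\<alpha>)\<^sup>2"
      using p d \<alpha> by (intro frac_le mult_right_mono) auto
    finally show ?thesis by simp
  qed
  have "((\<lambda>z. (1 - (cmod (\<psi> z))\<^sup>2) / (1 - cmod ?\<alpha>)\<^sup>2) \<longlongrightarrow> (1 - 1\<^sup>2) / (1 - cmod ?\<alpha>)\<^sup>2) (at q within D)"
    using \<alpha> by (intro tendsto_intros norm_tendsto_1[OF q]) auto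
  then have lim: "((\<lambda>z. (1 - (cmod (\<psi> z))\<^sup>2) / (1 - cmod ?\<alpha>)\<^sup>2) \<longlongrightarrow> 0) (at q within D)" by simp
  have "((\<lambda>z. 1 - B z) \<longlongrightarrow> 0) (at q within D)"
    by (rule Lim_null_comparison[OF eventually_mono[OF evD bound] lim])
  then have "((\<lambda>z. 1 - (1 - B z)) \<longlongrightarrow> 1 - 0) (at q within D)" by (intro tendsto_intros)
  then have B1: "(B \<longlongrightarrow> 1) (at q within D)" by simp
  have "((\<lambda>z. ln (B z) / 2) \<longlongrightarrow> ln 1 / 2) (at q within D)" by (intro tendsto_intros B1) auto
  then have "((\<lambda>z. ln (B z) / 2) \<longlongrightarrow> 0) (at q within D)" by simp
  moreover have "\<forall>\<^sub>F z in at q within D. z \<noteq> a"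
    using t1_space_nhds[OF \<open>q \<noteq> a\<close>] by (simp add: eventually_at_filter eventually_mono)
  then have "\<forall>\<^sub>F z in at q within D. ln (B z) / 2 = ln (cmod (image_factor a z)) + ln (cmod (z - a))"
    using evD
  proof eventually_elim
    case (elim z)
    have n: "cmod (image_factor a z) > 0" "cmod (z - a) > 0" using image_factor_nonzero[OF a] elim by auto
    have "image_factor a z * (z - a) = (\<psi> z - ?\<alpha>) / (1 - cnj ?\<alpha> * \<psi> z)"
      using dquot_mult[of z a] by (simp add: image_factor_def mult.commute)
    then have "B z = (cmod (image_factor a z) * cmod (z - a))\<^sup>2"
      by (simp add: B_def norm_divide power_divide flip: norm_mult)
    then have "ln (B z) = 2 * ln (cmod (image_factor a z) * cmod (z - a))"
      using n by (simp add: ln_realpow)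
    then show ?case using n by (simp add: ln_mult)
  qed
  ultimately show ?thesis by (rule Lim_transform_eventually)
qed

text \<open>
  The imaginary part of \<open>W = H - \<Sum>\<^sub>i b\<^sub>i / (2 \<pi> \<i>) ln (image_factor a\<^sub>i)\<close> is constant on the
  frontier, because there \<open>ln |image_factor a\<^sub>i|\<close> cancels \<open>ln |z - a\<^sub>i|\<close>; so \<open>W' = 0\<close>.
  Holomorphic logarithms exist since the image factors have no zeros and \<^term>\<open>D\<close> is simply connected.
\<close>

lemma field_eq_image_field:
  fixes H :: "complex \<Rightarrow> complex" and b :: "'n::finite \<Rightarrow> real" and a :: "'n \<Rightarrow> complex"
  assumes H: "\<And>z. z \<in> D \<Longrightarrow> (H has_field_derivative f z) (at z)"
    and a: "\<And>i. a i \<in> D"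
    and lim: "\<And>q. q \<in> frontier D \<Longrightarrow>
       ((\<lambda>z. Im (H z) - log_potential b a z) \<longlongrightarrow> c) (at q within D)"
    and z: "z \<in> D"
  shows "f z = (\<Sum>i\<in>UNIV. b i / (2 * pi * \<i>) * (deriv (image_factor (a i)) z / image_factor (a i) z))"
proof -
  have "\<exists>r. r holomorphic_on D \<and> (\<forall>z \<in> D. image_factor (a i) z = exp (r z))" for i
    using simply_connected_eq_holomorphic_log[OF openD] scD image_factor_holomorphic[OF a] image_factor_nonzero[OF a]
    by blast
  then obtain r where r: "\<And>i. r i holomorphic_on D" "\<And>i z. z \<in> D \<Longrightarrow> image_factor (a i) z = exp (r i z)"
    by metis
  have Hhol: "H holomorphic_on D"
    using H openD by (auto simp: holomorphic_on_open)
  \<comment> \<open>\<open>Re (r i)\<close> is \<open>ln |image_factor|\<close>, and division by \<open>\<i>\<close> moves it to the imaginary part\<close>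
  define W where "W z = H z - (\<Sum>i\<in>UNIV. b i / (2 * pi * \<i>) * r i z)" for z
  have Whol: "W holomorphic_on D" unfolding W_def by (intro holomorphic_intros Hhol r)
  have ImW: "Im (W z) = Im (H z) + (\<Sum>i\<in>UNIV. b i / (2 * pi) * ln (cmod (image_factor (a i) z)))" if "z \<in> D" for z
  proof -
    have "Im (complex_of_real (b i) / (2 * pi * \<i>) * r i z) = - (b i / (2 * pi) * ln (cmod (image_factor (a i) z)))" for i
      using r(2)[OF that, of i] by (simp add: Im_divide power2_eq_square) 
    then show ?thesis by (simp add: W_def sum_negf)
  qed
  have "((\<lambda>z. Im (W z)) \<longlongrightarrow> c) (at q within D)" if q: "q \<in> frontier D" for q
  proof -
    have "((\<lambda>z. (Im (H z) - log_potential b a z) +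
       (\<Sum>i\<in>UNIV. b i / (2 * pi) * (ln (cmod (image_factor (a i) z)) + ln (cmod (z - a i))))) 
        \<longlongrightarrow> c + (\<Sum>i\<in>(UNIV::'n set). b i / (2 * pi) * 0)) (at q within D)"
      by (intro tendsto_intros lim[OF q] ln_image_factor_tendsto[OF a q])
    then have L: "((\<lambda>z. (Im (H z) - log_potential b a z) +
       (\<Sum>i\<in>UNIV. b i / (2 * pi) * (ln (cmod (image_factor (a i) z)) + ln (cmod (z - a i))))) 
        \<longlongrightarrow> c) (at q within D)" by simp
    show ?thesis
    proof (rule Lim_transform_eventually[OF L])
      show "\<forall>\<^sub>F z in at q within D. (Im (H z) - log_potential b a z) +
       (\<Sum>i\<in>UNIV. b i / (2 * pi) * (ln (cmod (image_factor (a i) z)) + ln (cmod (z - a i)))) = Im (W z)"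
        unfolding eventually_at_filter
        by (rule always_eventually) (simp add: ImW distrib_left sum.distrib)
    qed
  qed
  then have W0: "deriv W z = 0"
    using constant_boundary_Im_imp_deriv_0[OF openD connectedD boundedD Whol _ z] by blast
  have r': "(r i has_field_derivative deriv (image_factor (a i)) z / image_factor (a i) z) (at z)" for i
  proof -
    have rd: "(r i has_field_derivative deriv (r i) z) (at z)" using holomorphic_derivI[OF r(1) openD z] .
    have "((\<lambda>z. exp (r i z)) has_field_derivative exp (r i z) * deriv (r i) z) (at z)"
      by (auto intro!: derivative_eq_intros rd)
    then have "(image_factor (a i) has_field_derivative exp (r i z) * deriv (r i) z) (at z)"
      by (rule has_field_derivative_transform_within_open[OF _ openD z]) (simp add: r(2))
    then have "deriv (image_factor (a i)) z = exp (r i z) * deriv (r i) z" by (rule DERIV_imp_deriv)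
    then show ?thesis using rd r(2)[OF z, of i] by simp
  qed
  have "(W has_field_derivative f z - (\<Sum>i\<in>UNIV. b i / (2 * pi * \<i>) * (deriv (image_factor (a i)) z / image_factor (a i) z))) (at z)"
    unfolding W_def[abs_def] by (intro derivative_intros H[OF z] DERIV_cmult r')
  then show ?thesis using W0 by (simp add: DERIV_imp_deriv)
qed

lemma deriv_image_factor_quotient:
  assumes a: "a \<in> D" and z: "z \<in> D"
  shows "deriv (image_factor a) z / image_factor a z =
     deriv (dquot a) z / dquot a z + cnj (\<psi> a) * deriv \<psi> z / (1 - cnj (\<psi> a) * \<psi> z)"
proof -
  note nz = denom_nonzero[OF a z] dquot_nonzero[OF a z]
  have 1: "(dquot a has_field_derivative deriv (dquot a) z) (at z)"
    using holomorphic_derivI[OF dquot_holomorphic[of a] openD z] .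
  have 2: "(\<psi> has_field_derivative deriv \<psi> z) (at z)" using holomorphic_derivI[OF hol openD z] .
  have "(image_factor a has_field_derivative
      (deriv (dquot a) z * (1 - cnj (\<psi> a) * \<psi> z) - dquot a z * (0 - cnj (\<psi> a) * deriv \<psi> z)) /
      ((1 - cnj (\<psi> a) * \<psi> z) * (1 - cnj (\<psi> a) * \<psi> z))) (at z)"
    unfolding image_factor_def[abs_def]
    by (intro DERIV_divide 1 DERIV_diff DERIV_const DERIV_cmult 2 nz)
  then have "deriv (image_factor a) z = (deriv (dquot a) z * (1 - cnj (\<psi> a) * \<psi> z) - dquot a z * (0 - cnj (\<psi> a) * deriv \<psi> z)) /
      ((1 - cnj (\<psi> a) * \<psi> z) * (1 - cnj (\<psi> a) * \<psi> z))" by (rule DERIV_imp_deriv)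
  then show ?thesis using nz unfolding image_factor_def by (simp add: divide_simps)
qed

lemma deriv_dquot:
  assumes a: "a \<in> D" and z: "z \<in> D" "z \<noteq> a"
  shows "deriv (dquot a) z / dquot a z = deriv \<psi> z / (\<psi> z - \<psi> a) - 1 / (z - a)"
proof -
  have 2: "(\<psi> has_field_derivative deriv \<psi> z) (at z)" using holomorphic_derivI[OF hol openD z(1)] .
  have "((\<lambda>z. (\<psi> z - \<psi> a) / (z - a)) has_field_derivative
      ((deriv \<psi> z - 0) * (z - a) - (\<psi> z - \<psi> a) * (1 - 0)) / ((z - a) * (z - a))) (at z)"
    using z by (intro DERIV_divide DERIV_diff 2 DERIV_const DERIV_ident) auto
  then have "(dquot a has_field_derivative
      ((deriv \<psi> z - 0) * (z - a) - (\<psi> z - \<psi> a) * (1 - 0)) / ((z - a) * (z - a))) (at z)"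
    by (rule has_field_derivative_transform_within_open[of _ _ _ "- {a}"]) (use z in \<open>auto simp: dquot_def\<close>)
  then have "deriv (dquot a) z = (deriv \<psi> z * (z - a) - (\<psi> z - \<psi> a)) / ((z - a) * (z - a))"
    by (simp add: DERIV_imp_deriv)
  moreover have "\<psi> z - \<psi> a \<noteq> 0" using inj a z by (auto simp: inj_on_def)
  ultimately show ?thesis using z by (simp add: dquot_def divide_simps)
qed

text \<open>
  Differentiate \<open>(z - a) dquot a z = \<psi> z - \<psi> a\<close> twice and put \<open>z = a\<close>.
\<close>

lemma deriv_dquot_diagonal:
  assumes a: "a \<in> D"
  shows "deriv (dquot a) a / dquot a a = deriv (deriv \<psi>) a / (2 * deriv \<psi> a)"
proof -
  note q = dquot_holomorphic[of a]
  note q' = holomorphic_deriv[OF q openD]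
  have 1: "deriv \<psi> z = (z - a) * deriv (dquot a) z + dquot a z" if z: "z \<in> D" for z
  proof -
    have "((\<lambda>z. (z - a) * dquot a z) has_field_derivative (z - a) * deriv (dquot a) z + (1 - 0) * dquot a z) (at z)"
      by (intro DERIV_mult' DERIV_diff DERIV_ident DERIV_const holomorphic_derivI[OF q openD z])
    then have "((\<lambda>z. \<psi> z - \<psi> a) has_field_derivative (z - a) * deriv (dquot a) z + dquot a z) (at z)"
      by (simp add: dquot_mult)
    moreover have "((\<lambda>z. \<psi> z - \<psi> a) has_field_derivative deriv \<psi> z - 0) (at z)"
      by (intro DERIV_diff DERIV_const holomorphic_derivI[OF hol openD z])
    ultimately show ?thesis using DERIV_unique by fastforce
  qed
  have "((\<lambda>z. (z - a) * deriv (dquot a) z + dquot a z) has_field_derivative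
     ((a - a) * deriv (deriv (dquot a)) a + (1 - 0) * deriv (dquot a) a) + deriv (dquot a) a) (at a)"
    by (intro DERIV_add DERIV_mult' DERIV_diff DERIV_ident DERIV_const holomorphic_derivI[OF q openD a]
        holomorphic_derivI[OF q' openD a])
  then have "(deriv \<psi> has_field_derivative
     ((a - a) * deriv (deriv (dquot a)) a + (1 - 0) * deriv (dquot a) a) + deriv (dquot a) a) (at a)"
    by (rule has_field_derivative_transform_within_open[OF _ openD a]) (simp add: 1)
  then have "deriv (deriv \<psi>) a = 2 * deriv (dquot a) a" by (simp add: DERIV_imp_deriv)
  then show ?thesis by (simp add: dquot_def)
qed

text \<open>
  The field that acts on the \<open>l\<close>-th of the point vortices \<open>a i\<close> of circulation \<open>b i\<close> in \<^term>\<open>D\<close>,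
  its own singular part being removed: each other vortex contributes its field together with that of
  its mirror image, and the vortex itself contributes the Kirchhoff-Routh self-interaction.
\<close>

definition vortex_field :: "('n::finite \<Rightarrow> real) \<Rightarrow> 'n \<Rightarrow> ('n \<Rightarrow> complex) \<Rightarrow> complex" where
  "vortex_field b l a =
     (\<Sum>i\<in>UNIV - {l}. b i / (2 * pi * \<i>) *
         (deriv \<psi> (a l) / (\<psi> (a l) - \<psi> (a i)) + cnj (\<psi> (a i)) * deriv \<psi> (a l) / (1 - cnj (\<psi> (a i)) * \<psi> (a l))))
     + b l / (2 * pi * \<i>) *
         (deriv (deriv \<psi>) (a l) / (2 * deriv \<psi> (a l)) + cnj (\<psi> (a l)) * deriv \<psi> (a l) / (1 - cnj (\<psi> (a l)) * \<psi> (a l)))"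

lemma field_at_vortex:
  fixes H :: "complex \<Rightarrow> complex" and b :: "'n::finite \<Rightarrow> real" and a :: "'n \<Rightarrow> complex"
  assumes H: "\<And>z. z \<in> D \<Longrightarrow> (H has_field_derivative f z) (at z)"
    and a: "\<And>i. a i \<in> D" and ne: "\<And>i. i \<noteq> l \<Longrightarrow> a i \<noteq> a l"
    and lim: "\<And>q. q \<in> frontier D \<Longrightarrow>
       ((\<lambda>z. Im (H z) - log_potential b a z) \<longlongrightarrow> c) (at q within D)"
  shows "f (a l) + (\<Sum>i\<in>UNIV - {l}. b i / (2 * pi * \<i>) * (1 / (a l - a i))) = vortex_field b l a"
proof -
  have "f (a l) = (\<Sum>i\<in>UNIV. b i / (2 * pi * \<i>) * (deriv (image_factor (a i)) (a l) / image_factor (a i) (a l)))"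
    by (rule field_eq_image_field[OF H a lim a])
  also have "\<dots> = b l / (2 * pi * \<i>) * (deriv (image_factor (a l)) (a l) / image_factor (a l) (a l))
      + (\<Sum>i\<in>UNIV - {l}. b i / (2 * pi * \<i>) * (deriv (image_factor (a i)) (a l) / image_factor (a i) (a l)))"
    by (simp add: sum.remove[of UNIV l])
  also have "(\<Sum>i\<in>UNIV - {l}. b i / (2 * pi * \<i>) * (deriv (image_factor (a i)) (a l) / image_factor (a i) (a l)))
     = (\<Sum>i\<in>UNIV - {l}. b i / (2 * pi * \<i>) *
         (deriv \<psi> (a l) / (\<psi> (a l) - \<psi> (a i)) + cnj (\<psi> (a i)) * deriv \<psi> (a l) / (1 - cnj (\<psi> (a i)) * \<psi> (a l)))
        - b i / (2 * pi * \<i>) * (1 / (a l - a i)))"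
  proof (rule sum.cong[OF refl])
    fix i assume "i \<in> UNIV - {l}"
    then have "a l \<noteq> a i" using ne[of i] by auto
    have distr: "B * ((x - y) + w) = B * (x + w) - B * y" for B x y w :: complex by (simp add: algebra_simps)
    show "b i / (2 * pi * \<i>) * (deriv (image_factor (a i)) (a l) / image_factor (a i) (a l)) = 
      b i / (2 * pi * \<i>) *
         (deriv \<psi> (a l) / (\<psi> (a l) - \<psi> (a i)) + cnj (\<psi> (a i)) * deriv \<psi> (a l) / (1 - cnj (\<psi> (a i)) * \<psi> (a l)))
        - b i / (2 * pi * \<i>) * (1 / (a l - a i))"
      unfolding deriv_image_factor_quotient[OF a a] deriv_dquot[OF a a \<open>a l \<noteq> a i\<close>]
      by (rule distr)
  qed
  finally show ?thesis
    unfolding deriv_image_factor_quotient[OF a a] deriv_dquot_diagonal[OF a] vortex_field_def sum_subtractf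
    by simp
qed

end

section \<open>Differentiability together with a local Lipschitz bound\<close>

text \<open>
  Exactly the regularity that the crossing argument consumes. Unlike continuous differentiability it
  requires no derivative away from the point, and it is closed under the
  operations that occur in the formula for the force.
\<close>

definition lipschitz_differentiable_at :: "('a::real_normed_vector \<Rightarrow> 'b::real_normed_vector) \<Rightarrow> 'a \<Rightarrow> bool" where
  "lipschitz_differentiable_at f p \<longleftrightarrow>
     f differentiable (at p) \<and> (\<exists>r>0. \<exists>L. L-lipschitz_on (ball p r) f)"

lemma lipschitz_differentiable_atI:
  "f differentiable (at p) \<Longrightarrow> r > 0 \<Longrightarrow> L-lipschitz_on (ball p r) f \<Longrightarrow> lipschitz_differentiable_at f p"
  unfolding lipschitz_differentiable_at_def by blast

lemma lipschitz_differentiable_at_transform: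
  assumes f: "lipschitz_differentiable_at f p" and S: "open S" "p \<in> S" and eq: "\<And>x. x \<in> S \<Longrightarrow> g x = f x"
  shows "lipschitz_differentiable_at g p"
proof -
  obtain r L where L: "f differentiable (at p)" "r > 0" "L-lipschitz_on (ball p r) f"
    using f unfolding lipschitz_differentiable_at_def by blast
  obtain s where s: "s > 0" "ball p s \<subseteq> S" using S openE by blast
  have "g differentiable (at p)"
    using L(1) eq has_derivative_transform_within_open[OF _ S] unfolding differentiable_def by metis
  moreover have "L-lipschitz_on (ball p (min r s)) f" by (rule lipschitz_on_subset[OF L(3)]) auto
  then have "L-lipschitz_on (ball p (min r s)) g"
    by (rule lipschitz_on_transform) (use s eq in auto)
  ultimately show ?thesis using L(2) s(1) by (intro lipschitz_differentiable_atI[of _ _ "min r s"]) auto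
qed

lemma lipschitz_differentiable_at_compose:
  assumes g: "lipschitz_differentiable_at g (f p)" and f: "lipschitz_differentiable_at f p"
  shows "lipschitz_differentiable_at (\<lambda>x. g (f x)) p"
proof -
  obtain r L where L: "f differentiable (at p)" "r > 0" "L-lipschitz_on (ball p r) f"
    using f unfolding lipschitz_differentiable_at_def by blast
  obtain s M where M: "g differentiable (at (f p))" "s > 0" "M-lipschitz_on (ball (f p) s) g"
    using g unfolding lipschitz_differentiable_at_def by blast
  have "isCont f p" using L(1) by (rule differentiable_imp_continuous_within)
  then obtain d where d: "d > 0" "\<And>x. dist x p < d \<Longrightarrow> dist (f x) (f p) < s"
    using M(2) unfolding continuous_at_eps_delta by blast
  have "(\<lambda>x. g (f x)) differentiable (at p)"
    using differentiable_chain_at[OF L(1) M(1)] by (simp add: o_def)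
  moreover have "L-lipschitz_on (ball p (min r d)) f" by (rule lipschitz_on_subset[OF L(3)]) auto
  then have "(M * L)-lipschitz_on (ball p (min r d)) (\<lambda>x. g (f x))"
    by (rule lipschitz_on_compose2)
      (rule lipschitz_on_subset[OF M(3)], use d(2) in \<open>auto simp: dist_commute\<close>)
  ultimately show ?thesis using L(2) d(1) by (intro lipschitz_differentiable_atI[of _ _ "min r d"]) auto
qed

lemma lipschitz_differentiable_at_bounded_linear:
  assumes "bounded_linear f"
  shows "lipschitz_differentiable_at f p"
proof -
  obtain K where K: "K-lipschitz_on UNIV f" by (rule bounded_linear.lipschitz_boundE[OF assms])
  show ?thesis
    by (rule lipschitz_differentiable_atI[OF bounded_linear_imp_differentiable[OF assms] zero_less_one
        lipschitz_on_subset[OF K subset_UNIV]])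
qed

lemma lipschitz_differentiable_at_linear_compose:
  "bounded_linear h \<Longrightarrow> lipschitz_differentiable_at f p \<Longrightarrow> lipschitz_differentiable_at (\<lambda>x. h (f x)) p"
  by (rule lipschitz_differentiable_at_compose[OF lipschitz_differentiable_at_bounded_linear])

lemma lipschitz_differentiable_at_const: "lipschitz_differentiable_at (\<lambda>x. c) p"
  by (rule lipschitz_differentiable_atI[OF differentiable_const zero_less_one lipschitz_on_constant])

lemma lipschitz_differentiable_at_add:
  assumes f: "lipschitz_differentiable_at f p" and g: "lipschitz_differentiable_at g p"
  shows "lipschitz_differentiable_at (\<lambda>x. f x + g x) p"
proof -
  obtain r L where L: "f differentiable (at p)" "r > 0" "L-lipschitz_on (ball p r) f"
    using f unfolding lipschitz_differentiable_at_def by blast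
  obtain s M where M: "g differentiable (at p)" "s > 0" "M-lipschitz_on (ball p s) g"
    using g unfolding lipschitz_differentiable_at_def by blast
  have "(L + M)-lipschitz_on (ball p (min r s)) (\<lambda>x. f x + g x)"
    by (intro lipschitz_on_add lipschitz_on_subset[OF L(3)] lipschitz_on_subset[OF M(3)]) auto
  then show ?thesis using L M by (intro lipschitz_differentiable_atI[of _ _ "min r s"] differentiable_add) auto
qed

lemma lipschitz_differentiable_at_diff:
  assumes f: "lipschitz_differentiable_at f p" and g: "lipschitz_differentiable_at g p"
  shows "lipschitz_differentiable_at (\<lambda>x. f x - g x) p"
  using lipschitz_differentiable_at_add[OF f 
      lipschitz_differentiable_at_linear_compose[OF bounded_linear_minus[OF bounded_linear_ident] g]]
  by simp

lemma lipschitz_differentiable_at_sum: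
  assumes "\<And>i. i \<in> I \<Longrightarrow> lipschitz_differentiable_at (f i) p"
  shows "lipschitz_differentiable_at (\<lambda>x. \<Sum>i\<in>I. f i x) p"
  using assms
  by (induction I rule: infinite_finite_induct)
     (auto intro: lipschitz_differentiable_at_const lipschitz_differentiable_at_add)

text \<open>
  The derivative is bounded on a closed disc, and the mean value inequality applies there.
\<close>

lemma lipschitz_differentiable_at_holomorphic:
  assumes h: "h holomorphic_on S" and S: "open S" "w \<in> S"
  shows "lipschitz_differentiable_at h w"
proof -
  obtain r where r: "r > 0" "cball w r \<subseteq> S" using S open_contains_cball by blast
  have "compact (deriv h ` cball w r)"
    by (rule compact_continuous_image)
       (use holomorphic_on_imp_continuous_on[OF holomorphic_deriv[OF h S(1)]] r in \<open>auto intro: continuous_on_subset\<close>)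
  then obtain B where B: "\<And>z. z \<in> cball w r \<Longrightarrow> norm (deriv h z) \<le> B"
    by (metis bounded_iff compact_imp_bounded imageI)
  have B0: "B \<ge> 0" using B[of w] r norm_ge_zero order_trans by (metis centre_in_cball less_imp_le)
  show ?thesis
  proof (rule lipschitz_differentiable_atI[OF _ r(1) lipschitz_onI[OF _ B0]])
    have "(h has_field_derivative deriv h w) (at w)" using holomorphic_derivI[OF h S] .
    then show "h differentiable (at w)" unfolding has_field_derivative_def differentiable_def by blast
    fix x y assume "x \<in> ball w r" "y \<in> ball w r"
    then show "dist (h x) (h y) \<le> B * dist x y"
      unfolding dist_norm
    proof (intro field_differentiable_bound[OF convex_ball[of w r]])
      fix z assume z: "z \<in> ball w r"
      then have "z \<in> S" "z \<in> cball w r" using r by auto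
      then show "(h has_field_derivative deriv h z) (at z within ball w r)" "cmod (deriv h z) \<le> B"
        using holomorphic_derivI[OF h S(1)] B has_field_derivative_at_within by blast+
    qed
  qed
qed

text \<open>
  The product is recovered from sums and the holomorphic squaring map by polarization.
\<close>

lemma lipschitz_differentiable_at_mult:
  fixes f g :: "'a::real_normed_vector \<Rightarrow> complex"
  assumes f: "lipschitz_differentiable_at f p" and g: "lipschitz_differentiable_at g p"
  shows "lipschitz_differentiable_at (\<lambda>x. f x * g x) p"
proof -
  have sq: "lipschitz_differentiable_at (\<lambda>x. (h x)\<^sup>2 / 4) p" if "lipschitz_differentiable_at h p"
    for h :: "'a \<Rightarrow> complex"
    by (rule lipschitz_differentiable_at_compose[OF lipschitz_differentiable_at_holomorphic[of _ UNIV] that])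
      (auto intro!: holomorphic_intros)
  have "(\<lambda>x. f x * g x) = (\<lambda>x. (f x + g x)\<^sup>2 / 4 - (f x - g x)\<^sup>2 / 4)"
    by (auto simp: power2_eq_square field_simps)
  then show ?thesis
    using lipschitz_differentiable_at_diff[OF sq[OF lipschitz_differentiable_at_add[OF f g]]
        sq[OF lipschitz_differentiable_at_diff[OF f g]]] by simp
qed

lemma lipschitz_differentiable_at_divide:
  fixes f g :: "'a::real_normed_vector \<Rightarrow> complex"
  assumes f: "lipschitz_differentiable_at f p" and g: "lipschitz_differentiable_at g p" and nz: "g p \<noteq> 0"
  shows "lipschitz_differentiable_at (\<lambda>x. f x / g x) p"
proof -
  have "lipschitz_differentiable_at inverse (g p)"
    by (rule lipschitz_differentiable_at_holomorphic[of _ "- {0}"]) (use nz in \<open>auto intro!: holomorphic_intros\<close>)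
  then have "lipschitz_differentiable_at (\<lambda>x. inverse (g x)) p"
    using g by (rule lipschitz_differentiable_at_compose)
  from lipschitz_differentiable_at_mult[OF f this] show ?thesis by (simp add: divide_inverse)
qed

context riemann_map
begin

lemma vortex_field_lipschitz_differentiable:
  assumes a: "\<And>i. lipschitz_differentiable_at (\<lambda>Y. a Y i) Z" and aD: "\<And>i. a Z i \<in> D"
    and ne: "\<And>i. i \<noteq> l \<Longrightarrow> a Z i \<noteq> a Z l"
  shows "lipschitz_differentiable_at (\<lambda>Y. vortex_field b l (a Y)) Z"
proof -
  have h: "lipschitz_differentiable_at (\<lambda>Y. h (a Y i)) Z" if "h holomorphic_on D" for h i
    by (rule lipschitz_differentiable_at_compose[OF lipschitz_differentiable_at_holomorphic[OF that openD aD] a])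
  note h1 = h[OF hol] h[OF holomorphic_deriv[OF hol openD]]
    h[OF holomorphic_deriv[OF holomorphic_deriv[OF hol openD] openD]]
  note h2 = lipschitz_differentiable_at_linear_compose[OF bounded_linear_cnj h[OF hol]]
  have nz: "\<psi> (a Z l) - \<psi> (a Z i) \<noteq> 0" if "i \<noteq> l" for i
    using inj aD ne[OF that] by (auto simp: inj_on_def)
  show ?thesis
    unfolding vortex_field_def
    by (intro lipschitz_differentiable_at_add lipschitz_differentiable_at_sum lipschitz_differentiable_at_mult
        lipschitz_differentiable_at_divide lipschitz_differentiable_at_diff lipschitz_differentiable_at_const h1 h2
        denom_nonzero aD) (use nz deriv_nonzero[OF aD] in auto)
qed

end

lemma lipschitz_differentiable_at_uniform:
  fixes f :: "'n::finite \<Rightarrow> 'a::real_normed_vector \<Rightarrow> 'b::real_normed_vector"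
  assumes "\<And>k. lipschitz_differentiable_at (f k) p" and S: "open S" "p \<in> S"
  obtains r L where "r > 0" "ball p r \<subseteq> S" "\<And>k. L-lipschitz_on (ball p r) (f k)"
proof -
  have "\<exists>r L. r > 0 \<and> L-lipschitz_on (ball p r) (f k)" for k
    using assms(1)[of k] unfolding lipschitz_differentiable_at_def by blast
  then obtain r L where rL: "\<And>k. r k > 0" "\<And>k. (L k)-lipschitz_on (ball p (r k)) (f k)" by metis
  obtain s where s: "s > 0" "ball p s \<subseteq> S" using S openE by blast
  define \<rho> where "\<rho> = min s (Min (range r))"
  have \<rho>: "\<rho> > 0" "\<rho> \<le> s" "\<And>k. \<rho> \<le> r k" using rL(1) s by (auto simp: \<rho>_def min.coboundedI2)
  show thesis
  proof (rule that[of \<rho> "Max (range L)"])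
    show "ball p \<rho> \<subseteq> S" using \<rho>(2) s by force
    fix k
    have "ball p \<rho> \<subseteq> ball p (r k)" using \<rho>(3) by (intro subset_ball)
    then have "(L k)-lipschitz_on (ball p \<rho>) (f k)" using lipschitz_on_subset[OF rL(2)] by blast
    then show "(Max (range L))-lipschitz_on (ball p \<rho>) (f k)" by (rule lipschitz_on_le) simp
  qed (rule \<rho>(1))
qed

section \<open>Symmetry of second derivatives\<close>

definition second_difference :: "('a::real_vector \<Rightarrow> real) \<Rightarrow> 'a \<Rightarrow> 'a \<Rightarrow> 'a \<Rightarrow> real \<Rightarrow> real" where
  "second_difference u x v w t = u (x + t *\<^sub>R v + t *\<^sub>R w) - u (x + t *\<^sub>R v) - u (x + t *\<^sub>R w) + u x"

text \<open>
  The left-hand side is symmetric in \<^term>\<open>v\<close> and \<^term>\<open>w\<close>, so its limit shows that the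
  second derivative is. By the mean value theorem in the direction \<^term>\<open>v\<close>, the second difference is
  \<open>t\<close> times the difference of two directional derivatives of \<^term>\<open>u\<close>, each of which the derivative
  \<^term>\<open>A\<close> of the gradient approximates up to \<open>o(t)\<close>.
\<close>

lemma second_difference_tendsto:
  fixes u :: "'a::real_inner \<Rightarrow> real" and g :: "'a \<Rightarrow> 'a"
  assumes \<Omega>: "open \<Omega>" "x \<in> \<Omega>" and u: "\<And>y. y \<in> \<Omega> \<Longrightarrow> GDERIV u y :> g y"
    and g: "(g has_derivative A) (at x)"
  shows "((\<lambda>t. second_difference u x v w t / t\<^sup>2) \<longlongrightarrow> A w \<bullet> v) (at_right 0)"
proof (rule tendstoI)
  fix e :: real assume e: "e > 0"
  define K where "K = norm v + norm w + 1"
  have K: "K > 0" by (simp add: K_def add_nonneg_pos)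
  define \<eta> where "\<eta> = e / (4 * K * K)"
  have \<eta>: "\<eta> > 0" using e K by (simp add: \<eta>_def)
  obtain d1 where d1: "d1 > 0" "\<And>y. norm (y - x) < d1 \<Longrightarrow> norm (g y - g x - A (y - x)) \<le> \<eta> * norm (y - x)"
    using g \<eta> unfolding has_derivative_at_alt by blast
  obtain d2 where d2: "d2 > 0" "ball x d2 \<subseteq> \<Omega>" using \<Omega> openE by blast
  define d where "d = min d1 d2 / K"
  have d: "d > 0" using d1 d2 K by (simp add: d_def)
  have lin: "linear A" using g has_derivative_linear by blast
  have "dist (second_difference u x v w t / t\<^sup>2) (A w \<bullet> v) < e"
    if t: "0 < t" "t < d" for t
  proof -
    have tK: "t * K < d1" "t * K < d2" using t K by (auto simp: d_def field_simps)
    let ?y = "\<lambda>s c. x + (s *\<^sub>R v + c *\<^sub>R w)"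
    have near: "norm (s *\<^sub>R v + c *\<^sub>R w) \<le> t * K" if "0 \<le> s" "s \<le> t" "0 \<le> c" "c \<le> t" for s c
    proof -
      have "norm (s *\<^sub>R v + c *\<^sub>R w) \<le> s * norm v + c * norm w"
        using norm_triangle_ineq[of "s *\<^sub>R v" "c *\<^sub>R w"] that by simp
      also have "\<dots> \<le> t * norm v + t * norm w" using that by (intro add_mono mult_right_mono) auto
      also have "\<dots> \<le> t * K" using t by (simp add: K_def algebra_simps)
      finally show ?thesis .
    qed
    have in\<Omega>: "?y s c \<in> \<Omega>" if "0 \<le> s" "s \<le> t" "0 \<le> c" "c \<le> t" for s c
    proof -
      have "dist (?y s c) x < d2" using near[OF that] tK by (simp add: dist_norm)
      then show ?thesis using d2(2) by (auto simp: dist_commute)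
    qed
    have approx: "norm (g (?y s c) - g x - A (s *\<^sub>R v + c *\<^sub>R w)) \<le> \<eta> * (t * K)"
      if "0 \<le> s" "s \<le> t" "0 \<le> c" "c \<le> t" for s c
    proof -
      have "norm (g (?y s c) - g x - A (s *\<^sub>R v + c *\<^sub>R w)) \<le> \<eta> * norm (s *\<^sub>R v + c *\<^sub>R w)"
        using d1(2)[of "?y s c"] near[OF that] tK by simp
      also have "\<dots> \<le> \<eta> * (t * K)" using near[OF that] \<eta> by (intro mult_left_mono) auto
      finally show ?thesis .
    qed
    define F where "F s = u (?y s t) - u (?y s 0)" for s
    have dF: "(F has_real_derivative g (?y s t) \<bullet> v - g (?y s 0) \<bullet> v) (at s)"
      if "0 \<le> s" "s \<le> t" for s
    proof -
      have 1: "((\<lambda>s. u (?y s c)) has_real_derivative g (?y s c) \<bullet> v) (at s)"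
        if c: "0 \<le> c" "c \<le> t" for c
      proof -
        have "((\<lambda>s. ?y s c) has_derivative (\<lambda>s. s *\<^sub>R v)) (at s)"
          by (auto intro!: derivative_eq_intros)
        moreover have "(u has_derivative (\<lambda>h. h \<bullet> g (?y s c))) (at (?y s c))"
          using u[OF in\<Omega>[OF \<open>0 \<le> s\<close> \<open>s \<le> t\<close> c]] by (simp add: gderiv_def)
        ultimately have "((\<lambda>s. u (?y s c)) has_derivative (\<lambda>k. (k *\<^sub>R v) \<bullet> g (?y s c))) (at s)"
          by (rule has_derivative_compose)
        then show ?thesis by (simp add: has_field_derivative_def mult_commute_abs inner_commute)
      qed
      show ?thesis unfolding F_def[abs_def] using t by (intro DERIV_diff 1) auto
    qed
    obtain \<xi> where \<xi>: "0 < \<xi>" "\<xi> < t" "F t - F 0 = (t - 0) * (g (?y \<xi> t) \<bullet> v - g (?y \<xi> 0) \<bullet> v)"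
      using MVT2[OF t(1) dF] by blast
    let ?R1 = "g (?y \<xi> t) - g x - A (\<xi> *\<^sub>R v + t *\<^sub>R w)"
    let ?R2 = "g (?y \<xi> 0) - g x - A (\<xi> *\<^sub>R v + 0 *\<^sub>R w)"
    have "g (?y \<xi> t) - g (?y \<xi> 0) = t *\<^sub>R A w + (?R1 - ?R2)"
      by (simp add: linear_add[OF lin] linear_scale[OF lin])
    then have FF: "F t - F 0 = t * (t * (A w \<bullet> v) + (?R1 - ?R2) \<bullet> v)"
      using \<xi>(3) by (metis diff_zero inner_add_left inner_diff_left inner_scaleR_left)
    have "\<bar>(?R1 - ?R2) \<bullet> v\<bar> \<le> norm (?R1 - ?R2) * norm v" by (rule Cauchy_Schwarz_ineq2)
    also have "\<dots> \<le> (2 * \<eta> * (t * K)) * K"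
    proof (rule mult_mono)
      have "norm (?R1 - ?R2) \<le> norm ?R1 + norm ?R2" by (rule norm_triangle_ineq4)
      also have "\<dots> \<le> 2 * \<eta> * (t * K)" using approx[of \<xi> t] approx[of \<xi> 0] \<xi> t by simp
      finally show "norm (?R1 - ?R2) \<le> 2 * \<eta> * (t * K)" .
    qed (use K \<eta> t in \<open>auto simp: K_def\<close>)
    also have "\<dots> = t * (e / 2)" using K by (simp add: \<eta>_def field_simps)
    finally have R: "\<bar>(?R1 - ?R2) \<bullet> v\<bar> \<le> t * (e / 2)" .
    have "second_difference u x v w t = F t - F 0"
      by (simp add: second_difference_def F_def add.assoc)
    then have "second_difference u x v w t / t\<^sup>2 - A w \<bullet> v
       = ((?R1 - ?R2) \<bullet> v) / t"
      using t unfolding FF by (simp add: field_simps power2_eq_square)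
    also have "\<bar>\<dots>\<bar> \<le> e / 2" using R t by (simp add: field_simps)
    finally show ?thesis using e by (simp add: dist_real_def)
  qed
  then show "\<forall>\<^sub>F t in at_right 0. dist (second_difference u x v w t / t\<^sup>2) (A w \<bullet> v) < e"
    using d eventually_at_right_real[of 0 d] by (auto elim: eventually_mono)
qed

lemma hessian_symmetric:
  fixes u :: "'a::real_inner \<Rightarrow> real" and g :: "'a \<Rightarrow> 'a"
  assumes \<Omega>: "open \<Omega>" "x \<in> \<Omega>" and u: "\<And>y. y \<in> \<Omega> \<Longrightarrow> GDERIV u y :> g y"
    and g: "(g has_derivative A) (at x)"
  shows "A w \<bullet> v = A v \<bullet> w"
proof -
  have 1: "((\<lambda>t. second_difference u x v w t / t\<^sup>2) \<longlongrightarrow> A w \<bullet> v) (at_right 0)"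
    by (rule second_difference_tendsto[OF assms])
  have 2: "((\<lambda>t. second_difference u x w v t / t\<^sup>2) \<longlongrightarrow> A v \<bullet> w) (at_right 0)"
    by (rule second_difference_tendsto[OF assms])
  have "(\<lambda>t. second_difference u x w v t / t\<^sup>2) =
     (\<lambda>t. second_difference u x v w t / t\<^sup>2)"
    by (rule ext) (simp add: second_difference_def add.assoc add.commute[of "_ *\<^sub>R w" "_ *\<^sub>R v"])
  then show ?thesis using tendsto_unique[OF _ 1] 2 by simp
qed

section \<open>Boundary values in graph charts\<close>

text \<open>
  In the plane the second vector of an orthonormal frame is a quarter turn of the first, in the
  direction given by the sign \<open>\<sigma>\<close>.
\<close>

lemma orthonormal_2_cases:
  fixes e1 e2 :: "real^2"
  assumes "norm e1 = 1" "norm e2 = 1" "e1 \<bullet> e2 = 0"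
  obtains \<sigma> :: real where "\<sigma> * \<sigma> = 1" "e2 = vector [- \<sigma> * e1$2, \<sigma> * e1$1]" "e1$1 * e1$1 + e1$2 * e1$2 = 1"
proof -
  have n: "e1$1 * e1$1 + e1$2 * e1$2 = 1" "e2$1 * e2$1 + e2$2 * e2$2 = 1" "e1$1 * e2$1 + e1$2 * e2$2 = 0"
    using assms by (simp_all add: norm_eq_1 inner_vec_def sum_2)
  define \<sigma> where "\<sigma> = e1$1 * e2$2 - e1$2 * e2$1"
  have a: "e2$1 = - \<sigma> * e1$2" "e2$2 = \<sigma> * e1$1" unfolding \<sigma>_def using n by algebra+
  have "\<sigma> * \<sigma> = 1" unfolding \<sigma>_def using n by algebra
  moreover have "e2 = vector [- \<sigma> * e1$2, \<sigma> * e1$1]" using a by (simp add: vec_eq_iff forall_2)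
  ultimately show ?thesis using that n by blast
qed

lemma orthonormal_2_decomposition:
  fixes e1 e2 :: "real^2"
  assumes "norm e1 = 1" "norm e2 = 1" "e1 \<bullet> e2 = 0"
  shows "x = (x \<bullet> e1) *\<^sub>R e1 + (x \<bullet> e2) *\<^sub>R e2"
proof -
  obtain \<sigma> :: real where s: "\<sigma> * \<sigma> = 1" "e2 = vector [- \<sigma> * e1$2, \<sigma> * e1$1]" "e1$1 * e1$1 + e1$2 * e1$2 = 1"
    by (rule orthonormal_2_cases[OF assms])
  show ?thesis
    unfolding s(2) vec_eq_iff forall_2 inner_vec_def sum_2
    by (simp; use s(1,3) in algebra)
qed

text \<open>
  The number \<open>c\<close> is the limit at \<open>0\<close> from the right, here with the rate of convergence.
\<close>

lemma lipschitz_real_tendsto_at_right: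
  fixes f :: "real \<Rightarrow> real"
  assumes "\<eta> > 0" and M: "M \<ge> 0" and lip: "\<And>h k. 0 < h \<Longrightarrow> h < \<eta> \<Longrightarrow> 0 < k \<Longrightarrow> k < \<eta> \<Longrightarrow> \<bar>f h - f k\<bar> \<le> M * \<bar>h - k\<bar>"
  obtains c where "\<And>h. 0 < h \<Longrightarrow> h < \<eta> \<Longrightarrow> \<bar>f h - c\<bar> \<le> M * h"
proof -
  define h where "h n = \<eta> / (real n + 2)" for n
  have h: "0 < h n" "h n < \<eta>" for n
  proof -
    have "\<eta> / (real n + 2) < \<eta> / 1" using assms(1) by (intro divide_strict_left_mono) auto
    then show "0 < h n" "h n < \<eta>" using assms(1) by (simp_all add: h_def)
  qed
  have h0: "h \<longlonglongrightarrow> 0" unfolding h_def by real_asymp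
  have "Cauchy h" using h0 convergent_Cauchy convergentI by blast
  have "Cauchy (\<lambda>n. f (h n))"
  proof (rule metric_CauchyI)
    fix e :: real assume e: "e > 0"
    obtain N where N: "\<And>m n. m \<ge> N \<Longrightarrow> n \<ge> N \<Longrightarrow> dist (h m) (h n) < e / (M + 1)"
      using metric_CauchyD[OF \<open>Cauchy h\<close>, of "e / (M+1)"] e M by auto
    have "dist (f (h m)) (f (h n)) < e" if "m \<ge> N" "n \<ge> N" for m n
    proof -
      have "\<bar>f (h m) - f (h n)\<bar> \<le> M * \<bar>h m - h n\<bar>" using lip h by blast
      also have "\<dots> \<le> (M + 1) * \<bar>h m - h n\<bar>" by (intro mult_right_mono) auto
      also have "\<dots> < e" using N[OF that] M by (simp add: dist_real_def field_simps)
      finally show ?thesis by (simp add: dist_real_def)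
    qed
    then show "\<exists>N. \<forall>m\<ge>N. \<forall>n\<ge>N. dist (f (h m)) (f (h n)) < e" by blast
  qed
  then obtain c where c: "(\<lambda>n. f (h n)) \<longlonglongrightarrow> c" using Cauchy_convergent convergent_def by blast
  show thesis
  proof (rule that)
    fix k assume k: "0 < k" "k < \<eta>"
    have 1: "(\<lambda>n. \<bar>f k - f (h n)\<bar>) \<longlonglongrightarrow> \<bar>f k - c\<bar>" by (intro tendsto_intros c)
    have 2: "(\<lambda>n. M * \<bar>k - h n\<bar>) \<longlonglongrightarrow> M * \<bar>k - 0\<bar>" by (intro tendsto_intros h0)
    have "\<bar>f k - c\<bar> \<le> M * \<bar>k - 0\<bar>"
      by (rule tendsto_le[OF _ 2 1]) (use lip k h in auto)
    then show "\<bar>f k - c\<bar> \<le> M * k" using k by simp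
  qed
qed


lemma local_graph_boundary_value:
  assumes \<Omega>: "open \<Omega>" and lg: "local_graph \<Omega> p r e1 e2 \<phi>" and cont: "continuous_on UNIV \<phi>"
    and q: "q \<in> frontier \<Omega>" "q \<in> ball p r"
  shows "(q - p) \<bullet> e2 = \<phi> ((q - p) \<bullet> e1)"
proof -
  have iff: "x \<in> \<Omega> \<longleftrightarrow> (x - p) \<bullet> e2 < \<phi> ((x - p) \<bullet> e1)" if "x \<in> ball p r" for x
    using lg that unfolding local_graph_def by blast
  have "q \<notin> \<Omega>" using q(1) \<Omega> frontier_disjoint_eq by blast
  then have 1: "\<phi> ((q - p) \<bullet> e1) \<le> (q - p) \<bullet> e2" using iff[OF q(2)] by simp
  define h where "h x = \<phi> ((x - p) \<bullet> e1) - (x - p) \<bullet> e2" for x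
  have conth: "continuous_on UNIV h" unfolding h_def
    by (intro continuous_intros continuous_on_compose2[OF cont]) auto
  have "\<not> h q < 0"
  proof
    assume "h q < 0"
    have "open {x. h x < 0}" using conth by (intro open_Collect_less continuous_intros) auto
    then have "open ({x. h x < 0} \<inter> ball p r)" by blast
    moreover have "q \<in> {x. h x < 0} \<inter> ball p r" using \<open>h q < 0\<close> q by simp
    moreover have "q \<in> closure \<Omega>" using q(1) by (simp add: frontier_def)
    ultimately have "{x. h x < 0} \<inter> ball p r \<inter> \<Omega> \<noteq> {}"
      using open_Int_closure_eq_empty by blast
    then show False using iff by (auto simp: h_def)
  qed
  then show ?thesis using 1 by (simp add: h_def)
qed

text \<open>
  Outer normals are defined through charts centred at the point in question. Moving the
  centre along the graph makes the normal available at all frontier points of one chart.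
\<close>

lemma local_graph_recentre:
  assumes \<Omega>: "open \<Omega>" and lg: "local_graph \<Omega> p r e1 e2 \<phi>" and cont: "continuous_on UNIV \<phi>"
    and q: "q \<in> frontier \<Omega>" "q \<in> ball p r"
  shows "local_graph \<Omega> q (r - dist p q) e1 e2 (\<lambda>t. \<phi> ((q - p) \<bullet> e1 + t) - \<phi> ((q - p) \<bullet> e1))"
proof -
  have bv: "(q - p) \<bullet> e2 = \<phi> ((q - p) \<bullet> e1)" by (rule local_graph_boundary_value[OF assms])
  have "\<Omega> \<inter> ball q (r - dist p q) = {x \<in> ball q (r - dist p q). x \<in> \<Omega> \<inter> ball p r}"
    by (auto simp: dist_commute) (metis add.commute dist_commute dist_triangle_lt less_diff_eq)
  also have "\<dots> = {x \<in> ball q (r - dist p q). (x - p) \<bullet> e2 < \<phi> ((x - p) \<bullet> e1)}"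
  proof -
    have "x \<in> ball p r" if "x \<in> ball q (r - dist p q)" for x
      using that dist_triangle[of p x q] by (simp add: dist_commute)
    then show ?thesis using lg unfolding local_graph_def by auto
  qed
  also have "\<dots> = {x \<in> ball q (r - dist p q). (x - q) \<bullet> e2 < \<phi> ((q - p) \<bullet> e1 + (x - q) \<bullet> e1) - \<phi> ((q - p) \<bullet> e1)}"
    using bv by (auto simp: inner_diff_left)
  finally show ?thesis using lg q unfolding local_graph_def by (simp add: dist_commute)
qed

text \<open>
  A function whose gradient extends continuously to the boundary and is normal there has a locally
  constant boundary value. In the coordinates \<open>(s, h)\<close> of the chart, \<open>h\<close> being the depth
  below the graph, the derivative in \<open>h\<close> is bounded, which gives a limit \<open>c\<close> as \<open>h\<close> tends to \<open>0\<close> on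
  the axis \<open>s = 0\<close>; the derivative in \<open>s\<close> tends to \<open>0\<close> uniformly with \<open>h\<close>, so that the same \<open>c\<close>
  serves for all \<open>s\<close>.
\<close>

lemma tangential_boundary_limit:
  fixes \<Omega> :: "(real^2) set" and S :: "real^2 \<Rightarrow> real" and A :: "real^2 \<Rightarrow> real^2"
  assumes \<Omega>: "open \<Omega>" and p: "p \<in> frontier \<Omega>" and lg: "local_graph \<Omega> p r e1 e2 \<phi>"
    and d\<phi>: "\<And>s. (\<phi> has_real_derivative \<phi>' s) (at s)" and c\<phi>': "continuous_on UNIV \<phi>'"
    and \<rho>: "0 < \<rho>" "\<rho> \<le> r"
    and A: "continuous_on (closure \<Omega> \<inter> ball p \<rho>) A"
    and S: "\<And>x. x \<in> \<Omega> \<inter> ball p \<rho> \<Longrightarrow> GDERIV S x :> A x"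
    and tan: "\<And>q. q \<in> frontier \<Omega> \<inter> ball p \<rho> \<Longrightarrow> A q \<bullet> (e1 + \<phi>' ((q - p) \<bullet> e1) *\<^sub>R e2) = 0"
  obtains \<delta> c where "\<delta> > 0" "\<And>q. q \<in> frontier \<Omega> \<inter> ball p \<delta> \<Longrightarrow> (S \<longlongrightarrow> c) (at q within \<Omega>)"
proof -
  have ON: "norm e1 = 1" "norm e2 = 1" "e1 \<bullet> e2 = 0" and r: "r > 0"
    and iff: "\<And>x. x \<in> ball p r \<Longrightarrow> x \<in> \<Omega> \<longleftrightarrow> (x - p) \<bullet> e2 < \<phi> ((x - p) \<bullet> e1)"
    using lg unfolding local_graph_def by blast+
  have e11: "e1 \<bullet> e1 = 1" "e2 \<bullet> e2 = 1" using ON by (simp_all add: norm_eq_1)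
  have c\<phi>: "continuous_on UNIV \<phi>" using d\<phi> by (meson DERIV_isCont continuous_at_imp_continuous_on)
  have bv: "(q - p) \<bullet> e2 = \<phi> ((q - p) \<bullet> e1)" if "q \<in> frontier \<Omega>" "q \<in> ball p r" for q
    by (rule local_graph_boundary_value[OF \<Omega> lg c\<phi> that])
  have \<phi>0: "\<phi> 0 = 0" using bv[OF p] r by simp
  define P where "P s h = p + s *\<^sub>R e1 + (\<phi> s - h) *\<^sub>R e2" for s h
  have Pc: "(P s h - p) \<bullet> e1 = s" "(P s h - p) \<bullet> e2 = \<phi> s - h" for s h
    using ON(3) e11 by (simp_all add: P_def inner_add_left inner_commute[of e2 e1])
  have xP: "x = P ((x - p) \<bullet> e1) (\<phi> ((x - p) \<bullet> e1) - (x - p) \<bullet> e2)" for x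
    unfolding P_def using orthonormal_2_decomposition[OF ON, of "x - p"] by (simp add: algebra_simps)
  \<comment> \<open>a box in the coordinates \<open>(s, h)\<close> whose points stay in a compact ball around \<open>p\<close>\<close>
  obtain d1 where d1: "d1 > 0" "\<And>s. \<bar>s\<bar> < d1 \<Longrightarrow> \<bar>\<phi> s\<bar> < \<rho> / 16"
  proof -
    have "isCont \<phi> 0" using c\<phi> by (simp add: continuous_on_eq_continuous_at)
    then obtain d where "d > 0" "\<And>s. dist s 0 < d \<Longrightarrow> dist (\<phi> s) (\<phi> 0) < \<rho> / 16"
      using \<rho> unfolding continuous_at_eps_delta by (metis divide_pos_pos zero_less_numeral)
    then show thesis using that \<phi>0 by (simp add: dist_real_def)
  qed
  define \<delta>' where "\<delta>' = min d1 (\<rho> / 16)"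
  define \<eta>0 where "\<eta>0 = \<rho> / 8"
  have pos: "\<delta>' > 0" "\<eta>0 > 0" using d1 \<rho> by (auto simp: \<delta>'_def \<eta>0_def)
  have inK: "P s h \<in> ball p (\<rho> / 2)" if "\<bar>s\<bar> < \<delta>'" "0 \<le> h" "h < \<eta>0" for s h
  proof -
    have "norm (s *\<^sub>R e1 + (\<phi> s - h) *\<^sub>R e2) \<le> \<bar>s\<bar> + \<bar>\<phi> s - h\<bar>"
      using norm_triangle_ineq[of "s *\<^sub>R e1" "(\<phi> s - h) *\<^sub>R e2"] ON by simp
    also have "\<dots> < \<rho> / 2" using d1(2)[of s] that abs_triangle_ineq4[of "\<phi> s" h] by (auto simp: \<delta>'_def \<eta>0_def)
    finally have "dist (P s h) p < \<rho> / 2" by (simp add: P_def dist_norm add.assoc)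
    then show ?thesis by (simp add: dist_commute)
  qed
  have inr: "P s h \<in> ball p r" "P s h \<in> ball p \<rho>" if "\<bar>s\<bar> < \<delta>'" "0 \<le> h" "h < \<eta>0" for s h
    using inK[OF that] \<rho> by auto
  have in\<Omega>: "P s h \<in> \<Omega>" if "\<bar>s\<bar> < \<delta>'" "0 < h" "h < \<eta>0" for s h
    using iff[OF inr(1)[of s h]] that by (simp add: Pc)
  have infr: "P s 0 \<in> frontier \<Omega>" if s: "\<bar>s\<bar> < \<delta>'" for s
  proof -
    have "P s 0 \<notin> \<Omega>" using iff[OF inr(1)[of s 0]] s pos by (simp add: Pc)
    moreover have "P s 0 \<in> closure \<Omega>"
    proof (rule Lim_in_closed_set[of "closure \<Omega>" "P s" "at_right 0"])
      show "\<forall>\<^sub>F h in at_right 0. P s h \<in> closure \<Omega>"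
        using eventually_at_right_real[OF pos(2)] 
        by eventually_elim (use in\<Omega>[OF s] closure_subset in force)
      have "((\<lambda>h. P s h) \<longlongrightarrow> P s 0) (at_right 0)" unfolding P_def by (intro tendsto_intros)
      then show "(P s \<longlongrightarrow> P s 0) (at_right 0)" by simp
    qed auto
    ultimately show ?thesis using \<Omega> by (simp add: frontier_def interior_open)
  qed
  define K where "K = closure \<Omega> \<inter> cball p (\<rho> / 2)"
  have "compact K" unfolding K_def by (intro closed_Int_compact) auto
  have KA: "continuous_on K A" by (rule continuous_on_subset[OF A]) (use \<rho> in \<open>auto simp: K_def\<close>)
  have PK: "P s h \<in> K" if "\<bar>s\<bar> < \<delta>'" "0 \<le> h" "h < \<eta>0" for s h
  proof -
    have "P s h \<in> closure \<Omega>"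
      using infr[of s] in\<Omega>[of s h] that closure_subset by (cases "h = 0") (auto simp: frontier_def)
    then show ?thesis using inK[OF that] by (auto simp: K_def)
  qed
  obtain M0 where M0: "\<And>x. x \<in> K \<Longrightarrow> norm (A x) \<le> M0"
    using compact_imp_bounded[OF compact_continuous_image[OF KA \<open>compact K\<close>]] by (auto simp: bounded_iff)
  define M where "M = max M0 0"
  have M: "M \<ge> 0" "\<And>x. x \<in> K \<Longrightarrow> norm (A x) \<le> M" using M0 by (auto simp: M_def le_max_iff_disj)
  have ucA: "uniformly_continuous_on K A" by (rule compact_uniformly_continuous[OF KA \<open>compact K\<close>])
  have "bounded (\<phi>' ` {- \<delta>'..\<delta>'})"
    by (intro compact_imp_bounded compact_continuous_image continuous_on_subset[OF c\<phi>']) auto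
  then obtain B0 where B0: "\<And>s. s \<in> {-\<delta>'..\<delta>'} \<Longrightarrow> \<bar>\<phi>' s\<bar> \<le> B0"
    unfolding bounded_iff real_norm_def by blast
  have B0n: "B0 \<ge> 0" using B0[of 0] pos by auto
  have GS: "(S has_derivative (\<lambda>k. k \<bullet> A (P s h))) (at (P s h))" if "\<bar>s\<bar> < \<delta>'" "0 < h" "h < \<eta>0" for s h
    using S[of "P s h"] in\<Omega>[OF that] inr(2)[of s h] that by (simp add: gderiv_def)
  have dh: "((\<lambda>h. S (P s h)) has_derivative (\<lambda>k. - k * (e2 \<bullet> A (P s h)))) (at h)" if "\<bar>s\<bar> < \<delta>'" "0 < h" "h < \<eta>0" for s h
  proof -
    have "((\<lambda>h. P s h) has_derivative (\<lambda>k. - k *\<^sub>R e2)) (at h)"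
      unfolding P_def by (auto intro!: derivative_eq_intros)
    from has_derivative_compose[OF this GS[OF that]] show ?thesis by simp
  qed
  have ds: "((\<lambda>s. S (P s h)) has_derivative (\<lambda>k. k * ((e1 + \<phi>' s *\<^sub>R e2) \<bullet> A (P s h)))) (at s)" if "\<bar>s\<bar> < \<delta>'" "0 < h" "h < \<eta>0" for s h
  proof -
    have d: "(\<phi> has_derivative (\<lambda>k. k * \<phi>' s)) (at s)" using d\<phi>[of s] by (simp add: has_field_derivative_def mult_commute_abs)
    have "((\<lambda>s. P s h) has_derivative (\<lambda>k. k *\<^sub>R (e1 + \<phi>' s *\<^sub>R e2))) (at s)"
      unfolding P_def by (auto intro!: derivative_eq_intros d simp: algebra_simps)
    from has_derivative_compose[OF this GS[OF that]] show ?thesis by simp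
  qed
  have lip_h: "\<bar>S (P s h) - S (P s k)\<bar> \<le> M * \<bar>h - k\<bar>"
    if "\<bar>s\<bar> < \<delta>'" "0 < h" "h < \<eta>0" "0 < k" "k < \<eta>0" for s h k
  proof -
    have "norm (S (P s h) - S (P s k)) \<le> M * norm (h - k)"
    proof (rule differentiable_bound[of "{0<..<\<eta>0}" _ "\<lambda>h k. - k * (e2 \<bullet> A (P s h))"])
      fix x assume x: "x \<in> {0<..<\<eta>0}"
      show "((\<lambda>h. S (P s h)) has_derivative (\<lambda>k. - k * (e2 \<bullet> A (P s x)))) (at x within {0<..<\<eta>0})"
        using dh[of s x] that x by (auto intro: has_derivative_at_withinI)
      have "\<bar>e2 \<bullet> A (P s x)\<bar> \<le> norm e2 * norm (A (P s x))" by (rule Cauchy_Schwarz_ineq2)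
      also have "\<dots> \<le> M" using M(2)[OF PK[of s x]] that x ON by simp
      finally show "onorm (\<lambda>k. - k * (e2 \<bullet> A (P s x))) \<le> M"
        by (intro onorm_le) (simp add: abs_mult mult.commute[of M] mult_left_mono)
    qed (use that in auto)
    then show ?thesis by simp
  qed
  obtain c where c: "\<And>h. 0 < h \<Longrightarrow> h < \<eta>0 \<Longrightarrow> \<bar>S (P 0 h) - c\<bar> \<le> M * h"
    by (rule lipschitz_real_tendsto_at_right[of \<eta>0 M "\<lambda>h. S (P 0 h)"]) (use pos M lip_h in auto)
  have small: "\<exists>\<eta>>0. \<eta> \<le> \<eta>0 \<and> (\<forall>s h. \<bar>s\<bar> < \<delta>' \<and> 0 < h \<and> h < \<eta> \<longrightarrow> \<bar>S (P s h) - S (P 0 h)\<bar> \<le> e)" if e: "e > 0" for e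
  proof -
    define e' where "e' = e / ((1 + B0) * \<delta>')"
    have e': "e' > 0" using e pos B0n by (simp add: e'_def)
    obtain d where d: "d > 0" "\<And>x y. x \<in> K \<Longrightarrow> y \<in> K \<Longrightarrow> dist y x < d \<Longrightarrow> dist (A y) (A x) < e'"
      using ucA e' unfolding uniformly_continuous_on_def by metis
    have "\<bar>S (P s h) - S (P 0 h)\<bar> \<le> e" if s: "\<bar>s\<bar> < \<delta>'" and h: "0 < h" "h < min d \<eta>0" for s h
    proof -
      have "norm (S (P s h) - S (P 0 h)) \<le> ((1 + B0) * e') * norm (s - 0)"
      proof (rule differentiable_bound[of "{-\<delta>'<..<\<delta>'}" _ "\<lambda>s k. k * ((e1 + \<phi>' s *\<^sub>R e2) \<bullet> A (P s h))"])
        fix x assume x: "x \<in> {-\<delta>'<..<\<delta>'}"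
        then have x': "\<bar>x\<bar> < \<delta>'" by auto
        show "((\<lambda>s. S (P s h)) has_derivative (\<lambda>k. k * ((e1 + \<phi>' x *\<^sub>R e2) \<bullet> A (P x h)))) (at x within {-\<delta>'<..<\<delta>'})"
          using ds[of x h] x' h by (auto intro: has_derivative_at_withinI)
        have dP: "dist (P x h) (P x 0) < d"
          using h ON by (simp add: P_def dist_norm flip: scaleR_diff_left)
        have "A (P x 0) \<bullet> (e1 + \<phi>' x *\<^sub>R e2) = 0"
          using tan[of "P x 0"] infr[OF x'] inr(2)[of x 0] x' pos by (simp add: Pc)
        then have "(e1 + \<phi>' x *\<^sub>R e2) \<bullet> A (P x h) = (e1 + \<phi>' x *\<^sub>R e2) \<bullet> (A (P x h) - A (P x 0))"
          by (simp add: inner_diff_right inner_commute)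
        also have "\<bar>\<dots>\<bar> \<le> norm (e1 + \<phi>' x *\<^sub>R e2) * norm (A (P x h) - A (P x 0))" by (rule Cauchy_Schwarz_ineq2)
        also have "\<dots> \<le> (1 + B0) * e'"
        proof (rule mult_mono)
          show "norm (e1 + \<phi>' x *\<^sub>R e2) \<le> 1 + B0"
            using norm_triangle_ineq[of e1 "\<phi>' x *\<^sub>R e2"] ON B0[of x] x by simp
          show "norm (A (P x h) - A (P x 0)) \<le> e'"
            using d(2)[OF PK PK dP] x' h pos by (simp add: dist_norm)
        qed (use B0n in auto)
        finally show "onorm (\<lambda>k. k * ((e1 + \<phi>' x *\<^sub>R e2) \<bullet> A (P x h))) \<le> (1 + B0) * e'"
          by (intro onorm_le) (simp add: abs_mult mult.commute[of "(1 + B0) * e'"] mult_left_mono)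
      qed (use s pos in auto)
      also have "\<dots> \<le> ((1 + B0) * e') * \<delta>'" using s B0n e' by (intro mult_left_mono) auto
      also have "\<dots> = e" using B0n pos by (simp add: e'_def)
      finally show ?thesis by simp
    qed
    then show ?thesis using d(1) pos by (intro exI[of _ "min d \<eta>0"]) auto
  qed
  define hgt where "hgt x = \<phi> ((x - p) \<bullet> e1) - (x - p) \<bullet> e2" for x
  have conth: "continuous_on UNIV hgt" unfolding hgt_def
    by (intro continuous_intros continuous_on_compose2[OF c\<phi>]) auto
  show thesis
  proof (rule that[OF pos(1)])
    fix q assume q: "q \<in> frontier \<Omega> \<inter> ball p \<delta>'"
    have "\<delta>' \<le> r" using \<rho> by (simp add: \<delta>'_def min_def)
    then have hq: "hgt q = 0" using bv[of q] q by (simp add: hgt_def)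
    have "((\<lambda>x. hgt x) \<longlongrightarrow> hgt q) (at q within \<Omega>)"
      using conth by (simp add: continuous_on_eq_continuous_at continuous_at_imp_continuous_within flip: continuous_within)
    then have h0: "(hgt \<longlongrightarrow> 0) (at q within \<Omega>)" using hq by simp
    show "(S \<longlongrightarrow> c) (at q within \<Omega>)"
    proof (rule tendstoI)
      fix e :: real assume e: "e > 0"
      obtain \<eta> where \<eta>: "\<eta> > 0" "\<eta> \<le> \<eta>0" "\<And>s h. \<bar>s\<bar> < \<delta>' \<Longrightarrow> 0 < h \<Longrightarrow> h < \<eta> \<Longrightarrow> \<bar>S (P s h) - S (P 0 h)\<bar> \<le> e / 2"
        using small[of "e / 2"] e by auto
      define \<eta>' where "\<eta>' = min \<eta> (e / (2 * (M + 1)))"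
      have \<eta>': "\<eta>' > 0" using \<eta> e M by (simp add: \<eta>'_def)
      have ev1: "\<forall>\<^sub>F x in at q within \<Omega>. hgt x < \<eta>'" using order_tendstoD(2)[OF h0 \<eta>'] .
      have ev2: "\<forall>\<^sub>F x in at q within \<Omega>. x \<in> ball p \<delta>'"
        using q eventually_at_topological[of _ q \<Omega>] by (meson IntD2 open_ball)
      have ev3: "\<forall>\<^sub>F x in at q within \<Omega>. x \<in> \<Omega>" by (simp add: eventually_at_filter)
      show "\<forall>\<^sub>F x in at q within \<Omega>. dist (S x) c < e"
        using ev1 ev2 ev3
      proof eventually_elim
        case (elim x)
        define s where "s = (x - p) \<bullet> e1"
        have "\<bar>s\<bar> \<le> norm (x - p) * norm e1" unfolding s_def by (rule Cauchy_Schwarz_ineq2)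
        then have s: "\<bar>s\<bar> < \<delta>'" using elim ON by (simp add: dist_norm norm_minus_commute)
        have "x \<in> ball p r" using elim \<open>\<delta>' \<le> r\<close> by auto
        then have hpos: "hgt x > 0" using iff elim(3) by (simp add: hgt_def)
        have x: "x = P s (hgt x)" using xP[of x] by (simp add: s_def hgt_def)
        have h: "hgt x < \<eta>" "hgt x < e / (2 * (M + 1))" using elim(1) by (auto simp: \<eta>'_def)
        have "\<bar>S x - S (P 0 (hgt x))\<bar> \<le> e / 2" using \<eta>(3)[OF s hpos h(1)] x by simp
        moreover have "\<bar>S (P 0 (hgt x)) - c\<bar> \<le> M * hgt x" using c[OF hpos] h \<eta> by simp
        moreover have "M * hgt x \<le> (M + 1) * hgt x" using hpos by (intro mult_right_mono) auto
        moreover have "(M + 1) * hgt x < e / 2" using h(2) M by (simp add: field_simps)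
        ultimately show ?case unfolding dist_real_def by linarith
      qed
    qed
  qed
qed

section \<open>The anisotropic problem in a complex variable\<close>

text \<open>
  In the coordinates \<open>stretch lam x\<close> the matrix \<open>L\<close> becomes a multiple of the identity. The complex
  gradient \<open>U\<^sub>1 - \<i> U\<^sub>2\<close> of a function \<open>U\<close> of the new variable is
  \<open>complex_gradient lam p\<close>, where \<open>p\<close> is the gradient of \<open>U \<circ> stretch lam\<close>; \<open>real_gradient\<close> recovers
  \<open>p\<close> from it.
\<close>

definition stretch :: "real \<Rightarrow> real^2 \<Rightarrow> complex" where
  "stretch lam x = Complex (lam * x$1) (x$2)"

definition unstretch :: "real \<Rightarrow> complex \<Rightarrow> real^2" where
  "unstretch lam z = vector [Re z / lam, Im z]"

definition complex_gradient :: "real \<Rightarrow> real^2 \<Rightarrow> complex" where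
  "complex_gradient lam p = Complex (p$1 / lam) (- p$2)"

definition real_gradient :: "real \<Rightarrow> complex \<Rightarrow> real^2" where
  "real_gradient lam w = vector [lam * Re w, - Im w]"

lemma bounded_linear_stretch: "bounded_linear (stretch lam)"
  by (rule linear_conv_bounded_linear[THEN iffD1], rule linearI)
     (auto simp: stretch_def complex_eq_iff algebra_simps)

lemma bounded_linear_unstretch: "bounded_linear (unstretch lam)"
  by (rule linear_conv_bounded_linear[THEN iffD1], rule linearI)
     (auto simp: unstretch_def vec_eq_iff forall_2 add_divide_distrib)

lemma bounded_linear_complex_gradient: "bounded_linear (complex_gradient lam)"
  by (rule linear_conv_bounded_linear[THEN iffD1], rule linearI)
     (auto simp: complex_gradient_def complex_eq_iff add_divide_distrib)

lemma bounded_linear_real_gradient: "bounded_linear (real_gradient lam)"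
  by (rule linear_conv_bounded_linear[THEN iffD1], rule linearI)
     (auto simp: real_gradient_def vec_eq_iff forall_2 algebra_simps)

lemma stretch_unstretch: "lam \<noteq> 0 \<Longrightarrow> stretch lam (unstretch lam z) = z"
  by (simp add: stretch_def unstretch_def complex_eq_iff)

lemma unstretch_stretch: "lam \<noteq> 0 \<Longrightarrow> unstretch lam (stretch lam x) = x"
  by (simp add: stretch_def unstretch_def vec_eq_iff forall_2)

lemma real_gradient_complex_gradient: "lam \<noteq> 0 \<Longrightarrow> real_gradient lam (complex_gradient lam p) = p"
  by (simp add: real_gradient_def complex_gradient_def vec_eq_iff forall_2)

lemma linear_stretch: "linear (stretch lam)"
  using bounded_linear_stretch bounded_linear.linear by blast

lemma inj_stretch: "lam \<noteq> 0 \<Longrightarrow> inj (stretch lam)"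
  by (metis injI unstretch_stretch)

lemma bij_stretch: "lam \<noteq> 0 \<Longrightarrow> bij (stretch lam)"
  by (metis bij_betw_def inj_stretch stretch_unstretch surjI)

lemma stretch_image_properties:
  assumes lam: "lam \<noteq> 0"
  shows "open (stretch lam ` \<Omega>) \<longleftrightarrow> open \<Omega>"
    and "bounded \<Omega> \<Longrightarrow> bounded (stretch lam ` \<Omega>)"
    and "simply_connected \<Omega> \<Longrightarrow> simply_connected (stretch lam ` \<Omega>)"
    and "open \<Omega> \<Longrightarrow> frontier (stretch lam ` \<Omega>) = stretch lam ` frontier \<Omega>"
proof -
  show op: "open (stretch lam ` \<Omega>) \<longleftrightarrow> open \<Omega>"
    by (rule open_bijective_linear_image_eq[OF linear_stretch bij_stretch[OF lam]])
  show "bounded \<Omega> \<Longrightarrow> bounded (stretch lam ` \<Omega>)"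
    by (rule bounded_linear_image[OF _ bounded_linear_stretch])
  have "homeomorphism \<Omega> (stretch lam ` \<Omega>) (stretch lam) (unstretch lam)"
    unfolding homeomorphism_def
    using lam by (auto simp: stretch_unstretch unstretch_stretch image_image
       intro!: linear_continuous_on bounded_linear_stretch bounded_linear_unstretch)
  then show "simply_connected \<Omega> \<Longrightarrow> simply_connected (stretch lam ` \<Omega>)"
    using homeomorphic_simply_connected unfolding homeomorphic_def by blast
  assume "open \<Omega>"
  then show "frontier (stretch lam ` \<Omega>) = stretch lam ` frontier \<Omega>"
    using op closure_injective_linear_image[OF linear_stretch inj_stretch[OF lam], of \<Omega>]
    by (simp add: frontier_def interior_open image_set_diff[OF inj_stretch[OF lam]])
qed

lemma GDERIV_unique:
  assumes "GDERIV f x :> D" "GDERIV f x :> D'"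
  shows "D = D'"
proof -
  have "(\<lambda>h. h \<bullet> D) = (\<lambda>h. h \<bullet> D')"
    using assms unfolding gderiv_def by (rule has_derivative_unique)
  then have "(D - D') \<bullet> (D - D') = 0" by (metis inner_diff_right right_minus_eq)
  then show ?thesis by simp
qed

lemma GDERIV_grad:
  fixes f :: "'a::euclidean_space \<Rightarrow> real"
  assumes "f differentiable (at x)"
  shows "GDERIV f x :> grad f x"
proof -
  obtain n where n: "GDERIV f x :> n" using differentiable_imp_GDERIV[OF assms] .
  show ?thesis unfolding grad_def by (rule theI[of "\<lambda>D. GDERIV f x :> D", OF n]) (rule GDERIV_unique[OF _ n])
qed

lemma L_mat_mult: "L_mat \<mu> lam *v p = vector [\<mu> * p$1, \<mu> * lam\<^sup>2 * p$2]"
  by (simp add: L_mat_def matrix_vector_mult_def vec_eq_iff forall_2 sum_2)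

text \<open>
  The strain of a single dislocation is the field of a point vortex.
\<close>

lemma complex_gradient_strain_kernel:
  assumes lam: "lam \<noteq> 0"
  shows "complex_gradient lam (strain_kernel lam \<beta> x z)
     = \<beta> / (2 * pi * \<i>) * (1 / (stretch lam x - stretch lam z))"
proof -
  define d where "d = x - z"
  define n where "n = lam\<^sup>2 * (d$1)\<^sup>2 + (d$2)\<^sup>2"
  have nn: "(norm (Lambda_mat lam *v d))\<^sup>2 = n"
    by (simp add: Lambda_mat_def matrix_vector_mult_def norm_vec_def L2_set_def sum_2 n_def power_mult_distrib)
  have J: "transpose J_mat *v d = vector [- d$2, d$1]"
    by (simp add: J_mat_def transpose_def matrix_vector_mult_def vec_eq_iff forall_2 sum_2)
  have s: "stretch lam x - stretch lam z = stretch lam d"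
    by (simp add: d_def linear_diff[OF linear_stretch])
  have "1 / stretch lam d = cnj (stretch lam d) / of_real n"
  proof -
    have "(cmod (stretch lam d))\<^sup>2 = n" by (simp add: stretch_def n_def cmod_power2 power_mult_distrib)
    then show ?thesis using complex_div_cnj[of 1 "stretch lam d"] by simp
  qed
  moreover have "\<beta> / (2 * pi * \<i>) * (c / of_real n) = of_real (\<beta> / (2 * pi) / n) * (- \<i> * c)" for c
    by (cases "n = 0") (simp_all add: field_simps)
  ultimately have "\<beta> / (2 * pi * \<i>) * (1 / stretch lam d) = of_real (\<beta> / (2 * pi) / n) * (- \<i> * cnj (stretch lam d))"
    by simp
  also have "\<dots> = complex_gradient lam ((\<beta> / (2 * pi)) *\<^sub>R ((lam / n) *\<^sub>R vector [- d$2, d$1]))"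
    using lam by (simp add: complex_gradient_def stretch_def complex_eq_iff)
  finally show ?thesis unfolding s strain_kernel_def d_def[symmetric] nn J by simp
qed

text \<open>
  A quarter turn exchanges the normal \<open>e2 - m e1\<close> and the tangent \<open>e1 + m e2\<close> of the graph, and
  multiplication by \<open>stretch lam\<close> of the tangent turns the conormal component of the
  field into the derivative of the stream function along the boundary.
\<close>

lemma conormal_zero_imp_tangential_Im_zero:
  assumes ON: "norm e1 = 1" "norm e2 = 1" "e1 \<bullet> e2 = 0" and mu: "\<mu> \<noteq> 0" and lam: "lam \<noteq> 0"
    and zero: "(L_mat \<mu> lam *v p) \<bullet> (e2 - m *\<^sub>R e1) = 0"
  shows "Im (complex_gradient lam p * stretch lam (e1 + m *\<^sub>R e2)) = 0"
proof -
  obtain \<sigma> :: real where s: "\<sigma> * \<sigma> = 1" "e2 = vector [- \<sigma> * e1$2, \<sigma> * e1$1]" "e1$1 * e1$1 + e1$2 * e1$2 = 1"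
    by (rule orthonormal_2_cases[OF ON])
  have "\<mu> * (p$1 * (- \<sigma> * e1$2 - m * e1$1) + lam\<^sup>2 * p$2 * (\<sigma> * e1$1 - m * e1$2)) = 0"
    using zero unfolding L_mat_mult s(2) by (simp add: inner_vec_def sum_2 algebra_simps)
  then have z: "p$1 * (- \<sigma> * e1$2 - m * e1$1) + lam\<^sup>2 * p$2 * (\<sigma> * e1$1 - m * e1$2) = 0" using mu by simp
  have "lam * Im (complex_gradient lam p * stretch lam (e1 + m *\<^sub>R e2)) =
     p$1 * (e1$2 + m * (\<sigma> * e1$1)) - lam\<^sup>2 * p$2 * (e1$1 - m * (\<sigma> * e1$2))"
    using lam unfolding s(2) by (simp add: complex_gradient_def stretch_def power2_eq_square field_simps)
  also have "\<dots> = - \<sigma> * (p$1 * (- \<sigma> * e1$2 - m * e1$1) + lam\<^sup>2 * p$2 * (\<sigma> * e1$1 - m * e1$2))"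
    using s(1) by algebra
  also have "\<dots> = 0" using z by simp
  finally show ?thesis using lam by simp
qed

text \<open>
  The Cauchy-Riemann equations are the symmetry of the Hessian together with the
  partial differential equation.
\<close>

lemma complex_gradient_of_solution_holomorphic:
  assumes \<Omega>: "open \<Omega>" and lam: "lam \<noteq> 0" and mu: "\<mu> \<noteq> 0" and u: "C2_on \<Omega> u"
    and div: "\<And>x. x \<in> \<Omega> \<Longrightarrow> divergence (\<lambda>y. L_mat \<mu> lam *v grad u y) x = 0"
  shows "(\<lambda>z. complex_gradient lam (grad u (unstretch lam z))) holomorphic_on (stretch lam ` \<Omega>)"
proof -
  have "\<exists>f'. ((\<lambda>z. complex_gradient lam (grad u (unstretch lam z))) has_field_derivative f') (at z)"
    if z: "z \<in> stretch lam ` \<Omega>" for z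
  proof -
    obtain x where x: "x \<in> \<Omega>" "z = stretch lam x" using z by blast
    have uz: "unstretch lam z = x" using x lam by (simp add: unstretch_stretch)
    obtain A where A: "(grad u has_derivative A) (at x)"
      using u x unfolding C2_on_def differentiable_def by blast
    have lin: "linear A" using has_derivative_linear[OF A] .
    define E1 where "E1 = (axis 1 1 :: real^2)"
    define E2 where "E2 = (axis 2 1 :: real^2)"
    have sym: "A E2 $ 1 = A E1 $ 2"
    proof -
      have "A E2 \<bullet> E1 = A E1 \<bullet> E2"
        by (rule hessian_symmetric[OF \<Omega> x(1) GDERIV_grad A]) (use u in \<open>simp add: C2_on_def\<close>)
      then show ?thesis by (simp add: E1_def E2_def inner_axis)
    qed
    have tr: "A E1 $ 1 + lam\<^sup>2 * A E2 $ 2 = 0"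
    proof -
      have "((\<lambda>y. L_mat \<mu> lam *v grad u y) has_derivative (\<lambda>h. L_mat \<mu> lam *v A h)) (at x)"
        by (rule bounded_linear.has_derivative[OF matrix_vector_mul_bounded_linear A])
      then have "frechet_derivative (\<lambda>y. L_mat \<mu> lam *v grad u y) (at x) = (\<lambda>h. L_mat \<mu> lam *v A h)"
        by (rule frechet_derivative_at[symmetric])
      then have "divergence (\<lambda>y. L_mat \<mu> lam *v grad u y) x = \<mu> * (A E1 $ 1 + lam\<^sup>2 * A E2 $ 2)"
        by (simp add: divergence_def jacobian_def trace_def matrix_def sum_2 L_mat_mult E1_def E2_def algebra_simps)
      then show ?thesis using div[OF x(1)] mu by simp
    qed
    have Ah: "A h = (h$1) *\<^sub>R A E1 + (h$2) *\<^sub>R A E2" for h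
    proof -
      have "h = (h$1) *\<^sub>R E1 + (h$2) *\<^sub>R E2" by (simp add: vec_eq_iff forall_2 E1_def E2_def axis_def)
      then show ?thesis by (metis linear_add[OF lin] linear_scale[OF lin])
    qed
    define f' where "f' = Complex (- A E2 $ 2) (- A E2 $ 1 / lam)"
    have "(grad u has_derivative A) (at (unstretch lam z))" using A uz by simp
    from has_derivative_compose[OF bounded_linear.has_derivative[OF bounded_linear_unstretch has_derivative_ident] this]
    have "((\<lambda>z. grad u (unstretch lam z)) has_derivative (\<lambda>k. A (unstretch lam k))) (at z)" .
    from bounded_linear.has_derivative[OF bounded_linear_complex_gradient this]
    have "((\<lambda>z. complex_gradient lam (grad u (unstretch lam z))) has_derivative
       (\<lambda>k. complex_gradient lam (A (unstretch lam k)))) (at z)" .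
    moreover have "(\<lambda>k. complex_gradient lam (A (unstretch lam k))) = (*) f'"
    proof
      fix k
      have a: "A E1 $ 1 = - (lam\<^sup>2 * A E2 $ 2)" using tr by simp
      show "complex_gradient lam (A (unstretch lam k)) = f' * k"
        using lam unfolding Ah[of "unstretch lam k"]
        by (simp add: complex_gradient_def unstretch_def f'_def complex_eq_iff sym[symmetric] a power2_eq_square field_simps)
    qed
    ultimately show ?thesis by (auto simp: has_field_derivative_def)
  qed
  then show ?thesis using \<Omega> stretch_image_properties(1)[OF lam] by (simp add: holomorphic_on_open)
qed

text \<open>
  The derivative in direction \<open>h\<close> of this stream function is \<open>Im (E * stretch lam h)\<close>, where
  \<open>E\<close> is the total field, kernels included.
\<close>

lemma GDERIV_stream_function:
  fixes a :: "'n::finite \<Rightarrow> complex" and b :: "'n \<Rightarrow> real"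
  assumes H: "(H has_field_derivative f) (at (stretch lam x))" and ne: "\<And>i. stretch lam x \<noteq> a i"
  shows "GDERIV (\<lambda>x. Im (H (stretch lam x)) - log_potential b a (stretch lam x)) x
     :> (let E = f + (\<Sum>i\<in>UNIV. b i / (2 * pi * \<i>) * (1 / (stretch lam x - a i))) in vector [lam * Im E, Re E])"
proof -
  let ?z = "stretch lam x"
  define E where "E = f + (\<Sum>i\<in>UNIV. b i / (2 * pi * \<i>) * (1 / (?z - a i)))"
  note st = bounded_linear.has_derivative[OF bounded_linear_stretch has_derivative_ident, of lam "at x"]
  have 1: "((\<lambda>x. Im (H (stretch lam x))) has_derivative (\<lambda>h. Im (f * stretch lam h))) (at x)"
    using has_derivative_compose[OF st H[unfolded has_field_derivative_def]]
    by (rule bounded_linear.has_derivative[OF bounded_linear_Im])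
  have 2: "((\<lambda>x. b i / (2 * pi) * ln (cmod (stretch lam x - a i))) has_derivative
     (\<lambda>h. - Im (b i / (2 * pi * \<i>) * (1 / (?z - a i)) * stretch lam h))) (at x)" for i
  proof -
    let ?w = "?z - a i"
    have w: "?w \<noteq> 0" using ne[of i] by simp
    have "((\<lambda>x. stretch lam x - a i) has_derivative (\<lambda>h. stretch lam h)) (at x)"
      using has_derivative_diff[OF st has_derivative_const[of "a i"]] by simp
    from has_derivative_compose[OF this has_derivative_norm[OF w]]
    have n: "((\<lambda>x. cmod (stretch lam x - a i)) has_derivative (\<lambda>h. stretch lam h \<bullet> sgn ?w)) (at x)" .
    have "((\<lambda>x. b i / (2 * pi) * ln (cmod (stretch lam x - a i))) has_derivative
      (\<lambda>h. b i / (2 * pi) * (stretch lam h \<bullet> sgn ?w / cmod ?w))) (at x)"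
    proof -
      have "(ln has_derivative (*) (inverse (cmod ?w))) (at (cmod ?w))"
        using DERIV_ln[of "cmod ?w"] w unfolding has_field_derivative_def by simp
      from has_derivative_mult_right[OF has_derivative_compose[OF n this], of "b i / (2 * pi)"]
      show ?thesis by (simp only: divide_inverse mult.commute[of "inverse (cmod ?w)"])
    qed
    moreover have "b i / (2 * pi) * (k \<bullet> sgn ?w / cmod ?w) = - Im (b i / (2 * pi * \<i>) * (1 / ?w) * k)" for k
    proof -
      have "k \<bullet> sgn ?w / cmod ?w = (k \<bullet> ?w) / (cmod ?w)\<^sup>2"
        by (simp add: sgn_div_norm divide_inverse power2_eq_square)
      also have "\<dots> = Re (k / ?w)" by (simp only: Re_divide inner_complex_def cmod_power2)
      finally have k: "k \<bullet> sgn ?w / cmod ?w = Re (k / ?w)" .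
      have "b i / (2 * pi * \<i>) * (1 / ?w) * k = complex_of_real (b i / (2 * pi)) * (- \<i> * (k / ?w))"
        using w by (simp add: field_simps)
      moreover have "Im (complex_of_real r * (- \<i> * y)) = - (r * Re y)" for r y by simp
      ultimately have "Im (b i / (2 * pi * \<i>) * (1 / ?w) * k) = - (b i / (2 * pi) * Re (k / ?w))" by metis
      then show ?thesis using k by simp
    qed
    ultimately show ?thesis by simp
  qed
  have "((\<lambda>x. Im (H (stretch lam x)) - log_potential b a (stretch lam x)) has_derivative
     (\<lambda>h. Im (f * stretch lam h) - (\<Sum>i\<in>UNIV. - Im (b i / (2 * pi * \<i>) * (1 / (?z - a i)) * stretch lam h)))) (at x)"
    by (intro has_derivative_diff 1 has_derivative_sum 2)
  moreover have "(\<lambda>h. Im (f * stretch lam h) - (\<Sum>i\<in>UNIV. - Im (b i / (2 * pi * \<i>) * (1 / (?z - a i)) * stretch lam h)))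
     = (\<lambda>h. h \<bullet> vector [lam * Im E, Re E])"
  proof
    fix h
    have "Im (f * stretch lam h) - (\<Sum>i\<in>UNIV. - Im (b i / (2 * pi * \<i>) * (1 / (?z - a i)) * stretch lam h))
      = Im (E * stretch lam h)"
      by (simp only: E_def distrib_right sum_distrib_right plus_complex.sel Im_sum sum_negf)
    also have "\<dots> = h \<bullet> vector [lam * Im E, Re E]"
      by (simp add: stretch_def inner_vec_def sum_2 algebra_simps)
    finally show "Im (f * stretch lam h) - (\<Sum>i\<in>UNIV. - Im (b i / (2 * pi * \<i>) * (1 / (?z - a i)) * stretch lam h))
      = h \<bullet> vector [lam * Im E, Re E]" .
  qed
  ultimately show ?thesis unfolding gderiv_def E_def Let_def by simp
qed

lemma open_config_domain:
  assumes "open \<Omega>"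
  shows "open (config_domain \<Omega> :: (real^2^'n::finite) set)"
proof -
  have "config_domain \<Omega> = (\<Inter>i\<in>(UNIV::'n set). {Z. Z $ i \<in> \<Omega>}) \<inter>
      (\<Inter>j\<in>(UNIV::'n set). \<Inter>k\<in>UNIV - {j}. {Z. Z $ j \<noteq> Z $ k})"
    by (auto simp: config_domain_def)
  moreover have "open {Z :: real^2^'n. Z $ i \<in> \<Omega>}" for i
    using open_vimage[OF assms, of "\<lambda>Z. Z $ i"] by (simp add: vimage_def continuous_on_component)
  moreover have "open {Z :: real^2^'n. Z $ j \<noteq> Z $ k}" for j k
    by (intro open_Collect_neq continuous_intros)
  ultimately show ?thesis by (auto intro!: open_Int open_INT)
qed

lemma C2_holder_has_continuous_deriv:
  assumes "C2_holder \<gamma> \<phi>"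
  shows "(\<phi> has_real_derivative deriv \<phi> s) (at s)" "continuous_on UNIV (deriv \<phi>)" "continuous_on UNIV \<phi>"
proof -
  have d: "\<And>s. \<phi> differentiable (at s)" "\<And>s. deriv \<phi> differentiable (at s)"
    using assms by (auto simp: C2_holder_def)
  show "(\<phi> has_real_derivative deriv \<phi> s) (at s)"
    using d(1) by (simp add: DERIV_deriv_iff_real_differentiable)
  show "continuous_on UNIV (deriv \<phi>)" "continuous_on UNIV \<phi>"
    using d by (auto intro!: continuous_at_imp_continuous_on differentiable_imp_continuous_within)
qed

text \<open>
  By the Neumann condition the gradient of the total stream function is normal to the boundary.
\<close>

lemma stream_function_locally_constant_on_frontier:
  fixes b :: "'n::finite \<Rightarrow> real" and Z :: "real^2^'n"
  assumes \<Omega>: "open \<Omega>" and bd: "C2_holder_boundary \<gamma> \<Omega>" and mu: "\<mu> \<noteq> 0" and lam: "lam \<noteq> 0"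
    and Z: "\<And>i. Z $ i \<in> \<Omega>" and sol: "neumann_solution \<Omega> \<mu> lam b Z u"
    and H: "\<And>z. z \<in> stretch lam ` \<Omega> \<Longrightarrow>
      (H has_field_derivative complex_gradient lam (grad u (unstretch lam z))) (at z)"
    and p: "p \<in> frontier \<Omega>"
  obtains \<delta> c where "\<delta> > 0"
    "\<And>q. q \<in> frontier \<Omega> \<inter> ball p \<delta> \<Longrightarrow>
       ((\<lambda>x. Im (H (stretch lam x)) - log_potential b (\<lambda>i. stretch lam (Z $ i)) (stretch lam x))
          \<longlongrightarrow> c) (at q within \<Omega>)"
proof -
  obtain w where w: "continuous_on (closure \<Omega>) w" "\<And>x. x \<in> \<Omega> \<Longrightarrow> w x = grad u x"
    and bc: "\<And>x \<nu>. x \<in> frontier \<Omega> \<Longrightarrow> outer_unit_normal \<Omega> x \<nu> \<Longrightarrow>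
           (L_mat \<mu> lam *v (w x + (\<Sum>i\<in>UNIV. strain_kernel lam (b i) x (Z $ i)))) \<bullet> \<nu> = 0"
    using sol unfolding neumann_solution_def by blast
  obtain r e1 e2 \<phi> where lg: "local_graph \<Omega> p r e1 e2 \<phi>" and \<phi>: "C2_holder \<gamma> \<phi>"
    using bd p unfolding C2_holder_boundary_def by blast
  note d\<phi> = C2_holder_has_continuous_deriv[OF \<phi>]
  have ON: "norm e1 = 1" "norm e2 = 1" "e1 \<bullet> e2 = 0" and r: "r > 0"
    using lg unfolding local_graph_def by blast+
  have pn: "p \<notin> \<Omega>" using p \<Omega> frontier_disjoint_eq by blast
  define Q where "Q = range (\<lambda>i. Z $ i)"
  have "p \<notin> Q" using pn Z by (auto simp: Q_def)
  moreover have "closed Q" unfolding Q_def by (intro finite_imp_closed) simp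
  ultimately obtain r1 where r1: "r1 > 0" "ball p r1 \<inter> Q = {}"
    using openE[of "- Q" p] unfolding closed_def by (metis ComplI disjoint_eq_subset_Compl)
  define \<rho> where "\<rho> = min r r1"
  have \<rho>: "0 < \<rho>" "\<rho> \<le> r" "\<rho> \<le> r1" using r r1 by (auto simp: \<rho>_def)
  have away: "stretch lam x \<noteq> stretch lam (Z $ i)" if "x \<in> ball p \<rho>" for x i
  proof
    assume "stretch lam x = stretch lam (Z $ i)"
    then have "x = Z $ i" using inj_stretch[OF lam] by (simp add: inj_eq)
    then have "x \<in> ball p r1 \<inter> Q" using that \<rho> by (auto simp: Q_def)
    then show False using r1 by blast
  qed
  define E where "E x = complex_gradient lam (w x) +
      (\<Sum>i\<in>UNIV. b i / (2 * pi * \<i>) * (1 / (stretch lam x - stretch lam (Z $ i))))" for x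
  define A where "A x = (vector [lam * Im (E x), Re (E x)] :: real^2)" for x
  have E: "E x = complex_gradient lam (w x + (\<Sum>i\<in>UNIV. strain_kernel lam (b i) x (Z $ i)))" for x
    using bounded_linear.linear[OF bounded_linear_complex_gradient, of lam]
    by (simp add: E_def linear_add linear_sum complex_gradient_strain_kernel[OF lam])
  have A_inner: "A x \<bullet> h = Im (E x * stretch lam h)" for x h
    by (simp add: A_def stretch_def inner_vec_def sum_2 algebra_simps)
  define S where "S x = Im (H (stretch lam x)) - log_potential b (\<lambda>i. stretch lam (Z $ i)) (stretch lam x)" for x
  have contE: "continuous_on (closure \<Omega> \<inter> ball p \<rho>) E"
    unfolding E_def
    by (intro continuous_intros continuous_on_subset[OF w(1)]
        bounded_linear.continuous_on[OF bounded_linear_complex_gradient]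
        bounded_linear.continuous_on[OF bounded_linear_stretch]) (use away in auto)
  have "continuous_on (closure \<Omega> \<inter> ball p \<rho>) (\<lambda>x. (lam * Im (E x)) *\<^sub>R axis 1 1 + Re (E x) *\<^sub>R axis 2 (1::real) :: real^2)"
    by (intro continuous_intros contE)
  moreover have "A x = (lam * Im (E x)) *\<^sub>R axis 1 1 + Re (E x) *\<^sub>R axis 2 (1::real)" for x
    by (simp add: A_def vec_eq_iff forall_2 axis_def)
  ultimately have contA: "continuous_on (closure \<Omega> \<inter> ball p \<rho>) A" by simp
  have GS: "GDERIV S x :> A x" if x: "x \<in> \<Omega> \<inter> ball p \<rho>" for x
  proof -
    have "(H has_field_derivative complex_gradient lam (w x)) (at (stretch lam x))"
      using H[of "stretch lam x"] x lam w(2) by (simp add: unstretch_stretch)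
    from GDERIV_stream_function[where a="\<lambda>i. stretch lam (Z $ i)" and b=b, OF this away]
    show ?thesis using x unfolding S_def[abs_def] A_def E_def Let_def by blast
  qed
  have tan: "A q \<bullet> (e1 + deriv \<phi> ((q - p) \<bullet> e1) *\<^sub>R e2) = 0" if q: "q \<in> frontier \<Omega> \<inter> ball p \<rho>" for q
  proof -
    define s where "s = (q - p) \<bullet> e1"
    \<comment> \<open>the chart recentred at \<^term>\<open>q\<close>, which yields the outer normal there\<close>
    define \<phi>s where "\<phi>s t = \<phi> (s + t) - \<phi> s" for t
    have qr: "q \<in> frontier \<Omega>" "q \<in> ball p r" using q \<rho> by auto
    have "local_graph \<Omega> q (r - dist p q) e1 e2 \<phi>s"
      unfolding \<phi>s_def[abs_def] s_def by (rule local_graph_recentre[OF \<Omega> lg d\<phi>(3) qr])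
    moreover have ds: "(\<phi>s has_real_derivative deriv \<phi> (s + t)) (at t)" for t
      unfolding \<phi>s_def[abs_def] using DERIV_shift[of \<phi> "deriv \<phi> (s + t)" t s] d\<phi>(1)[of "s + t"]
      by (auto intro!: derivative_eq_intros simp: add.commute)
    then have "\<forall>t. \<phi>s differentiable (at t)" using real_differentiable_def by blast
    moreover have "deriv \<phi>s 0 = deriv \<phi> s" using DERIV_imp_deriv[OF ds[of 0]] by simp
    ultimately have "outer_unit_normal \<Omega> q ((1 / sqrt (1 + (deriv \<phi> s)\<^sup>2)) *\<^sub>R (e2 - deriv \<phi> s *\<^sub>R e1))"
      unfolding outer_unit_normal_def by metis
    from bc[OF qr(1) this]
    have "(L_mat \<mu> lam *v (w q + (\<Sum>i\<in>UNIV. strain_kernel lam (b i) q (Z $ i)))) \<bullet> (e2 - deriv \<phi> s *\<^sub>R e1) = 0"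
      by (simp add: add_nonneg_eq_0_iff)
    then show ?thesis unfolding A_inner E s_def[symmetric]
      by (rule conormal_zero_imp_tangential_Im_zero[OF ON mu lam])
  qed
  obtain \<delta> c where "\<delta> > 0" "\<And>q. q \<in> frontier \<Omega> \<inter> ball p \<delta> \<Longrightarrow> (S \<longlongrightarrow> c) (at q within \<Omega>)"
    by (rule tangential_boundary_limit[OF \<Omega> p lg d\<phi>(1,2) \<rho>(1,2) contA GS tan]) blast+
  then show thesis using that unfolding S_def by blast
qed

text \<open>
  Simple connectedness of a bounded domain makes its frontier connected, so the locally constant
  boundary value is a single constant; without this the conjugate Dirichlet problem would
  not be determined by the Neumann problem.
\<close>

lemma stream_function_constant_on_frontier:
  fixes b :: "'n::finite \<Rightarrow> real" and Z :: "real^2^'n"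
  assumes \<Omega>: "open \<Omega>" "bounded \<Omega>" "simply_connected \<Omega>"
    and bd: "C2_holder_boundary \<gamma> \<Omega>" and mu: "\<mu> \<noteq> 0" and lam: "lam \<noteq> 0"
    and Z: "\<And>i. Z $ i \<in> \<Omega>" and sol: "neumann_solution \<Omega> \<mu> lam b Z u"
    and H: "\<And>z. z \<in> stretch lam ` \<Omega> \<Longrightarrow>
      (H has_field_derivative complex_gradient lam (grad u (unstretch lam z))) (at z)"
  obtains c where "\<And>q. q \<in> frontier (stretch lam ` \<Omega>) \<Longrightarrow>
       ((\<lambda>z. Im (H z) - log_potential b (\<lambda>i. stretch lam (Z $ i)) z)
          \<longlongrightarrow> c) (at q within stretch lam ` \<Omega>)"
proof -
  define D where "D = stretch lam ` \<Omega>"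
  define T where "T z = Im (H z) - log_potential b (\<lambda>i. stretch lam (Z $ i)) z" for z
  have D: "open D" "bounded D" "simply_connected D" "frontier D = stretch lam ` frontier \<Omega>"
    using \<Omega> stretch_image_properties[OF lam, of \<Omega>] by (auto simp: D_def)
  have conn: "connected (frontier D)"
    using D simply_connected_eq_frontier_properties[of D] by simp
  have transfer: "(T \<longlongrightarrow> c) (at (stretch lam q) within D)"
    if "((\<lambda>x. T (stretch lam x)) \<longlongrightarrow> c) (at q within \<Omega>)" for q c
  proof -
    have "filterlim (unstretch lam) (at q within \<Omega>) (at (stretch lam q) within D)"
      unfolding filterlim_at
    proof
      show "\<forall>\<^sub>F z in at (stretch lam q) within D. unstretch lam z \<in> \<Omega> \<and> unstretch lam z \<noteq> q"
        unfolding eventually_at_filter D_def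
        by (rule always_eventually) (auto simp: unstretch_stretch[OF lam])
      have "(unstretch lam \<longlongrightarrow> unstretch lam (stretch lam q)) (at (stretch lam q) within D)"
        by (rule bounded_linear.tendsto[OF bounded_linear_unstretch]) (rule tendsto_ident_at)
      then show "(unstretch lam \<longlongrightarrow> q) (at (stretch lam q) within D)" by (simp add: unstretch_stretch[OF lam])
    qed
    from filterlim_compose[OF that this] show ?thesis by (simp add: stretch_unstretch[OF lam])
  qed
  have nontriv: "at \<xi> within D \<noteq> bot" if "\<xi> \<in> frontier D" for \<xi>
  proof -
    have "\<xi> \<notin> D" "\<xi> \<in> closure D" using that D(1) frontier_disjoint_eq[of D] by (auto simp: frontier_def)
    then have "\<xi> islimpt D" by (auto simp: closure_def)
    then show ?thesis by (simp add: trivial_limit_within)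
  qed
  have local: "\<exists>U c. openin (top_of_set (frontier D)) U \<and> \<zeta> \<in> U \<and> (\<forall>\<xi>\<in>U. (T \<longlongrightarrow> c) (at \<xi> within D))"
    if \<zeta>: "\<zeta> \<in> frontier D" for \<zeta>
  proof -
    obtain p where p: "p \<in> frontier \<Omega>" "\<zeta> = stretch lam p" using \<zeta> D(4) by blast
    obtain \<delta> c where c: "\<delta> > 0" "\<And>q. q \<in> frontier \<Omega> \<inter> ball p \<delta> \<Longrightarrow> ((\<lambda>x. T (stretch lam x)) \<longlongrightarrow> c) (at q within \<Omega>)"
      using stream_function_locally_constant_on_frontier[OF \<Omega>(1) bd mu lam Z sol H p(1)] unfolding T_def by blast
    have "open (stretch lam ` ball p \<delta>)" using stretch_image_properties(1)[OF lam] by simp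
    then have "openin (top_of_set (frontier D)) (frontier D \<inter> stretch lam ` ball p \<delta>)" by (rule openin_open_Int)
    moreover have "\<zeta> \<in> frontier D \<inter> stretch lam ` ball p \<delta>" using \<zeta> p c(1) by auto
    moreover have "(T \<longlongrightarrow> c) (at \<xi> within D)" if \<xi>: "\<xi> \<in> frontier D \<inter> stretch lam ` ball p \<delta>" for \<xi>
    proof -
      obtain q where q: "q \<in> ball p \<delta>" "\<xi> = stretch lam q" using \<xi> by blast
      have "stretch lam q \<in> stretch lam ` frontier \<Omega>" using \<xi> q D(4) by simp
      then have "q \<in> frontier \<Omega>" using inj_image_mem_iff[OF inj_stretch[OF lam]] by blast
      then show ?thesis using transfer[OF c(2)] q by simp
    qed
    ultimately show ?thesis by blast
  qed
  define C where "C \<xi> = Lim (at \<xi> within D) T" for \<xi>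
  have C: "(T \<longlongrightarrow> C \<xi>) (at \<xi> within D)" if \<xi>: "\<xi> \<in> frontier D" for \<xi>
    using local[OF \<xi>] tendsto_Lim[OF nontriv[OF \<xi>]] unfolding C_def by blast
  have "C constant_on frontier D"
  proof (rule locally_constant_imp_constant[OF conn])
    fix \<zeta> assume \<zeta>: "\<zeta> \<in> frontier D"
    obtain U c where U: "openin (top_of_set (frontier D)) U" "\<zeta> \<in> U" "\<And>\<xi>. \<xi> \<in> U \<Longrightarrow> (T \<longlongrightarrow> c) (at \<xi> within D)"
      using local[OF \<zeta>] by blast
    have "C \<xi> = c" if "\<xi> \<in> U" for \<xi>
      using tendsto_unique[OF nontriv C U(3)[OF that]] U(1) that openin_imp_subset by blast
    then show "\<exists>U. openin (top_of_set (frontier D)) U \<and> \<zeta> \<in> U \<and> (\<forall>x\<in>U. C x = C \<zeta>)" using U by blast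
  qed
  then obtain c where c: "\<And>\<xi>. \<xi> \<in> frontier D \<Longrightarrow> C \<xi> = c" by (auto simp: constant_on_def)
  have "(T \<longlongrightarrow> c) (at \<xi> within D)" if "\<xi> \<in> frontier D" for \<xi>
    using C[OF that] c[OF that] by simp
  then show thesis by (rule that[unfolded D_def[symmetric] T_def[symmetric]])
qed

section \<open>The Peach-Koehler force\<close>

lemma riemann_map_exists:
  fixes D :: "complex set"
  assumes "open D" "bounded D" "simply_connected D" "D \<noteq> {}"
  obtains \<psi> \<psi>inv where "riemann_map D \<psi> \<psi>inv"
proof -
  have "D \<noteq> UNIV" using assms(2) not_bounded_UNIV by blast
  then obtain \<psi> \<psi>inv where "\<psi> holomorphic_on D" "\<psi>inv holomorphic_on ball 0 1"
    "\<forall>z\<in>D. \<psi> z \<in> ball 0 1 \<and> \<psi>inv (\<psi> z) = z" "\<forall>z\<in>ball 0 1. \<psi>inv z \<in> D \<and> \<psi> (\<psi>inv z) = z"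
    using Riemann_mapping_theorem[of D] assms by blast
  then have "riemann_map D \<psi> \<psi>inv" using assms by unfold_locales auto
  then show ?thesis by (rule that)
qed

context riemann_map
begin

lemma pk_force_eq_vortex_field:
  fixes b :: "'n::finite \<Rightarrow> real" and Y :: "real^2^'n"
  assumes D_eq: "D = stretch lam ` \<Omega>"
    and \<Omega>: "open \<Omega>" "bounded \<Omega>" "simply_connected \<Omega>"
    and bd: "C2_holder_boundary \<gamma> \<Omega>" and mu: "\<mu> \<noteq> 0" and lam: "lam \<noteq> 0"
    and Y: "Y \<in> config_domain \<Omega>" and sol: "neumann_solution \<Omega> \<mu> lam b Y (u0 Y)"
  shows "pk_force \<mu> lam b u0 l Y =
    b l *\<^sub>R ((J_mat ** L_mat \<mu> lam) *v real_gradient lam (vortex_field b l (\<lambda>i. stretch lam (Y $ i))))"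
proof -
  define f where "f z = complex_gradient lam (grad (u0 Y) (unstretch lam z))" for z
  have YD: "\<And>i. Y $ i \<in> \<Omega>" and Yne: "\<And>i k. i \<noteq> k \<Longrightarrow> Y $ i \<noteq> Y $ k"
    using Y by (auto simp: config_domain_def)
  have "f holomorphic_on D"
    unfolding f_def D_eq
    by (rule complex_gradient_of_solution_holomorphic[OF \<Omega>(1) lam mu])
       (use sol in \<open>auto simp: neumann_solution_def\<close>)
  then obtain H where H: "\<And>z. z \<in> D \<Longrightarrow> (H has_field_derivative f z) (at z)"
    using simply_connected_eq_global_primitive[OF openD] scD by blast
  obtain c where c: "\<And>q. q \<in> frontier D \<Longrightarrow>
       ((\<lambda>z. Im (H z) - log_potential b (\<lambda>i. stretch lam (Y $ i)) z) \<longlongrightarrow> c) (at q within D)"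
    by (rule stream_function_constant_on_frontier[OF \<Omega> bd mu lam YD sol H[unfolded D_eq f_def]]) (auto simp: D_eq)
  have "f (stretch lam (Y $ l)) + (\<Sum>i\<in>UNIV - {l}. b i / (2 * pi * \<i>) * (1 / (stretch lam (Y $ l) - stretch lam (Y $ i))))
      = vortex_field b l (\<lambda>i. stretch lam (Y $ i))"
  proof (rule field_at_vortex[OF H _ _ c])
    show "stretch lam (Y $ i) \<in> D" for i using YD D_eq by blast
    show "stretch lam (Y $ i) \<noteq> stretch lam (Y $ l)" if "i \<noteq> l" for i
      using Yne[OF that] inj_stretch[OF lam] by (simp add: inj_eq)
  qed
  moreover have "complex_gradient lam ((\<Sum>i\<in>UNIV - {l}. strain_kernel lam (b i) (Y $ l) (Y $ i)) + grad (u0 Y) (Y $ l))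
     = f (stretch lam (Y $ l)) + (\<Sum>i\<in>UNIV - {l}. b i / (2 * pi * \<i>) * (1 / (stretch lam (Y $ l) - stretch lam (Y $ i))))"
    using bounded_linear.linear[OF bounded_linear_complex_gradient, of lam]
    by (simp add: f_def linear_add linear_sum complex_gradient_strain_kernel[OF lam] unstretch_stretch[OF lam])
  ultimately have "complex_gradient lam ((\<Sum>i\<in>UNIV - {l}. strain_kernel lam (b i) (Y $ l) (Y $ i)) + grad (u0 Y) (Y $ l))
     = vortex_field b l (\<lambda>i. stretch lam (Y $ i))"
    by (rule trans[rotated])
  from arg_cong[OF this, of "real_gradient lam"]
  have "(\<Sum>i\<in>UNIV - {l}. strain_kernel lam (b i) (Y $ l) (Y $ i)) + grad (u0 Y) (Y $ l)
     = real_gradient lam (vortex_field b l (\<lambda>i. stretch lam (Y $ i)))"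
    unfolding real_gradient_complex_gradient[OF lam] .
  then show ?thesis by (simp add: pk_force_def)
qed

end

text \<open>
  Immediate from the closed formula; the Neumann solutions of different configurations are never compared
  with one another.
\<close>

lemma pk_force_lipschitz_differentiable:
  fixes b :: "'n::finite \<Rightarrow> real" and Z :: "real^2^'n"
  assumes \<Omega>: "open \<Omega>" "bounded \<Omega>" "simply_connected \<Omega>"
    and bd: "C2_holder_boundary \<gamma> \<Omega>" and mu: "\<mu> \<noteq> 0" and lam: "lam \<noteq> 0"
    and sol: "\<And>Y. Y \<in> config_domain \<Omega> \<Longrightarrow> neumann_solution \<Omega> \<mu> lam b Y (u0 Y)"
    and Z: "Z \<in> config_domain \<Omega>"
  shows "lipschitz_differentiable_at (pk_force \<mu> lam b u0 l) Z"
proof -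
  have ZD: "\<And>i. Z $ i \<in> \<Omega>" and Zne: "\<And>i k. i \<noteq> k \<Longrightarrow> Z $ i \<noteq> Z $ k"
    using Z by (auto simp: config_domain_def)
  have "stretch lam ` \<Omega> \<noteq> {}" using ZD by blast
  then obtain \<psi> \<psi>inv where "riemann_map (stretch lam ` \<Omega>) \<psi> \<psi>inv"
    using riemann_map_exists stretch_image_properties[OF lam, of \<Omega>] \<Omega> by blast
  then interpret riemann_map "stretch lam ` \<Omega>" \<psi> \<psi>inv .
  show ?thesis
  proof (rule lipschitz_differentiable_at_transform[OF _ open_config_domain[OF \<Omega>(1)] Z])
    show "pk_force \<mu> lam b u0 l Y =
        b l *\<^sub>R ((J_mat ** L_mat \<mu> lam) *v real_gradient lam (vortex_field b l (\<lambda>i. stretch lam (Y $ i))))"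
      if "Y \<in> config_domain \<Omega>" for Y
      by (rule pk_force_eq_vortex_field[of lam \<Omega> \<gamma> \<mu> Y b u0, OF refl \<Omega> bd mu lam that sol[OF that]])
    have "lipschitz_differentiable_at (\<lambda>Y. vortex_field b l (\<lambda>i. stretch lam (Y $ i))) Z"
    proof (rule vortex_field_lipschitz_differentiable)
      show "lipschitz_differentiable_at (\<lambda>Y. stretch lam (Y $ i)) Z" for i
        by (intro lipschitz_differentiable_at_bounded_linear bounded_linear_compose[OF bounded_linear_stretch] bounded_linear_vec_nth)
      show "stretch lam (Z $ i) \<in> stretch lam ` \<Omega>" for i using ZD by blast
      show "stretch lam (Z $ i) \<noteq> stretch lam (Z $ l)" if "i \<noteq> l" for i
        using Zne[OF that] inj_stretch[OF lam] by (simp add: inj_eq)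
    qed
    then show "lipschitz_differentiable_at (\<lambda>Y. b l *\<^sub>R ((J_mat ** L_mat \<mu> lam) *v
        real_gradient lam (vortex_field b l (\<lambda>i. stretch lam (Y $ i))))) Z"
      by (intro lipschitz_differentiable_at_linear_compose[OF bounded_linear_scaleR_right]
          lipschitz_differentiable_at_linear_compose[OF matrix_vector_mul_bounded_linear]
          lipschitz_differentiable_at_linear_compose[OF bounded_linear_real_gradient])
  qed
qed

section \<open>Uniqueness and crossing\<close>

theorem theorem2p21:
  fixes \<Omega> :: "(real^2) set" and \<gamma> \<mu> lam T t1 r :: real
    and b :: "'n::finite \<Rightarrow> real"
    and u0 :: "real^2^'n \<Rightarrow> real^2 \<Rightarrow> real"
    and j :: "'n \<Rightarrow> real^2^'n \<Rightarrow> real^2"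
    and G :: "(real^2) set"
    and Z :: "real \<Rightarrow> real^2^'n"
    and Z0 Z1 \<nu> :: "real^2^'n"
    and l :: 'n
    and gp gm :: "real^2"
    and Vp Vm :: "(real^2^'n) set"
  assumes "open \<Omega>" "bounded \<Omega>" "simply_connected \<Omega>"
    and "0 < \<gamma>" "\<gamma> < 1" "C2_holder_boundary \<gamma> \<Omega>"
    and "\<mu> > 0" "lam \<noteq> 0"
    and "\<forall>Y\<in>config_domain \<Omega>. neumann_solution \<Omega> \<mu> lam b Y (u0 Y)"
    and "j = pk_force \<mu> lam b u0"
    and "glide_directions G"
    and "T > 0"
    and "inclusion_solution \<Omega> G j {-T..T} Z"
    and "Z0 \<in> config_domain \<Omega>" "Z 0 = Z0"
    and "t1 \<in> {-T<..<T}"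
    and "Z1 \<in> regular_ambiguity_set \<Omega> G j l" "Z t1 = Z1"
    and "max_glide G j l Z1 = {gp, gm}"
    and "r > 0"
    and "Vp = side \<Omega> G j l Z1 r gp" "Vm = side \<Omega> G j l Z1 r gm"
    and "unit_normal_from_to (ambiguity_set \<Omega> G j l) Vm Vp Z1 \<nu>"
  shows "(local_field G j l Z1 gm Z1 \<bullet> \<nu> > 0 \<and> local_field G j l Z1 gp Z1 \<bullet> \<nu> > 0
            \<longrightarrow> uniqueness_at \<Omega> G j t1 Z1 \<and> passes_from_to Z t1 Vm Vp {-T..T}) \<and>
         (local_field G j l Z1 gm Z1 \<bullet> \<nu> < 0 \<and> local_field G j l Z1 gp Z1 \<bullet> \<nu> < 0
            \<longrightarrow> uniqueness_at \<Omega> G j t1 Z1 \<and> passes_from_to Z t1 Vp Vm {-T..T})"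
proof -
  note regular = \<open>Z1 \<in> regular_ambiguity_set \<Omega> G j l\<close>
  have dom: "Z1 \<in> config_domain \<Omega>"
    using regular by (simp add: regular_ambiguity_set_def ambiguity_set_def)
  have smooth: "lipschitz_differentiable_at (j k) Z1" for k
    unfolding \<open>j = pk_force \<mu> lam b u0\<close>
    using assms(1,2,3,6,7,8,9) dom by (intro pk_force_lipschitz_differentiable) auto
  obtain \<rho> L where \<rho>: "\<rho> > 0" "ball Z1 \<rho> \<subseteq> config_domain \<Omega>" "\<And>k. L-lipschitz_on (ball Z1 \<rho>) (j k)"
    by (rule lipschitz_differentiable_at_uniform[of j, OF smooth open_config_domain[OF \<open>open \<Omega>\<close>] dom]) blast
  have diff: "j l differentiable (at Z1)" using smooth by (simp add: lipschitz_differentiable_at_def)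
  have glide: "max_glide G j l Z1 = {gp, gm}" "max_glide G j l Z1 = {gm, gp}"
    using \<open>max_glide G j l Z1 = {gp, gm}\<close> by auto
  note normal = \<open>unit_normal_from_to (ambiguity_set \<Omega> G j l) Vm Vp Z1 \<nu>\<close>[unfolded \<open>Vp = _\<close> \<open>Vm = _\<close>]
  note crossing = crossing_of_regular_ambiguity_set[OF \<open>glide_directions G\<close> regular _ \<open>r > 0\<close> _ \<rho> diff _ _
      \<open>inclusion_solution \<Omega> G j {-T..T} Z\<close> \<open>t1 \<in> {-T<..<T}\<close> \<open>Z t1 = Z1\<close>]
  \<comment> \<open>exchanging \<^term>\<open>gp\<close> and \<^term>\<open>gm\<close> reverses the normal, which gives the second case\<close>
  show ?thesis
    unfolding \<open>Vp = _\<close> \<open>Vm = _\<close>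
    using crossing[OF glide(1) normal] crossing[OF glide(2) unit_normal_from_to_uminus[OF normal]]
    by simp
qed

end
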